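(* Let $\theta>0$. Every uniform logarithmic combinatorial structure $(\mathbb P_n)_{n\in\mathbb N}$ with parameter $\theta$ is asymptotically Ewens with parameter $\theta$.
   Context: Partitions. $\mathcal P_n$ is the set of partitions of $n$, written $\alpha=(\alpha_1,\ldots,\alpha_n)$, where $\alpha_i\ge0$ is the number of parts of size $i$, so $\alpha_1+2\alpha_2+\cdots+n\alpha_n=n$. A vector $(\alpha_1,\ldots,\alpha_m)$ of nonnegative integers is regarded as a partition of $k=\sum_{i\le m} i\alpha_i$ (discarding or appending zeros as needed; $k=0$ gives the empty partition). Uniform logarithmic combinatorial structure. This is a sequence of probability measures $\mathbb P_n$ on $\mathcal P_n$, $n\in\mathbb N$, such that: (1) (Conditioning relation) there is a sequence of independent nonnegative-integer-valued random variables $Y_1,Y_2,\ldots$ such that, for all $n$ and all $\alpha\in\mathcal P_n$, $\mathbb P_n(\alpha)=\mathbb P\big[\forall i\le n,\ Y_i=\alpha_i\ \big|\ \sum_{i\le n}iY_i=n\big]$ (the conditioning events having positive probability for every $n$); and (2) (Uniform logarithmic condition, with parameter $\theta>0$) for every $i\ge1$, $\big|i\,\mathbb P[Y_i=1]-\theta\big|\le e_i$ and $i\,\mathbb P[Y_i=\ell]\le e_ic_\ell$ for all $\ell\ge2$, where $(e_i)$ and $(c_\ell)$ are nonnegative sequences tending to $0$ with $\sum_i e_i/i<\infty$ and $\sum_\ell \ell c_\ell<\infty$. Ewens measure. For $\theta>0$, $\mathbb P^\theta_n(\alpha)=\frac{n!}{\theta(\theta+1)\cdots(\theta+n-1)}\prod_{i=1}^n\frac{\theta^{\alpha_i}}{i^{\alpha_i}\alpha_i!}$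 for $\alpha\in\mathcal P_n$. Perturbed measures. Given a nonnegative function $\eta$ on the set of all partitions of all integers $k\ge0$, let $\mathbb P^{\theta,\eta}_n(\alpha)=\frac{\eta(\alpha)}{Z^{\theta,\eta}_n}\prod_{i=1}^n\frac{\theta^{\alpha_i}}{i^{\alpha_i}\alpha_i!}$ for $\alpha\in\mathcal P_n$, where $Z_n^{\theta,\eta}$ is the normalising constant (assumed positive for every $n\in\mathbb N$). Thus $\eta$ restricted to $\mathcal P_n$ is a positive constant multiple of the Radon-Nikodym derivative of $\mathbb P^{\theta,\eta}_n$ with respect to $\mathbb P^\theta_n$. Feller coupling. For a binary sequence $\xi=(\xi_1,\xi_2,\ldots)\in\{0,1\}^{\mathbb N}$ with $\xi_1=1$ and $n\in\mathbb N$, define the partition $(\alpha_1(n),\ldots,\alpha_n(n))\in\mathcal P_n$ by $$\alpha_i(n)=\sum_{j=1}^{n-i}\xi_j(1-\xi_{j+1})\cdots(1-\xi_{j+i-1})\xi_{i+j}+\xi_{n-i+1}(1-\xi_{n-i+2})\cdots(1-\xi_n),$$ i.e. the number of maximal runs of exactly $i-1$ zeros between consecutive $1$s in the string $(\xi_1,\ldots,\xi_n,1)$. Let $\mathbb P^\theta_F$ be the probability measure on $\{0,1\}^{\mathbb N}$ under which the $\xi_i$ are independent Bernoulli with success probability $\theta/(\theta+i-1)$ (so $\xi_1=1$ almost surely); the law of $(\alpha_1(n),\dots,\alpha_n(n))$ under $\mathbb P_F^\theta$ is $\mathbb P^\theta_n$. Expectation under $\mathbb P^\theta_F$ is $\mathbb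 E^\theta_F$. Asymptotically Ewens. Given a nonnegative function $\eta$ on the set of all partitions of all integers $k\ge0$, for $m\le n$ define the random variables (under $\mathbb P^\theta_F$) $\eta_{n,m}=\eta(\alpha_1(n),\ldots,\alpha_m(n))$. A sequence of measures $\mathbb P_n$ on $\mathcal P_n$, $n\in\mathbb N$, is asymptotically Ewens with parameter $\theta$ if it can be written as $\mathbb P_n=\mathbb P_n^{\theta,\eta}$ for some nonnegative function $\eta$ on the set of all partitions of all integers $k\ge0$, with $Z_n^{\theta,\eta}>0$ for every $n\in\mathbb N$, such that (1) the limits $\lim_{n\to\infty}\eta_{n,n}$ and $\lim_{m\to\infty}\lim_{n\to\infty}\eta_{n,m}$ exist and agree in $L^1(\mathbb P^\theta_F)$; and (2) the common limit $\eta_\infty$ satisfies $0<\mathbb E^\theta_F[\eta_\infty]<\infty$. *)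

theory Defs
  imports "HOL-Probability.Probability"
begin

text \<open>
  A partition is given by its multiplicities: \<open>\<alpha> i\<close> is the number of parts of size \<open>i\<close>.
  Since \<open>\<alpha>\<close> vanishes outside the relevant range, appending or discarding zeros
  does not change it.
\<close>

definition partitions_of :: "nat \<Rightarrow> (nat \<Rightarrow> nat) set" where
  "partitions_of n = {\<alpha>. (\<forall>i. i \<notin> {1..n} \<longrightarrow> \<alpha> i = 0) \<and> (\<Sum>i=1..n. i * \<alpha> i) = n}"

lemma finite_partitions_of: "finite (partitions_of n)"
proof (rule finite_subset)
  show "partitions_of n \<subseteq> {f. \<forall>i. (i \<in> {1..n} \<longrightarrow> f i \<in> {0..n}) \<and> (i \<notin> {1..n} \<longrightarrow> f i = 0)}"
  proof safe
    fix \<alpha> i assume \<alpha>: "\<alpha> \<in> partitions_of n" and i: "i \<in> {1..n}"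
    have "\<alpha> i \<le> i * \<alpha> i" using i by simp
    also have "\<dots> \<le> (\<Sum>i=1..n. i * \<alpha> i)" using i by (intro member_le_sum) auto
    also have "\<dots> = n" using \<alpha> by (simp add: partitions_of_def)
    finally show "\<alpha> i \<in> {0..n}" by simp
  qed (simp add: partitions_of_def)
qed (intro finite_set_of_finite_funs; simp)

text \<open>Sequences of measures are indexed by \<open>n \<ge> 1\<close>; the value at \<open>0\<close> is irrelevant.\<close>

definition partition_measures :: "(nat \<Rightarrow> (nat \<Rightarrow> nat) pmf) \<Rightarrow> bool" where
  "partition_measures P \<longleftrightarrow> (\<forall>n\<ge>1. set_pmf (P n) \<subseteq> partitions_of n)"

definition conditioning_relation ::
  "'a measure \<Rightarrow> (nat \<Rightarrow> 'a \<Rightarrow> nat) \<Rightarrow> (nat \<Rightarrow> (nat \<Rightarrow> nat) pmf) \<Rightarrow> bool" where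
  "conditioning_relation M Y P \<longleftrightarrow>
     (\<forall>n\<ge>1. \<P>(\<omega> in M. (\<Sum>i=1..n. i * Y i \<omega>) = n) > 0 \<and>
        (\<forall>\<alpha>\<in>partitions_of n.
           pmf (P n) \<alpha> =
             \<P>(\<omega> in M. (\<forall>i\<in>{1..n}. Y i \<omega> = \<alpha> i) \<bar> (\<Sum>i=1..n. i * Y i \<omega>) = n)))"

definition uniform_logarithmic_condition ::
  "'a measure \<Rightarrow> (nat \<Rightarrow> 'a \<Rightarrow> nat) \<Rightarrow> real \<Rightarrow> bool" where
  "uniform_logarithmic_condition M Y \<theta> \<longleftrightarrow>
     (\<exists>e c :: nat \<Rightarrow> real.
        (\<forall>i\<ge>1. e i \<ge> 0) \<and> (\<forall>l\<ge>2. c l \<ge> 0) \<and>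
        e \<longlonglongrightarrow> 0 \<and> c \<longlonglongrightarrow> 0 \<and>
        summable (\<lambda>i. e i / real i) \<and> summable (\<lambda>l. real l * c l) \<and>
        (\<forall>i\<ge>1. \<bar>real i * \<P>(\<omega> in M. Y i \<omega> = 1) - \<theta>\<bar> \<le> e i) \<and>
        (\<forall>i\<ge>1. \<forall>l\<ge>2. real i * \<P>(\<omega> in M. Y i \<omega> = l) \<le> e i * c l))"

text \<open>
  The probability space \<open>M\<close> carrying the variables \<open>Y\<close> is an explicit parameter, because HOL cannot
  quantify existentially over its underlying type.
\<close>

definition uniform_logarithmic_structure ::
  "'a measure \<Rightarrow> real \<Rightarrow> (nat \<Rightarrow> (nat \<Rightarrow> nat) pmf) \<Rightarrow> bool" where
  "uniform_logarithmic_structure M \<theta> P \<longleftrightarrow>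
     partition_measures P \<and> prob_space M \<and> \<theta> > 0 \<and>
     (\<exists>Y. prob_space.indep_vars M (\<lambda>_. count_space UNIV) Y {1..} \<and>
          conditioning_relation M Y P \<and> uniform_logarithmic_condition M Y \<theta>)"

definition ewens_weight :: "real \<Rightarrow> nat \<Rightarrow> (nat \<Rightarrow> nat) \<Rightarrow> real" where
  "ewens_weight \<theta> n \<alpha> = (\<Prod>i=1..n. \<theta> ^ \<alpha> i / (real i ^ \<alpha> i * fact (\<alpha> i)))"

definition perturbed_Z :: "real \<Rightarrow> ((nat \<Rightarrow> nat) \<Rightarrow> real) \<Rightarrow> nat \<Rightarrow> real" where
  "perturbed_Z \<theta> \<eta> n = (\<Sum>\<alpha>\<in>partitions_of n. \<eta> \<alpha> * ewens_weight \<theta> n \<alpha>)"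

definition perturbed_prob :: "real \<Rightarrow> ((nat \<Rightarrow> nat) \<Rightarrow> real) \<Rightarrow> nat \<Rightarrow> (nat \<Rightarrow> nat) \<Rightarrow> real" where
  "perturbed_prob \<theta> \<eta> n \<alpha> = \<eta> \<alpha> / perturbed_Z \<theta> \<eta> n * ewens_weight \<theta> n \<alpha>"

text \<open>Binary sequences are indexed by \<open>{1..}\<close>, with \<open>True\<close> standing for \<open>1\<close>.\<close>

definition feller_measure :: "real \<Rightarrow> (nat \<Rightarrow> bool) measure" where
  "feller_measure \<theta> =
     (\<Pi>\<^sub>M i\<in>{1..}. measure_pmf (bernoulli_pmf (\<theta> / (\<theta> + real i - 1))))"

definition feller_count :: "nat \<Rightarrow> (nat \<Rightarrow> bool) \<Rightarrow> nat \<Rightarrow> nat" where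
  "feller_count n \<xi> i =
     (if 1 \<le> i \<and> i \<le> n then
        (\<Sum>j=1..n-i. of_bool (\<xi> j) * (\<Prod>k=j+1..j+i-1. 1 - of_bool (\<xi> k)) * of_bool (\<xi> (i+j)))
        + of_bool (\<xi> (n-i+1)) * (\<Prod>k=n-i+2..n. 1 - of_bool (\<xi> k))
      else 0)"

text \<open>This is \<open>\<eta>(\<alpha>\<^sub>1(n), \<dots>, \<alpha>\<^sub>m(n))\<close>.\<close>

definition eta_trunc :: "((nat \<Rightarrow> nat) \<Rightarrow> real) \<Rightarrow> nat \<Rightarrow> nat \<Rightarrow> (nat \<Rightarrow> bool) \<Rightarrow> real" where
  "eta_trunc \<eta> n m \<xi> = \<eta> (\<lambda>i. if i \<le> m then feller_count n \<xi> i else 0)"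

definition L1_limit :: "'a measure \<Rightarrow> (nat \<Rightarrow> 'a \<Rightarrow> real) \<Rightarrow> ('a \<Rightarrow> real) \<Rightarrow> bool" where
  "L1_limit M f g \<longleftrightarrow>
     eventually (\<lambda>n. integrable M (f n)) sequentially \<and> integrable M g \<and>
     (\<lambda>n. \<integral>x. \<bar>f n x - g x\<bar> \<partial>M) \<longlonglongrightarrow> 0"

text \<open>
  In the following definition, finiteness of the expectation of the common limit \<open>g\<close> is the integrability
  contained in \<^const>\<open>L1_limit\<close>.
\<close>

definition asymptotically_Ewens :: "real \<Rightarrow> (nat \<Rightarrow> (nat \<Rightarrow> nat) pmf) \<Rightarrow> bool" where
  "asymptotically_Ewens \<theta> P \<longleftrightarrow>
     partition_measures P \<and>
     (\<exists>\<eta> :: (nat \<Rightarrow> nat) \<Rightarrow> real.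
        (\<forall>k. \<forall>\<alpha>\<in>partitions_of k. \<eta> \<alpha> \<ge> 0) \<and>
        (\<forall>n\<ge>1. perturbed_Z \<theta> \<eta> n > 0) \<and>
        (\<forall>n\<ge>1. \<forall>\<alpha>\<in>partitions_of n. pmf (P n) \<alpha> = perturbed_prob \<theta> \<eta> n \<alpha>) \<and>
        (\<exists>g h.
           L1_limit (feller_measure \<theta>) (\<lambda>n. eta_trunc \<eta> n n) g \<and>
           (\<forall>m\<ge>1. L1_limit (feller_measure \<theta>) (\<lambda>n. eta_trunc \<eta> n m) (h m)) \<and>
           L1_limit (feller_measure \<theta>) h g \<and>
           (\<integral>\<xi>. g \<xi> \<partial>feller_measure \<theta>) > 0))"

end

theory Submission
  imports Defs
begin

text \<open>
  Let \<open>q\<^sub>i\<close> be the Poisson weights \<open>(\<theta>/i)\<^sup>l / l!\<close> and \<open>t\<^sub>i(l) = P(Y\<^sub>i = l)\<close>, divided by \<open>P(Y\<^sub>i = 0)\<close> for large \<open>i\<close>.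
  Then \<open>P\<^sub>n\<close> is the perturbation of the Ewens measure by \<open>\<eta>(\<alpha>) = \<Prod>\<^bsub>i \<le> |\<alpha>|\<^esub> t\<^sub>i(\<alpha>\<^sub>i) / q\<^sub>i(\<alpha>\<^sub>i)\<close>.
  The logarithmic condition gives \<open>|t\<^sub>i(l) - q\<^sub>i(l)| \<le> D\<^sub>i(l) = \<epsilon>\<^sub>i \<kappa>\<^sub>l / i\<close>, so replacing \<open>t\<^sub>i\<close> by \<open>q\<^sub>i\<close> for \<open>i > m\<close> costs in
  \<open>L\<^sup>1\<close> at most the \<open>n\<close>-th coefficient of \<open>\<Prod>\<^bsub>i\<le>n\<^esub> exp(\<theta>x\<^sup>i/i)\<close> times the difference of \<open>G\<^sub>n = \<Prod>\<^bsub>i\<le>n\<^esub> (1 + D\<^sub>i(x\<^sup>i))\<close>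
  and \<open>G\<^sub>m\<close>, divided by the Ewens coefficient \<open>a\<^sub>n\<close> of \<open>(1 - x)\<^bsup>-\<theta>\<^esup>\<close>. The coefficients \<open>g\<^sub>k\<close> of \<open>G\<^sub>\<infinity>\<close> are summable
  with \<open>k g\<^sub>k \<rightarrow> 0\<close>, and \<open>n a\<^sub>n\<close> is \<open>\<theta>\<close> times the sum of the preceding coefficients, whence the cost is small
  uniformly in large \<open>n\<close> as \<open>m\<close> grows. For fixed \<open>m\<close>, the counts \<open>\<alpha>\<^sub>1(n), \<dots>, \<alpha>\<^sub>m(n)\<close> of the Feller coupling are Cauchy in
  probability and \<open>\<eta>\<^bsub>n,m\<^esub>\<close> is uniformly integrable, hence Cauchy in \<open>L\<^sup>1\<close>. Completeness of \<open>L\<^sup>1\<close> yields all limits.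
\<close>

unbundle no vec_syntax and fps_syntax

section \<open>Power series and partitions\<close>

text \<open>The obstacle is \<theta> < 1, where \<open>a n\<close> decays: in
  \<open>\<Sum>k\<le>n. v k * a (n - k)\<close> the terms with k near n are then inflated relative
  to \<open>a n\<close>, and summability of \<open>v\<close> alone does not suffice. Monotonicity of
  \<open>n * a n\<close> controls k \<le> n/2, decay of \<open>k * v k\<close> controls the rest.
  For G this decay comes from the logarithmic derivative, whose coefficients vanish by dominated
  convergence. Normalising to \<open>t i 0 = 1\<close> makes \<eta> insensitive to appended zeros.
  For i \<le> J this may be impossible, so \<eta> of a truncated partition of size below J may
  differ from the truncated product; such sizes are rare because \<open>m * a m\<close> diverges.
  Positivity of the limit needs its own argument. The factors \<open>t i\<close> with i \<le> J may
  be far from Poisson, so comparison with the Ewens measure bounds from below only the mass in which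
  these factors are replaced by Poisson ones. If the true mass were o(\<open>a n\<close>), attaching
  one fixed partition with parts up to J would make the mass on parts above J o(\<open>a n\<close>)
  as well, and convolution with the Poisson factors would contradict that bound.\<close>

definition wparts :: "nat set \<Rightarrow> nat \<Rightarrow> (nat \<Rightarrow> nat) set" where
  "wparts S N = {\<alpha>. (\<forall>i. i \<notin> S \<longrightarrow> \<alpha> i = 0) \<and> (\<Sum>i\<in>S. i * \<alpha> i) = N}"

lemma partitions_of_eq_wparts: "partitions_of n = wparts {1..n} n"
  by (simp add: partitions_of_def wparts_def)

lemma finite_wparts:
  assumes "finite S" "0 \<notin> S"
  shows "finite (wparts S N)"
proof (rule finite_subset)
  show "wparts S N \<subseteq> {f. \<forall>i. (i \<in> S \<longrightarrow> f i \<in> {0..N}) \<and> (i \<notin> S \<longrightarrow> f i = 0)}"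
  proof safe
    fix \<alpha> i assume \<alpha>: "\<alpha> \<in> wparts S N" and i: "i \<in> S"
    have "i > 0" using i assms(2) by (metis gr0I)
    then have "\<alpha> i \<le> i * \<alpha> i" by simp
    also have "\<dots> \<le> (\<Sum>i\<in>S. i * \<alpha> i)" using i assms(1) by (intro member_le_sum) auto
    also have "\<dots> = N" using \<alpha> by (simp add: wparts_def)
    finally show "\<alpha> i \<in> {0..N}" by simp
  qed (simp add: wparts_def)
qed (intro finite_set_of_finite_funs assms; simp)

text \<open>Merging parts from S with parts from S' is a bijection; its inverse recovers k as the
  size of the S-portion. It drives the product formula below and separates small from large parts in
  \<open>sum_RT_large\<close>.\<close>

lemma sum_wparts_Un:
  fixes \<phi> \<psi> :: "(nat \<Rightarrow> nat) \<Rightarrow> 'a::comm_ring_1"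
  assumes S: "finite S" "finite S'" "S \<inter> S' = {}" "0 \<notin> S" "0 \<notin> S'"
  shows "(\<Sum>\<alpha>\<in>wparts (S \<union> S') N. \<phi> (\<lambda>i. if i \<in> S then \<alpha> i else 0) * \<psi> (\<lambda>i. if i \<in> S' then \<alpha> i else 0))
       = (\<Sum>k\<le>N. (\<Sum>\<beta>\<in>wparts S k. \<phi> \<beta>) * (\<Sum>\<gamma>\<in>wparts S' (N - k). \<psi> \<gamma>))"
proof -
  have "(\<Sum>k\<le>N. (\<Sum>\<beta>\<in>wparts S k. \<phi> \<beta>) * (\<Sum>\<gamma>\<in>wparts S' (N - k). \<psi> \<gamma>))
      = (\<Sum>k\<le>N. \<Sum>p\<in>wparts S k \<times> wparts S' (N - k). \<phi> (fst p) * \<psi> (snd p))"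
    by (simp add: sum_product sum.cartesian_product case_prod_beta)
  also have "\<dots> = (\<Sum>x\<in>(SIGMA k:{..N}. wparts S k \<times> wparts S' (N - k)). \<phi> (fst (snd x)) * \<psi> (snd (snd x)))"
    by (subst sum.Sigma) (auto intro!: finite_wparts S simp: case_prod_beta)
  also have "\<dots> = (\<Sum>\<alpha>\<in>wparts (S \<union> S') N. \<phi> (\<lambda>i. if i \<in> S then \<alpha> i else 0) * \<psi> (\<lambda>i. if i \<in> S' then \<alpha> i else 0))"
  proof (rule sum.reindex_bij_witness[where
        i = "\<lambda>\<alpha>. ((\<Sum>i\<in>S. i * \<alpha> i), (\<lambda>i. if i \<in> S then \<alpha> i else 0), (\<lambda>i. if i \<in> S' then \<alpha> i else 0))" and
        j = "\<lambda>(k, \<beta>, \<gamma>). (\<lambda>i. \<beta> i + \<gamma> i)"])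
    fix x assume "x \<in> (SIGMA k:{..N}. wparts S k \<times> wparts S' (N - k))"
    then obtain k \<beta> \<gamma> where x: "x = (k, \<beta>, \<gamma>)"
      and b: "\<And>i. i \<notin> S \<Longrightarrow> \<beta> i = 0" and c: "\<And>i. i \<notin> S' \<Longrightarrow> \<gamma> i = 0"
      and k: "(\<Sum>i\<in>S. i * \<beta> i) = k" "k \<le> N" and l: "(\<Sum>i\<in>S'. i * \<gamma> i) = N - k"
      by (auto simp: wparts_def)
    have g0: "\<gamma> i = 0" if "i \<in> S" for i using that S(3) c by blast
    have b0: "\<beta> i = 0" if "i \<in> S'" for i using that S(3) b by blast
    have sk: "(\<Sum>i\<in>S. i * (\<beta> i + \<gamma> i)) = k"
      unfolding k(1)[symmetric] by (rule sum.cong) (auto simp: g0)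
    have r1: "(\<lambda>i. if i \<in> S then \<beta> i + \<gamma> i else 0) = \<beta>" using b g0 by auto
    have r2: "(\<lambda>i. if i \<in> S' then \<beta> i + \<gamma> i else 0) = \<gamma>" using c b0 by auto
    let ?\<alpha> = "(\<lambda>(k, \<beta>, \<gamma>). (\<lambda>i. \<beta> i + \<gamma> i)) x"
    show "(\<Sum>i\<in>S. i * ?\<alpha> i, \<lambda>i. if i \<in> S then ?\<alpha> i else 0, \<lambda>i. if i \<in> S' then ?\<alpha> i else 0) = x"
      unfolding x prod.case sk r1 r2 ..
    show "\<phi> (\<lambda>i. if i \<in> S then ?\<alpha> i else 0) * \<psi> (\<lambda>i. if i \<in> S' then ?\<alpha> i else 0) = \<phi> (fst (snd x)) * \<psi> (snd (snd x))"
      unfolding x prod.case r1 r2 by simp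
    have "(\<Sum>i\<in>S \<union> S'. i * (\<beta> i + \<gamma> i)) = (\<Sum>i\<in>S. i * (\<beta> i + \<gamma> i)) + (\<Sum>i\<in>S'. i * (\<beta> i + \<gamma> i))"
      by (rule sum.union_disjoint) (use S in auto)
    also have "(\<Sum>i\<in>S'. i * (\<beta> i + \<gamma> i)) = N - k" unfolding l[symmetric] by (rule sum.cong) (auto simp: b0)
    finally show "?\<alpha> \<in> wparts (S \<union> S') N" using x k(2) b c by (auto simp: wparts_def sk)
  next
    fix \<alpha> assume \<alpha>: "\<alpha> \<in> wparts (S \<union> S') N"
    show "(\<lambda>(k, \<beta>, \<gamma>). (\<lambda>i. \<beta> i + \<gamma> i)) (\<Sum>i\<in>S. i * \<alpha> i, \<lambda>i. if i \<in> S then \<alpha> i else 0, \<lambda>i. if i \<in> S' then \<alpha> i else 0) = \<alpha>"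
      using \<alpha> S(3) by (auto simp: wparts_def fun_eq_iff)
    have "(\<Sum>i\<in>S \<union> S'. i * \<alpha> i) = (\<Sum>i\<in>S. i * \<alpha> i) + (\<Sum>i\<in>S'. i * \<alpha> i)"
      by (rule sum.union_disjoint) (use S in auto)
    then show "(\<Sum>i\<in>S. i * \<alpha> i, \<lambda>i. if i \<in> S then \<alpha> i else 0, \<lambda>i. if i \<in> S' then \<alpha> i else 0)
        \<in> (SIGMA k:{..N}. wparts S k \<times> wparts S' (N - k))"
      using \<alpha> by (auto simp: wparts_def)
  qed
  finally show ?thesis by simp
qed

lemma fps_compose_X_power_nth:
  fixes F :: "'a::comm_ring_1 fps"
  assumes "i \<ge> 1"
  shows "(F oo fps_X ^ i) $ k = (if i dvd k then F $ (k div i) else 0)"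
proof -
  have "(F oo fps_X ^ i) $ k = (\<Sum>j=0..k. F $ j * (if k = i * j then 1 else 0))"
    by (simp add: fps_compose_nth power_mult[symmetric] fps_X_power_nth)
  also have "\<dots> = (\<Sum>j=0..k. if i dvd k \<and> j = k div i then F $ j else 0)"
    using assms by (intro sum.cong) (auto simp: dvd_def)
  also have "\<dots> = (if i dvd k then F $ (k div i) else 0)"
    by (auto simp: sum.delta)
  finally show ?thesis .
qed

lemma wparts_singleton:
  assumes "i \<ge> 1"
  shows "wparts {i} N = (if i dvd N then {\<lambda>j. if j = i then N div i else 0} else {})"
proof (cases "i dvd N")
  case True
  then show ?thesis using assms by (auto simp: wparts_def fun_eq_iff elim!: dvdE)
next
  case False
  then show ?thesis by (auto simp: wparts_def)
qed

text \<open>Euler's product formula with arbitrary weights: \<open>F i $ l\<close> is the weight of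
  l parts of size i. Sums over partitions become coefficients through it.\<close>

lemma prod_fps_compose_X_power_nth:
  fixes F :: "nat \<Rightarrow> 'a::comm_ring_1 fps"
  assumes "finite S" "0 \<notin> S"
  shows "(\<Prod>i\<in>S. F i oo fps_X ^ i) $ N = (\<Sum>\<alpha>\<in>wparts S N. \<Prod>i\<in>S. F i $ \<alpha> i)"
  using assms
proof (induction S arbitrary: N rule: finite_induct)
  case empty
  have "wparts {} N = (if N = 0 then {\<lambda>i. 0} else {})" by (auto simp: wparts_def)
  then show ?case by simp
next
  case (insert i S)
  have i: "i \<ge> 1" using insert.prems by (metis One_nat_def Suc_leI gr0I insertI1)
  have "(\<Prod>j\<in>insert i S. F j oo fps_X ^ j) $ N = ((\<Prod>j\<in>S. F j oo fps_X ^ j) * (F i oo fps_X ^ i)) $ N"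
    using insert by (simp add: mult.commute)
  also have "\<dots> = (\<Sum>k\<le>N. (\<Sum>\<alpha>\<in>wparts S k. \<Prod>j\<in>S. F j $ \<alpha> j) * (F i oo fps_X ^ i) $ (N - k))"
    using insert by (simp add: fps_mult_nth atLeast0AtMost)
  also have "\<dots> = (\<Sum>k\<le>N. (\<Sum>\<beta>\<in>wparts S k. \<Prod>j\<in>S. F j $ \<beta> j) * (\<Sum>\<gamma>\<in>wparts {i} (N - k). F i $ \<gamma> i))"
    by (intro sum.cong refl) (auto simp: fps_compose_X_power_nth[OF i] wparts_singleton[OF i])
  also have "\<dots> = (\<Sum>\<alpha>\<in>wparts (S \<union> {i}) N. (\<lambda>\<beta>. \<Prod>j\<in>S. F j $ \<beta> j) (\<lambda>j. if j \<in> S then \<alpha> j else 0)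
       * (\<lambda>\<gamma>. F i $ \<gamma> i) (\<lambda>j. if j \<in> {i} then \<alpha> j else 0))"
    by (rule sum_wparts_Un[symmetric]) (use insert in auto)
  also have "\<dots> = (\<Sum>\<alpha>\<in>wparts (insert i S) N. \<Prod>j\<in>insert i S. F j $ \<alpha> j)"
    using insert by (auto intro!: sum.cong simp: mult.commute)
  finally show ?case .
qed

lemma fps_compose_X_power_mult:
  fixes F G :: "'a::idom fps"
  assumes "i \<ge> 1"
  shows "F * G oo fps_X ^ i = (F oo fps_X ^ i) * (G oo fps_X ^ i)"
  using assms by (intro fps_compose_mult_distrib) (simp add: fps_X_power_nth)

subsection \<open>Coefficients of the Ewens normalisation\<close>

definition ewens_coeff :: "real \<Rightarrow> nat \<Rightarrow> real" where
  "ewens_coeff \<theta> n = pochhammer \<theta> n / fact n"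

lemma ewens_coeff_0 [simp]: "ewens_coeff \<theta> 0 = 1"
  by (simp add: ewens_coeff_def)

lemma ewens_coeff_Suc: "real (Suc n) * ewens_coeff \<theta> (Suc n) = (\<theta> + real n) * ewens_coeff \<theta> n"
  by (simp add: ewens_coeff_def pochhammer_Suc del: of_nat_Suc)

lemma ewens_coeff_pos: "\<theta> > 0 \<Longrightarrow> ewens_coeff \<theta> n > 0"
  by (simp add: ewens_coeff_def pochhammer_pos)

text \<open>Coefficient form of x A' = \<theta> x / (1 - x) A for the Ewens series A.\<close>

lemma ewens_coeff_recurrence: "real n * ewens_coeff \<theta> n = \<theta> * (\<Sum>s<n. ewens_coeff \<theta> s)"
  by (induction n) (simp_all add: ewens_coeff_Suc algebra_simps del: of_nat_Suc)

text \<open>By the recurrence both sides are partial sums of positive terms, whereas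
  \<open>ewens_coeff\<close> itself decreases when \<theta> < 1. This is the substitute for monotone
  coefficients.\<close>

lemma ewens_coeff_mult_mono:
  assumes "\<theta> > 0" "m \<le> n"
  shows "real m * ewens_coeff \<theta> m \<le> real n * ewens_coeff \<theta> n"
  unfolding ewens_coeff_recurrence using assms
  by (intro mult_left_mono sum_mono2) (auto simp: less_imp_le[OF ewens_coeff_pos])

lemma ewens_coeff_ge:
  assumes "\<theta> > 0" "n \<ge> 1"
  shows "real n * ewens_coeff \<theta> n \<ge> \<theta>"
  using ewens_coeff_mult_mono[of \<theta> 1 n] assms by (simp add: ewens_coeff_def)

text \<open>Each step multiplies by (\<theta> + m) / (m + 1) \<le> \<theta> + 1. A fixed shift of
  the index thus costs only a constant factor, which \<open>mass_not_tendsto_0\<close>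
  exploits.\<close>

lemma ewens_coeff_add_le:
  assumes "\<theta> > 0"
  shows "ewens_coeff \<theta> (n + s) \<le> (\<theta> + 1) ^ s * ewens_coeff \<theta> n"
proof (induction s)
  case (Suc s)
  have "ewens_coeff \<theta> (n + Suc s) = (\<theta> + real (n + s)) / real (Suc (n + s)) * ewens_coeff \<theta> (n + s)"
    using ewens_coeff_Suc[of "n + s" \<theta>] by (simp add: field_simps del: of_nat_Suc of_nat_add)
  also have "\<dots> \<le> (\<theta> + 1) * ewens_coeff \<theta> (n + s)"
    using assms ewens_coeff_pos[OF assms, of "n + s"]
    by (intro mult_right_mono) (auto simp: field_simps intro: add_mono)
  also have "\<dots> \<le> (\<theta> + 1) * ((\<theta> + 1) ^ s * ewens_coeff \<theta> n)"
    using assms by (intro mult_left_mono Suc) auto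
  finally show ?case by (simp add: mult_ac)
qed simp

text \<open>The logarithmic derivative of \<open>\<Prod>i\<le>n. exp (\<theta> x\<^sup>i / i)\<close> is \<open>\<theta> (1 + x + \<dots> + x\<^bsup>n-1\<^esup>)\<close>.\<close>

lemma fps_XD_prod_exp:
  fixes \<theta> :: real
  shows "fps_XD (\<Prod>i=1..n. fps_exp (\<theta> / real i) oo fps_X ^ i)
     = (\<Prod>i=1..n. fps_exp (\<theta> / real i) oo fps_X ^ i) * (\<Sum>i=1..n. fps_const \<theta> * fps_X ^ i)"
proof (induction n)
  case 0
  then show ?case by (simp add: fps_XD_def)
next
  case (Suc n)
  have XDm: "fps_XD (A * B) = fps_XD A * B + A * fps_XD B" for A B :: "real fps"
    by (simp add: fps_XD_def algebra_simps)
  have "fps_deriv (fps_exp (\<theta> / real (Suc n)) oo fps_X ^ Suc n)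
      = (fps_deriv (fps_exp (\<theta> / real (Suc n))) oo fps_X ^ Suc n) * fps_deriv (fps_X ^ Suc n)"
    by (rule fps_compose_deriv) simp
  also have "\<dots> = fps_const (\<theta> / real (Suc n)) * (fps_exp (\<theta> / real (Suc n)) oo fps_X ^ Suc n)
       * (fps_const (real (Suc n)) * fps_X ^ n)"
    by (simp add: fps_deriv_power fps_compose_mult_distrib fps_const_mult[symmetric] fps_of_nat[symmetric] del: fps_const_mult power_Suc of_nat_Suc)
  also have "\<dots> = (fps_const (\<theta> / real (Suc n)) * fps_const (real (Suc n))) * (fps_exp (\<theta> / real (Suc n)) oo fps_X ^ Suc n)
       * fps_X ^ n"
    by (simp only: mult_ac)
  also have "fps_const (\<theta> / real (Suc n)) * fps_const (real (Suc n)) = fps_const \<theta>"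
    by simp
  finally have d: "fps_XD (fps_exp (\<theta> / real (Suc n)) oo fps_X ^ Suc n)
      = (fps_exp (\<theta> / real (Suc n)) oo fps_X ^ Suc n) * (fps_const \<theta> * fps_X ^ Suc n)"
    by (simp add: fps_XD_def mult_ac)
  show ?case
    by (simp only: prod.atLeastAtMost_shift_bounds prod.nat_ivl_Suc' sum.nat_ivl_Suc' le_add1 Suc_eq_plus1_left[symmetric] XDm d Suc)
       (simp add: XDm d Suc algebra_simps del: power_Suc of_nat_Suc)
qed

text \<open>In degrees 1 to n all coefficients of the logarithmic derivative equal \<theta>, so up
  to degree n the truncated product obeys the recurrence of \<open>ewens_coeff\<close>.\<close>

lemma prod_exp_nth:
  fixes \<theta> :: real
  assumes "N \<le> n"
  shows "(\<Prod>i=1..n. fps_exp (\<theta> / real i) oo fps_X ^ i) $ N = ewens_coeff \<theta> N"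
  using assms
proof (induction N rule: less_induct)
  case (less N)
  define A where "A = (\<Prod>i=1..n. fps_exp (\<theta> / real i) oo fps_X ^ i)"
  show ?case
  proof (cases "N = 0")
    case True
    have "(\<Prod>i\<in>I. F i) $ 0 = (\<Prod>i\<in>I. F i $ 0)" for I and F :: "nat \<Rightarrow> real fps"
      by (induction I rule: infinite_finite_induct) auto
    with True show ?thesis by simp
  next
    case False
    have "real N * A $ N = fps_XD A $ N" 
      using False by (cases N) (auto simp: fps_XD_def)
    also have "\<dots> = (A * (\<Sum>i=1..n. fps_const \<theta> * fps_X ^ i)) $ N"
      unfolding A_def by (simp only: fps_XD_prod_exp)
    also have "\<dots> = (\<Sum>j=0..N. A $ j * (\<theta> * (if N - j \<in> {1..n} then 1 else 0)))"
      unfolding fps_mult_nth[of A] fps_sum_nth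
      by (intro sum.cong refl) (simp add: fps_X_power_nth sum_distrib_left[symmetric] sum.delta)
    also have "\<dots> = (\<Sum>j<N. A $ j * \<theta>)"
      using less.prems by (intro sum.mono_neutral_cong_right) auto
    also have "\<dots> = (\<Sum>j<N. ewens_coeff \<theta> j * \<theta>)"
      using less by (intro sum.cong refl) (simp add: A_def)
    also have "\<dots> = real N * ewens_coeff \<theta> N"
      by (simp add: ewens_coeff_recurrence sum_distrib_left mult.commute)
    finally show ?thesis using False by (simp add: A_def)
  qed
qed

text \<open>The sum is split at n/2. For k \<le> n/2, monotonicity of
  \<open>m * ewens_coeff \<theta> m\<close> gives a factor 2. For larger k, \<open>v k\<close> is at
  most 2 B / n, and the remaining coefficients add up to at most
  \<open>n * ewens_coeff \<theta> n / \<theta>\<close>, which absorbs the 1 / n.\<close>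

lemma sum_mult_ewens_coeff_le:
  assumes \<theta>: "\<theta> > 0" and n: "n \<ge> 1" and v: "\<And>k. v k \<ge> 0"
    and B: "\<And>k. n < 2 * k \<Longrightarrow> k \<le> n \<Longrightarrow> real k * v k \<le> B"
  shows "(\<Sum>k\<le>n. v k * ewens_coeff \<theta> (n - k)) \<le> ewens_coeff \<theta> n * (2 * (\<Sum>k\<le>n div 2. v k) + 2 / \<theta> * B)"
proof -
  note apos = ewens_coeff_pos[OF \<theta>]
  have "(\<Sum>k\<le>n. v k * ewens_coeff \<theta> (n - k))
      = (\<Sum>k\<in>{..n div 2} \<union> {n div 2<..n}. v k * ewens_coeff \<theta> (n - k))"
    by (rule sum.cong) auto
  also have "\<dots> = (\<Sum>k\<le>n div 2. v k * ewens_coeff \<theta> (n - k)) + (\<Sum>k\<in>{n div 2<..n}. v k * ewens_coeff \<theta> (n - k))"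
    by (rule sum.union_disjoint) auto
  also have "(\<Sum>k\<le>n div 2. v k * ewens_coeff \<theta> (n - k)) \<le> (\<Sum>k\<le>n div 2. v k * (2 * ewens_coeff \<theta> n))"
  proof (intro sum_mono mult_left_mono v)
    fix k assume "k \<in> {..n div 2}"
    then have k: "2 * k \<le> n" by auto
    have "real n * ewens_coeff \<theta> (n - k) \<le> 2 * (real (n - k) * ewens_coeff \<theta> (n - k))"
      using k apos[of "n-k"] by (simp add: of_nat_diff field_simps)
    also have "\<dots> \<le> 2 * (real n * ewens_coeff \<theta> n)"
      using ewens_coeff_mult_mono[OF \<theta>, of "n - k" n] by simp
    finally show "ewens_coeff \<theta> (n - k) \<le> 2 * ewens_coeff \<theta> n"
      using n by (simp add: field_simps)
  qed
  also have "(\<Sum>k\<in>{n div 2<..n}. v k * ewens_coeff \<theta> (n - k)) \<le> (\<Sum>k\<in>{n div 2<..n}. (2 * B / real n) * ewens_coeff \<theta> (n - k))"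
  proof (intro sum_mono mult_right_mono less_imp_le[OF apos])
    fix k assume k: "k \<in> {n div 2<..n}"
    then have k2: "n < 2 * k" "k \<le> n" by auto
    have "real n * v k \<le> 2 * (real k * v k)" using k2 v[of k] by (simp add: mult_right_mono mult.assoc[symmetric])
    also have "\<dots> \<le> 2 * B" using B[OF k2] by simp
    finally show "v k \<le> 2 * B / real n" using n by (simp add: field_simps)
  qed
  also have "\<dots> = (2 * B / real n) * (\<Sum>k\<in>{n div 2<..n}. ewens_coeff \<theta> (n - k))"
    by (simp add: sum_distrib_left)
  also have "\<dots> \<le> (2 * B / real n) * (\<Sum>s<n. ewens_coeff \<theta> s)"
  proof (rule mult_left_mono)
    have "(\<Sum>k\<in>{n div 2<..n}. ewens_coeff \<theta> (n - k)) = (\<Sum>s\<in>(\<lambda>k. n - k) ` {n div 2<..n}. ewens_coeff \<theta> s)"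
      by (subst sum.reindex) (auto simp: inj_on_def)
    also have "\<dots> \<le> (\<Sum>s<n. ewens_coeff \<theta> s)"
      using n by (intro sum_mono2) (auto simp: less_imp_le[OF apos])
    finally show "(\<Sum>k\<in>{n div 2<..n}. ewens_coeff \<theta> (n - k)) \<le> (\<Sum>s<n. ewens_coeff \<theta> s)" .
    \<comment> \<open>The case k = n of the hypothesis is the source of B \<ge> 0.\<close>
    have "real n * v n \<le> B" using n by (intro B) auto
    moreover have "real n * v n \<ge> 0" using v[of n] by simp
    ultimately show "0 \<le> 2 * B / real n" by simp
  qed
  also have "(\<Sum>s<n. ewens_coeff \<theta> s) = real n * ewens_coeff \<theta> n / \<theta>"
    using \<theta> by (simp add: ewens_coeff_recurrence)
  also have "(2 * B / real n) * (real n * ewens_coeff \<theta> n / \<theta>) = ewens_coeff \<theta> n * (2 / \<theta> * B)"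
    using n by simp
  finally show ?thesis
    by (simp add: algebra_simps sum_distrib_left sum_distrib_right)
qed

text \<open>A factor with index i > m and constant term 1 is 1 plus terms of degree at least i >
  k.\<close>

lemma prod_fps_compose_nth_stable:
  fixes F :: "nat \<Rightarrow> 'a::comm_ring_1 fps"
  assumes "k \<le> m" "J \<le> m" "m \<le> n" "\<And>i. m < i \<Longrightarrow> F i $ 0 = 1"
  shows "(\<Prod>i\<in>{J<..n}. F i oo fps_X ^ i) $ k = (\<Prod>i\<in>{J<..m}. F i oo fps_X ^ i) $ k"
  using assms(3)
proof (induction n rule: dec_induct)
  case (step n)
  have h: "(F (Suc n) oo fps_X ^ Suc n) $ j = (if j = 0 then 1 else 0)" if "j \<le> k" for j
  proof (cases "j = 0")
    case False
    then have "\<not> Suc n dvd j" using that step.hyps assms by (auto dest: dvd_imp_le)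
    then show ?thesis using False by (subst fps_compose_X_power_nth) auto
  qed (use step.hyps assms in simp)
  let ?P = "\<lambda>n. \<Prod>i\<in>{J<..n}. F i oo fps_X ^ i"
  have "{J<..Suc n} = insert (Suc n) {J<..n}" using step.hyps assms by auto
  then have "?P (Suc n) $ k = ((F (Suc n) oo fps_X ^ Suc n) * ?P n) $ k"
    by (simp del: power_Suc)
  also have "\<dots> = (\<Sum>j=0..k. (if j = 0 then ?P n $ k else 0))"
    unfolding fps_mult_nth by (intro sum.cong refl) (simp add: h del: power_Suc)
  also have "\<dots> = ?P n $ k" by simp
  finally show ?case using step by simp
qed simp

subsection \<open>Coefficientwise order on power series\<close>

definition fps_le :: "real fps \<Rightarrow> real fps \<Rightarrow> bool" where
  "fps_le F G \<longleftrightarrow> (\<forall>k. F $ k \<le> G $ k)"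

lemma fps_leD: "fps_le F G \<Longrightarrow> F $ k \<le> G $ k"
  by (simp add: fps_le_def)

lemma fps_le_trans: "fps_le F G \<Longrightarrow> fps_le G H \<Longrightarrow> fps_le F H"
  by (auto simp: fps_le_def intro: order_trans)

lemma fps_le_refl [simp]: "fps_le F F"
  by (simp add: fps_le_def)

lemma fps_le_mult:
  assumes "fps_le 0 F" "fps_le F F'" "fps_le 0 G" "fps_le G G'"
  shows "fps_le (F * G) (F' * G')"
  unfolding fps_le_def fps_mult_nth
proof (intro allI sum_mono mult_mono)
  fix n i
  show "F $ i \<le> F' $ i" "G $ (n - i) \<le> G' $ (n - i)" "0 \<le> G $ (n - i)"
    using assms by (auto simp: fps_le_def)
  show "0 \<le> F' $ i" using assms order_trans[of 0 "F $ i" "F' $ i"] by (auto simp: fps_le_def)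
qed

lemma fps_le_0_mult: "fps_le 0 F \<Longrightarrow> fps_le 0 G \<Longrightarrow> fps_le 0 (F * G)"
  using fps_le_mult[of 0 F 0 G] by simp

lemma fps_le_add: "fps_le F F' \<Longrightarrow> fps_le G G' \<Longrightarrow> fps_le (F + G) (F' + G')"
  by (auto simp: fps_le_def intro: add_mono)

lemma fps_le_0_1 [simp]: "fps_le 0 1"
  by (simp add: fps_le_def)

lemma fps_le_0_prod: "(\<And>i. i \<in> I \<Longrightarrow> fps_le 0 (F i)) \<Longrightarrow> fps_le 0 (\<Prod>i\<in>I. F i)"
  by (induction I rule: infinite_finite_induct) (auto intro: fps_le_0_mult)

lemma fps_le_compose_X_power:
  assumes "fps_le F G" "i \<ge> 1"
  shows "fps_le (F oo fps_X ^ i) (G oo fps_X ^ i)"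
  using assms by (auto simp: fps_le_def fps_compose_X_power_nth)

lemma fps_le_0_compose_X_power:
  "fps_le 0 F \<Longrightarrow> i \<ge> 1 \<Longrightarrow> fps_le 0 (F oo fps_X ^ i)"
  using fps_le_compose_X_power[of 0 F i] by simp

lemma fps_le_1_prod:
  "(\<And>i. i \<in> I \<Longrightarrow> fps_le 1 (F i)) \<Longrightarrow> fps_le 1 (\<Prod>i\<in>I. F i)"
proof (induction I rule: infinite_finite_induct)
  case (insert i I)
  then have "fps_le (1 * 1) (F i * (\<Prod>i\<in>I. F i))"
    by (intro fps_le_mult) auto
  then show ?case using insert by simp
qed auto

text \<open>Partial sums replace the values at 1, so that no convergence has to be discussed. The
  pairs with i + j \<le> K lie in the square of side K.\<close>

lemma sum_nth_mult_le:
  assumes "fps_le 0 F" "fps_le 0 G"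
  shows "(\<Sum>k\<le>K. (F * G) $ k) \<le> (\<Sum>k\<le>K. F $ k) * (\<Sum>k\<le>K. G $ k)"
proof -
  have "(\<Sum>k\<le>K. (F * G) $ k) = (\<Sum>(k, i)\<in>(SIGMA k:{..K}. {..k}). F $ i * G $ (k - i))"
    by (simp add: fps_mult_nth atLeast0AtMost sum.Sigma)
  also have "\<dots> = (\<Sum>(i, j)\<in>{(i, j). i + j \<le> K}. F $ i * G $ j)"
    by (rule sum.reindex_bij_witness[of _ "\<lambda>(i, j). (i + j, i)" "\<lambda>(k, i). (i, k - i)"]) auto
  also have "\<dots> \<le> (\<Sum>(i, j)\<in>{..K} \<times> {..K}. F $ i * G $ j)"
    using assms by (intro sum_mono2) (auto simp: fps_le_def)
  also have "\<dots> = (\<Sum>k\<le>K. F $ k) * (\<Sum>k\<le>K. G $ k)"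
    by (simp add: sum_product sum.cartesian_product)
  finally show ?thesis .
qed

lemma sum_nth_prod_le:
  assumes "\<And>i. i \<in> I \<Longrightarrow> fps_le 0 (F i)"
  shows "(\<Sum>k\<le>K. (\<Prod>i\<in>I. F i) $ k) \<le> (\<Prod>i\<in>I. \<Sum>k\<le>K. F i $ k)"
  using assms
proof (induction I rule: infinite_finite_induct)
  case (insert i I)
  have "(\<Sum>k\<le>K. (\<Prod>i\<in>insert i I. F i) $ k) = (\<Sum>k\<le>K. (F i * (\<Prod>i\<in>I. F i)) $ k)"
    using insert by simp
  also have "\<dots> \<le> (\<Sum>k\<le>K. F i $ k) * (\<Sum>k\<le>K. (\<Prod>i\<in>I. F i) $ k)"
    using insert by (intro sum_nth_mult_le fps_le_0_prod) auto
  also have "\<dots> \<le> (\<Sum>k\<le>K. F i $ k) * (\<Prod>i\<in>I. \<Sum>k\<le>K. F i $ k)"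
    using insert by (intro mult_left_mono sum_nonneg) (auto simp: fps_le_def)
  finally show ?case using insert by simp
qed (simp_all add: fps_one_nth)

lemma sum_nth_compose_X_power_le:
  assumes "fps_le 0 F" "i \<ge> 1"
  shows "(\<Sum>k\<le>K. (F oo fps_X ^ i) $ k) \<le> (\<Sum>k\<le>K. F $ k)"
proof -
  have "(\<Sum>k\<le>K. (F oo fps_X ^ i) $ k) = (\<Sum>k\<in>{k\<in>{..K}. i dvd k}. F $ (k div i))"
    using assms by (subst sum.inter_filter) (auto simp: fps_compose_X_power_nth intro!: sum.cong)
  also have "\<dots> = (\<Sum>l\<in>(\<lambda>k. k div i) ` {k\<in>{..K}. i dvd k}. F $ l)"
    using assms by (subst sum.reindex) (auto simp: inj_on_def dvd_def)
  also have "\<dots> \<le> (\<Sum>k\<le>K. F $ k)"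
    using assms by (intro sum_mono2) (auto simp: fps_le_def div_le_dividend intro: order_trans[OF div_le_dividend])
  finally show ?thesis .
qed

lemma fps_XD_nth: "fps_XD F $ k = of_nat k * F $ k"
  by (cases k) (simp_all add: fps_XD_def)

lemma fps_XD_mult: "fps_XD (F * G) = fps_XD F * G + F * fps_XD (G :: 'a::comm_ring_1 fps)"
  by (simp add: fps_XD_def algebra_simps)

lemma fps_le_0_XD: "fps_le 0 F \<Longrightarrow> fps_le 0 (fps_XD F)"
  by (simp add: fps_le_def fps_XD_nth)

text \<open>Logarithmic differentiation of a product of factors \<open>\<ge> 1\<close>, with the denominators dropped.\<close>

lemma fps_XD_prod_le:
  assumes "finite I" "\<And>i. i \<in> I \<Longrightarrow> fps_le 1 (F i)"
  shows "fps_le (fps_XD (\<Prod>i\<in>I. F i)) ((\<Sum>i\<in>I. fps_XD (F i)) * (\<Prod>i\<in>I. F i))"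
  using assms
proof (induction I rule: finite_induct)
  case empty
  then show ?case by (simp add: fps_XD_def)
next
  case (insert i I)
  let ?P = "\<Prod>i\<in>I. F i" let ?S = "\<Sum>i\<in>I. fps_XD (F i)"
  have nn: "fps_le 0 (F j)" if "j \<in> insert i I" for j
    using insert.prems[OF that] fps_le_trans[OF fps_le_0_1] by blast
  have P: "fps_le 0 ?P" by (intro fps_le_0_prod nn) auto
  have 1: "fps_le (F i * fps_XD ?P) (F i * (?S * ?P))"
    using insert nn P by (intro fps_le_mult fps_le_0_XD) auto
  \<comment> \<open>Inserting \<open>F i\<close>, which is at least 1 coefficientwise, is the point
    at which the denominator of the true logarithmic derivative is dropped.\<close>
  have 2: "fps_le (fps_XD (F i) * ?P * 1) (fps_XD (F i) * ?P * F i)"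
    using insert nn P by (intro fps_le_mult fps_le_0_mult fps_le_0_XD) auto
  have "fps_le (fps_XD (F i) * ?P + F i * fps_XD ?P) (fps_XD (F i) * ?P * F i + F i * (?S * ?P))"
    by (rule fps_le_add) (use 1 2 in auto)
  then show ?case using insert by (simp add: fps_XD_mult algebra_simps)
qed

subsection \<open>Series with a summable derivative at 1\<close>

text \<open>The weight k + 1 rather than k also controls the value at 1, and it is
  submultiplicative, k + 1 \<le> (i + 1) (j + 1) for i + j = k, which closes the class under
  products.\<close>

definition fps_summable :: "real fps \<Rightarrow> bool" where
  "fps_summable F \<longleftrightarrow> fps_le 0 F \<and> summable (\<lambda>k. (real k + 1) * F $ k)"

lemma fps_summable_mult:
  assumes "fps_summable F" "fps_summable G"
  shows "fps_summable (F * G)"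
proof -
  have F: "fps_le 0 F" "summable (\<lambda>k. norm ((real k + 1) * F $ k))"
    and G: "fps_le 0 G" "summable (\<lambda>k. norm ((real k + 1) * G $ k))"
    using assms by (auto simp: fps_summable_def fps_le_def)
  have "summable (\<lambda>k. \<Sum>i\<le>k. ((real i + 1) * F $ i) * ((real (k - i) + 1) * G $ (k - i)))"
    by (rule summable_Cauchy_product) (use F G in auto)
  then have "summable (\<lambda>k. (real k + 1) * (F * G) $ k)"
  proof (rule summable_comparison_test'[where N = 0])
    fix k
    have "norm ((real k + 1) * (F * G) $ k) = (real k + 1) * (F * G) $ k"
      using fps_le_0_mult[OF F(1) G(1)] by (simp add: fps_le_def)
    also have "\<dots> = (\<Sum>i\<le>k. (real k + 1) * (F $ i * G $ (k - i)))"
      by (simp add: fps_mult_nth atLeast0AtMost sum_distrib_left)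
    also have "\<dots> \<le> (\<Sum>i\<le>k. ((real i + 1) * (real (k - i) + 1)) * (F $ i * G $ (k - i)))"
    proof (intro sum_mono mult_right_mono)
      fix i assume "i \<in> {..k}"
      then have "real k + 1 = real i + real (k - i) + 1" by (simp add: of_nat_diff)
      also have "\<dots> \<le> (real i + 1) * (real (k - i) + 1)" by (simp add: algebra_simps)
      finally show "real k + 1 \<le> (real i + 1) * (real (k - i) + 1)" .
    qed (use F G in \<open>auto simp: fps_le_def\<close>)
    finally show "norm ((real k + 1) * (F * G) $ k)
        \<le> (\<Sum>i\<le>k. ((real i + 1) * F $ i) * ((real (k - i) + 1) * G $ (k - i)))"
      by (simp add: mult_ac)
  qed
  then show ?thesis using fps_le_0_mult[OF F(1) G(1)] by (simp add: fps_summable_def)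
qed

lemma fps_summable_1 [simp]: "fps_summable 1"
proof -
  have "(\<lambda>k. (real k + 1) * (1::real fps) $ k) = (\<lambda>k. if k = 0 then 1 else 0)"
    by (auto simp: fps_one_nth)
  then show ?thesis by (simp add: fps_summable_def)
qed

lemma fps_summable_add: "fps_summable F \<Longrightarrow> fps_summable G \<Longrightarrow> fps_summable (F + G)"
  using summable_add[of "\<lambda>k. (real k + 1) * F $ k" "\<lambda>k. (real k + 1) * G $ k"]
  by (auto simp: fps_summable_def fps_le_def algebra_simps)

lemma fps_summable_prod:
  "(\<And>i. i \<in> I \<Longrightarrow> fps_summable (F i)) \<Longrightarrow> fps_summable (\<Prod>i\<in>I. F i)"
  by (induction I rule: infinite_finite_induct) (auto intro: fps_summable_mult)

lemma fps_summable_compose_X_power: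
  assumes "fps_summable F" "i \<ge> 1"
  shows "fps_summable (F oo fps_X ^ i)"
proof -
  have F: "fps_le 0 F" "summable (\<lambda>k. real i * ((real k + 1) * F $ k))"
    using assms by (auto simp: fps_summable_def intro: summable_mult)
  have "summable (\<lambda>k. (real k + 1) * (F oo fps_X ^ i) $ k)"
  proof (rule bounded_imp_summable)
    show "0 \<le> (real k + 1) * (F oo fps_X ^ i) $ k" for k
      using fps_le_0_compose_X_power[OF F(1) assms(2)] by (auto simp: fps_le_def)
    show "(\<Sum>k\<le>K. (real k + 1) * (F oo fps_X ^ i) $ k) \<le> (\<Sum>k. real i * ((real k + 1) * F $ k))" for K
    proof -
      have "(\<Sum>k\<le>K. (real k + 1) * (F oo fps_X ^ i) $ k) = (\<Sum>k\<in>{k\<in>{..K}. i dvd k}. (real k + 1) * F $ (k div i))"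
        using assms by (subst sum.inter_filter) (auto simp: fps_compose_X_power_nth intro!: sum.cong)
      also have "\<dots> \<le> (\<Sum>k\<in>{k\<in>{..K}. i dvd k}. real i * ((real (k div i) + 1) * F $ (k div i)))"
      proof (intro sum_mono)
        fix k assume "k \<in> {k\<in>{..K}. i dvd k}"
        then have "real k + 1 \<le> real i * (real (k div i) + 1)"
          using assms(2) by (auto simp: algebra_simps elim!: dvdE)
        then have "(real k + 1) * F $ (k div i) \<le> (real i * (real (k div i) + 1)) * F $ (k div i)"
          using F(1) by (intro mult_right_mono) (auto simp: fps_le_def)
        then show "(real k + 1) * F $ (k div i) \<le> real i * ((real (k div i) + 1) * F $ (k div i))"
          by (simp add: mult.assoc)
      qed
      also have "\<dots> = (\<Sum>l\<in>(\<lambda>k. k div i) ` {k\<in>{..K}. i dvd k}. real i * ((real l + 1) * F $ l))"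
        using assms by (subst sum.reindex) (auto simp: inj_on_def dvd_def)
      also have "\<dots> \<le> (\<Sum>k. real i * ((real k + 1) * F $ k))"
        using F by (intro sum_le_suminf) (auto simp: fps_le_def)
      finally show ?thesis .
    qed
  qed
  then show ?thesis using fps_le_0_compose_X_power[OF F(1) assms(2)] by (simp add: fps_summable_def)
qed

lemma fps_summable_exp:
  assumes "c \<ge> 0"
  shows "fps_summable (fps_exp c :: real fps)"
proof -
  have s: "summable (\<lambda>k. c ^ k / fact k)"
    using summable_exp[of c] by (simp add: divide_inverse mult.commute)
  have "summable (\<lambda>k. real (Suc k) * (c ^ Suc k / fact (Suc k)))"
    using summable_mult[OF s, of c] by (simp add: fact_Suc field_simps del: of_nat_Suc)
  then have "summable (\<lambda>k. real k * (c ^ k / fact k))"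
    by (subst summable_Suc_iff[symmetric])
  from summable_add[OF this s] show ?thesis
    using assms by (simp add: fps_summable_def fps_le_def algebra_simps add_divide_distrib)
qed

text \<open>These are the two properties that make the bound of
  \<open>sum_mult_ewens_coeff_le\<close> effective: small tails, and decay of k times the
  coefficient.\<close>

lemma fps_summable_imp_summable:
  assumes "fps_summable F"
  shows "summable (\<lambda>k. F $ k)" "(\<lambda>k. real k * F $ k) \<longlonglongrightarrow> 0"
proof -
  from assms have F: "fps_le 0 F" and s: "summable (\<lambda>k. (real k + 1) * F $ k)"
    by (auto simp: fps_summable_def)
  show "summable (\<lambda>k. F $ k)"
    by (rule summable_comparison_test'[OF s, of 0]) (use F in \<open>auto simp: fps_le_def algebra_simps\<close>)
  show "(\<lambda>k. real k * F $ k) \<longlonglongrightarrow> 0"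
    by (rule Lim_null_comparison[OF _ summable_LIMSEQ_zero[OF s]])
       (use F in \<open>auto simp: fps_le_def algebra_simps\<close>)
qed

lemma summable_of_summable_mult_nat:
  fixes c :: "nat \<Rightarrow> real"
  assumes "summable (\<lambda>l. real l * c l)" "\<And>l. c l \<ge> 0"
  shows "summable c"
proof (rule summable_comparison_test'[OF assms(1), of 1])
  fix l :: nat assume "1 \<le> l"
  then have "1 * c l \<le> real l * c l" using assms(2)[of l] by (intro mult_right_mono) auto
  then show "norm (c l) \<le> real l * c l" using assms(2)[of l] by simp
qed

lemma tendsto_0_bounded:
  fixes f :: "nat \<Rightarrow> real"
  assumes "f \<longlonglongrightarrow> 0"
  obtains B where "B > 0" "\<And>n. f n \<le> B"
proof -
  have "Bseq f" using assms convergent_def convergent_imp_Bseq by blast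
  then obtain B where "B > 0" "\<And>n. norm (f n) \<le> B" unfolding Bseq_def by blast
  then show ?thesis by (intro that[of B]) (auto simp: abs_le_iff)
qed

lemma tannery_null:
  fixes a :: "nat \<Rightarrow> nat \<Rightarrow> real"
  assumes "\<And>i. a i \<longlonglongrightarrow> 0" "\<And>i k. \<bar>a i k\<bar> \<le> M i" "summable M"
  shows "(\<lambda>k. \<Sum>i. a i k) \<longlonglongrightarrow> 0"
proof -
  have "((\<lambda>k. \<Sum>i. a i k) \<longlongrightarrow> (\<Sum>i. 0)) sequentially"
    using assms by (intro conjunct2[OF conjunct2[OF tannerys_theorem[where M = M]]] always_eventually) auto
  then show ?thesis by simp
qed

section \<open>Logarithmic perturbations of the Poisson weights\<close>

locale feller =
  fixes \<theta> :: real
  assumes theta_pos: "\<theta> > 0"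
begin

abbreviation "a \<equiv> ewens_coeff \<theta>"
abbreviation "wt \<equiv> ewens_weight \<theta>"

end

text \<open>
  \<open>T i\<close> dominates both \<open>t i\<close> and the Poisson weights \<open>q i\<close>, and factors as \<open>q i\<close> convolved with \<open>H i\<close>. Since \<open>H i\<close> has constant
  term 1 for \<open>i > J\<close>, the coefficients of \<open>G {1..n}\<close> stabilise to \<open>g\<close>; the logarithmic derivative of \<open>G\<close> is bounded by \<open>f\<close>.
\<close>

locale log_perturbation = feller \<theta> for \<theta> :: real +
  fixes J :: nat and t :: "nat \<Rightarrow> nat \<Rightarrow> real" and e c :: "nat \<Rightarrow> real"
  assumes t_nonneg: "\<And>i l. i \<ge> 1 \<Longrightarrow> t i l \<ge> 0"
    and t_0: "\<And>i. i > J \<Longrightarrow> t i 0 = 1"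
    and t_0_le: "\<And>i. i \<ge> 1 \<Longrightarrow> t i 0 \<le> 1"
    and t_pos: "\<And>i. i \<ge> 1 \<Longrightarrow> \<exists>l. t i l > 0"
    and t_close: "\<And>i l. i \<ge> 1 \<Longrightarrow> \<bar>t i l - fps_exp (\<theta> / real i) $ l\<bar> \<le> e i * c l / real i"
    and e_nonneg: "\<And>i. e i \<ge> 0" and c_nonneg: "\<And>l. c l \<ge> 0"
    and e_tendsto: "e \<longlonglongrightarrow> 0"
    and e_summable: "summable (\<lambda>i. e i / real i)"
    and c_summable: "summable (\<lambda>l. real l * c l)"
    and small: "(\<Sum>i. e (i + Suc J) / real (i + Suc J)) * suminf c \<le> 1 / 8"
begin


definition q :: "nat \<Rightarrow> nat \<Rightarrow> real" where
  "q i l = fps_exp (\<theta> / real i) $ l"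

text \<open>For i > J the values \<open>t i 0\<close> and \<open>q i 0\<close> are both 1, so the
  error there is exactly 0; the general bound in its place would destroy the constant term 1 of
  \<open>H i\<close>.\<close>

definition D :: "nat \<Rightarrow> nat \<Rightarrow> real" where
  "D i l = (if l = 0 \<and> i > J then 0 else e i * c l / real i)"

definition H :: "nat \<Rightarrow> real fps" where
  "H i = 1 + Abs_fps (D i)"

definition G :: "nat set \<Rightarrow> real fps" where
  "G I = (\<Prod>i\<in>I. H i oo fps_X ^ i)"

definition A :: "nat set \<Rightarrow> real fps" where
  "A I = (\<Prod>i\<in>I. fps_exp (\<theta> / real i) oo fps_X ^ i)"

text \<open>The sum q + D would also dominate, but it would not factor. Convolving q with 1 + D lets
  every sum over partitions of a product of majorants split into an \<open>A\<close> part and a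
  \<open>G\<close> part.\<close>

definition T :: "nat \<Rightarrow> nat \<Rightarrow> real" where
  "T i l = (fps_exp (\<theta> / real i) * H i) $ l"

text \<open>The coefficient of the infinite product: the cutoff k + J is at least k and at least J,
  and from there on \<open>G_nth_stable\<close> freezes the coefficient.\<close>

definition g :: "nat \<Rightarrow> real" where
  "g k = G {1..k + J} $ k"

lemma c_summable': "summable c"
  by (rule summable_of_summable_mult_nat[OF c_summable c_nonneg])

lemma D_nonneg: "D i l \<ge> 0"
  using e_nonneg[of i] c_nonneg[of l] by (simp add: D_def)

lemma D_le: "D i l \<le> e i * c l / real i"
  unfolding D_def using e_nonneg[of i] c_nonneg[of l] by auto

lemma q_nth: "q i l = (\<theta> / real i) ^ l / fact l"
  by (simp add: q_def)

lemma q_pos: "i \<ge> 1 \<Longrightarrow> q i l > 0"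
  using theta_pos by (simp add: q_nth)

lemma q_0 [simp]: "q i 0 = 1"
  by (simp add: q_def)

lemma fps_le_1_exp: "fps_le 1 (fps_exp (\<theta> / real i))"
  using theta_pos by (simp add: fps_le_def fps_one_nth)

lemma fps_le_1_H: "fps_le 1 (H i)"
  by (simp add: fps_le_def H_def D_nonneg)

lemma fps_le_1_compose: "fps_le 1 F \<Longrightarrow> i \<ge> 1 \<Longrightarrow> fps_le 1 (F oo fps_X ^ i)"
  using fps_le_compose_X_power[of 1 F i] by simp

lemma fps_le_0_of_1: "fps_le 1 F \<Longrightarrow> fps_le 0 F"
  using fps_le_trans[OF fps_le_0_1] .

lemma fps_le_1_A: "0 \<notin> I \<Longrightarrow> fps_le 1 (A I)"
  unfolding A_def by (intro fps_le_1_prod fps_le_1_compose fps_le_1_exp) (auto simp: Suc_le_eq intro: gr0I)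

lemma fps_le_1_G: "0 \<notin> I \<Longrightarrow> fps_le 1 (G I)"
  unfolding G_def by (intro fps_le_1_prod fps_le_1_compose fps_le_1_H) (auto simp: Suc_le_eq intro: gr0I)

lemmas fps_le_0_A = fps_le_0_of_1[OF fps_le_1_A]
lemmas fps_le_0_G = fps_le_0_of_1[OF fps_le_1_G]
lemmas fps_le_0_H = fps_le_0_of_1[OF fps_le_1_H]

lemma G_mono:
  assumes "finite I" "0 \<notin> I" "I' \<subseteq> I"
  shows "fps_le (G I') (G I)"
proof -
  have "fps_le (G I' * 1) (G I' * G (I - I'))"
    using assms by (intro fps_le_mult fps_le_0_G fps_le_1_G) auto
  also have "G I' * G (I - I') = G I"
    using assms by (simp add: G_def prod.subset_diff mult.commute)
  finally show ?thesis by simp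
qed

lemma A_mono:
  assumes "finite I" "0 \<notin> I" "I' \<subseteq> I"
  shows "fps_le (A I') (A I)"
proof -
  have "fps_le (A I' * 1) (A I' * A (I - I'))"
    using assms by (intro fps_le_mult fps_le_0_A fps_le_1_A) auto
  also have "A I' * A (I - I') = A I"
    using assms by (simp add: A_def prod.subset_diff mult.commute)
  finally show ?thesis by simp
qed

lemma A_nth: "N \<le> n \<Longrightarrow> A {1..n} $ N = a N"
  unfolding A_def by (rule prod_exp_nth)

lemma G_nth_stable:
  assumes "k \<le> m" "J \<le> m" "m \<le> n"
  shows "G {1..n} $ k = G {1..m} $ k"
proof -
  have "{1..r} = {0<..r}" for r :: nat by auto
  then show ?thesis
    unfolding G_def using prod_fps_compose_nth_stable[of k m 0 n H] assms by (simp add: H_def D_def)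
qed

text \<open>Enlarging I to a long interval only adds factors that are at least 1, and there the
  coefficient has stabilised.\<close>

lemma G_nth_le_g:
  assumes "finite I" "0 \<notin> I"
  shows "G I $ k \<le> g k"
proof -
  obtain b where b: "I \<subseteq> {..b}" using assms(1) by (meson atMost_iff finite_nat_set_iff_bounded_le subsetI)
  have "I \<subseteq> {1..b + k + J}"
  proof
    fix i assume "i \<in> I"
    moreover have "i \<noteq> 0" using \<open>i \<in> I\<close> assms by metis
    moreover have "i \<le> b" using \<open>i \<in> I\<close> b by auto
    ultimately show "i \<in> {1..b + k + J}" by auto
  qed
  then have "G I $ k \<le> G {1..b + k + J} $ k"
    by (intro fps_leD G_mono) auto
  also have "\<dots> = g k" unfolding g_def by (rule G_nth_stable) auto
  finally show ?thesis .
qed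

lemma g_nonneg: "g k \<ge> 0"
  unfolding g_def using fps_leD[OF fps_le_0_G, of "{1..k + J}" k] by simp

text \<open>Each factor contributes at most 1 + y with y = \<open>e i / i * suminf c\<close>, and 1
  + y \<le> exp y turns the product into a sum. The bound yields the summability of \<open>g\<close>
  as well as the smallness of the product over i > J.\<close>

lemma sum_G_nth_le:
  assumes "finite I" "0 \<notin> I"
  shows "(\<Sum>k\<le>K. G I $ k) \<le> exp ((\<Sum>i\<in>I. e i / real i) * suminf c)"
proof -
  have ge1: "i \<ge> 1" if "i \<in> I" for i using that assms(2) by (metis One_nat_def Suc_leI gr0I)
  have "(\<Sum>k\<le>K. G I $ k) \<le> (\<Prod>i\<in>I. \<Sum>k\<le>K. (H i oo fps_X ^ i) $ k)"
    unfolding G_def using ge1 by (intro sum_nth_prod_le fps_le_0_compose_X_power fps_le_0_H) auto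
  also have "\<dots> \<le> (\<Prod>i\<in>I. exp ((e i / real i) * suminf c))"
  proof (intro prod_mono conjI)
    fix i assume i: "i \<in> I"
    show "0 \<le> (\<Sum>k\<le>K. (H i oo fps_X ^ i) $ k)"
      using fps_le_0_compose_X_power[OF fps_le_0_H ge1[OF i], of i] by (intro sum_nonneg) (auto simp: fps_le_def)
    have "(\<Sum>k\<le>K. (H i oo fps_X ^ i) $ k) \<le> (\<Sum>k\<le>K. H i $ k)"
      by (intro sum_nth_compose_X_power_le fps_le_0_H ge1[OF i])
    also have "\<dots> = 1 + (\<Sum>k\<le>K. D i k)"
      by (simp add: H_def sum.distrib fps_one_nth)
    also have "(\<Sum>k\<le>K. D i k) \<le> (\<Sum>k\<le>K. (e i / real i) * c k)"
      using D_le[of i] by (intro sum_mono) simp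
    also have "\<dots> = (e i / real i) * (\<Sum>k\<le>K. c k)" by (simp add: sum_distrib_left)
    also have "\<dots> \<le> (e i / real i) * suminf c"
      using e_nonneg[of i] by (intro mult_left_mono sum_le_suminf c_summable') (auto simp: c_nonneg)
    also have "1 + \<dots> \<le> exp \<dots>" by (rule exp_ge_add_one_self)
    finally show "(\<Sum>k\<le>K. (H i oo fps_X ^ i) $ k) \<le> exp ((e i / real i) * suminf c)" by simp
  qed
  also have "\<dots> = exp ((\<Sum>i\<in>I. e i / real i) * suminf c)"
    by (cases "finite I") (simp_all add: exp_sum[symmetric] sum_distrib_right)
  finally show ?thesis .
qed

lemma g_summable: "summable g"
proof (rule bounded_imp_summable[OF g_nonneg])
  fix K
  have "(\<Sum>k\<le>K. g k) = (\<Sum>k\<le>K. G {1..K + J} $ k)"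
    unfolding g_def by (intro sum.cong refl G_nth_stable[symmetric]) auto
  also have "\<dots> \<le> exp ((\<Sum>i\<in>{1..K + J}. e i / real i) * suminf c)"
    by (rule sum_G_nth_le) auto
  also have "\<dots> \<le> exp ((\<Sum>i. e i / real i) * suminf c)"
    using e_nonneg by (auto intro!: mult_right_mono sum_le_suminf e_summable suminf_nonneg c_summable' c_nonneg)
  finally show "(\<Sum>k\<le>K. g k) \<le> exp ((\<Sum>i. e i / real i) * suminf c)" .
qed

text \<open>Majorant for the summed derivatives of the factors of \<open>G\<close>: for k = i * l
  the term is at most \<open>k * (e i * c l / i) = e i * l * c l\<close>. Indexing by the cofactor l
  rather than by i provides the dominating sequence \<open>l * c l\<close>.\<close>

definition f :: "nat \<Rightarrow> real" where
  "f k = (\<Sum>l=1..k. if l dvd k then e (k div l) * (real l * c l) else 0)"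

lemma f_eq_suminf: "f k = (\<Sum>l. if l \<in> {1..k} \<and> l dvd k then e (k div l) * (real l * c l) else 0)"
  unfolding f_def by (subst suminf_finite[of "{1..k}"]) auto

lemma f_nonneg: "f k \<ge> 0"
  unfolding f_def by (intro sum_nonneg) (simp add: e_nonneg c_nonneg)

text \<open>For fixed l the index k div l tends to infinity, so each term vanishes; the bound
  \<open>E * l * c l\<close> is summable.\<close>

lemma f_tendsto: "f \<longlonglongrightarrow> 0"
proof -
  obtain E where E: "E > 0" "\<And>i. e i \<le> E" using tendsto_0_bounded[OF e_tendsto] by blast
  have lim: "(\<lambda>k. if l \<in> {1..k} \<and> l dvd k then e (k div l) * (real l * c l) else 0) \<longlonglongrightarrow> 0" for l
  proof (cases "l = 0")
    case False
    have "filterlim (\<lambda>k. k div l) at_top sequentially"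
      unfolding filterlim_at_top
    proof
      fix Z
      show "\<forall>\<^sub>F k in sequentially. Z \<le> k div l"
        using eventually_ge_at_top[of "Z * l"]
        by eventually_elim (use False in \<open>simp add: less_eq_div_iff_mult_less_eq\<close>)
    qed
    from filterlim_compose[OF e_tendsto this]
    have "(\<lambda>k. e (k div l) * (real l * c l)) \<longlonglongrightarrow> 0" by (rule tendsto_mult_left_zero)
    then show ?thesis
      by (rule Lim_null_comparison[rotated]) (auto simp: e_nonneg c_nonneg)
  qed simp
  have "(\<lambda>k. \<Sum>l. if l \<in> {1..k} \<and> l dvd k then e (k div l) * (real l * c l) else 0) \<longlonglongrightarrow> 0"
  proof (rule tannery_null[OF lim, where M = "\<lambda>l. E * (real l * c l)"])
    fix l k
    have "0 \<le> real l * c l" using c_nonneg by simp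
    then show "\<bar>if l \<in> {1..k} \<and> l dvd k then e (k div l) * (real l * c l) else 0\<bar> \<le> E * (real l * c l)"
      using E(1) mult_right_mono[OF E(2)] e_nonneg[of "k div l"] by (simp add: abs_mult)
  qed (intro summable_mult c_summable)
  moreover have "f = (\<lambda>k. \<Sum>l. if l \<in> {1..k} \<and> l dvd k then e (k div l) * (real l * c l) else 0)"
    by (rule ext) (rule f_eq_suminf)
  ultimately show ?thesis by (simp only:)
qed

lemma XD_sum_nth_le_f:
  assumes "finite I" "0 \<notin> I"
  shows "(\<Sum>i\<in>I. fps_XD (H i oo fps_X ^ i)) $ k \<le> f k"
proof (cases "k = 0")
  case False
  have ge1: "i \<ge> 1" if "i \<in> I" for i using that assms(2) by (metis One_nat_def Suc_leI gr0I)
  have "(\<Sum>i\<in>I. fps_XD (H i oo fps_X ^ i)) $ k = (\<Sum>i\<in>I. if i dvd k then real k * H i $ (k div i) else 0)"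
    unfolding fps_sum_nth fps_XD_nth using ge1 by (intro sum.cong refl) (simp add: fps_compose_X_power_nth)
  also have "\<dots> \<le> (\<Sum>i\<in>I. if i dvd k then e i * (real (k div i) * c (k div i)) else 0)"
  proof (intro sum_mono)
    fix i assume i: "i \<in> I"
    show "(if i dvd k then real k * H i $ (k div i) else 0) \<le> (if i dvd k then e i * (real (k div i) * c (k div i)) else 0)"
    proof (cases "i dvd k")
      case True
      then obtain l where l: "k = i * l" by auto
      have "l \<noteq> 0" "i \<ge> 1" using False l ge1[OF i] by auto
      then have "real k * H i $ (k div i) = real (i * l) * D i l"
        using l by (simp add: H_def fps_one_nth)
      also have "\<dots> \<le> real (i * l) * (e i * c l / real i)"
        by (intro mult_left_mono D_le) simp
      also have "\<dots> = e i * (real l * c l)" using \<open>i \<ge> 1\<close> by simp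
      finally show ?thesis using l \<open>i \<ge> 1\<close> by simp
    qed simp
  qed
  also have "\<dots> = (\<Sum>i\<in>{i\<in>I. i dvd k}. e i * (real (k div i) * c (k div i)))"
    using assms by (subst sum.inter_filter) auto
  \<comment> \<open>Writing i as k div (k div i) prepares the passage to the complementary divisor
    l.\<close>
  also have "\<dots> = (\<Sum>i\<in>{i\<in>I. i dvd k}. e (k div (k div i)) * (real (k div i) * c (k div i)))"
    using False by (intro sum.cong refl) (auto elim!: dvdE)
  also have "\<dots> = (\<Sum>l\<in>(\<lambda>i. k div i) ` {i\<in>I. i dvd k}. e (k div l) * (real l * c l))"
  proof -
    have "inj_on (\<lambda>i. k div i) {i\<in>I. i dvd k}"
      using False by (intro inj_onI) (metis (lifting) dvd_div_eq_0_iff dvd_div_mult_self mem_Collect_eq mult_cancel_left)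
    then show ?thesis by (simp add: sum.reindex)
  qed
  also have "\<dots> \<le> (\<Sum>l\<in>{l\<in>{1..k}. l dvd k}. e (k div l) * (real l * c l))"
    using False by (intro sum_mono2) (auto simp: e_nonneg c_nonneg dvd_div_eq_0_iff Suc_le_eq elim!: dvdE)
  also have "\<dots> = f k" unfolding f_def by (subst sum.inter_filter) auto
  finally show ?thesis .
qed (simp add: fps_sum_nth fps_XD_nth f_def)

text \<open>Coefficient k of x G' \<le> f G, with f read as a power series.\<close>

lemma k_g_le: "real k * g k \<le> (\<Sum>i\<le>k. g i * f (k - i))"
proof -
  let ?I = "{1..k + J}"
  have "real k * g k = fps_XD (G ?I) $ k" by (simp add: g_def fps_XD_nth)
  also have "\<dots> \<le> ((\<Sum>i\<in>?I. fps_XD (H i oo fps_X ^ i)) * G ?I) $ k"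
    unfolding G_def by (intro fps_leD fps_XD_prod_le fps_le_1_compose fps_le_1_H) auto
  also have "\<dots> = (G ?I * (\<Sum>i\<in>?I. fps_XD (H i oo fps_X ^ i))) $ k" by (simp only: mult.commute)
  also have "\<dots> \<le> (\<Sum>i\<le>k. g i * f (k - i))"
    unfolding fps_mult_nth atLeast0AtMost
  proof (intro sum_mono mult_mono G_nth_le_g XD_sum_nth_le_f g_nonneg)
    fix i
    show "0 \<le> (\<Sum>i\<in>?I. fps_XD (H i oo fps_X ^ i)) $ (k - i)"
    proof -
      have "fps_le 0 (fps_XD (H j oo fps_X ^ j))" if "j \<in> ?I" for j
        using that by (intro fps_le_0_XD fps_le_0_compose_X_power fps_le_0_H) auto
      then show ?thesis unfolding fps_sum_nth by (intro sum_nonneg) (auto simp: fps_le_def)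
    qed
  qed auto
  finally show ?thesis .
qed

text \<open>The convolution of a summable sequence with a bounded null sequence is null.\<close>

lemma k_g_tendsto: "(\<lambda>k. real k * g k) \<longlonglongrightarrow> 0"
proof -
  obtain F where F: "\<And>k. f k \<le> F" using tendsto_0_bounded[OF f_tendsto] by blast
  have lim: "(\<lambda>k. if i \<le> k then g i * f (k - i) else 0) \<longlonglongrightarrow> 0" for i
  proof -
    have "(\<lambda>k. g i * f (k - i)) \<longlonglongrightarrow> 0"
      by (intro tendsto_mult_right_zero filterlim_compose[OF f_tendsto filterlim_minus_const_nat_at_top])
    then show ?thesis
      by (rule Lim_null_comparison[rotated]) (simp add: g_nonneg f_nonneg)
  qed
  have "(\<lambda>k. \<Sum>i. if i \<le> k then g i * f (k - i) else 0) \<longlonglongrightarrow> 0"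
  proof (rule tannery_null[OF lim, where M = "\<lambda>i. g i * F"])
    fix i k
    show "\<bar>if i \<le> k then g i * f (k - i) else 0\<bar> \<le> g i * F"
      using mult_left_mono[OF F g_nonneg, of i "k - i"] mult_nonneg_nonneg[OF g_nonneg f_nonneg, of i "k - i"]
      using mult_nonneg_nonneg[OF g_nonneg order_trans[OF f_nonneg F], of i] by simp
  qed (intro summable_mult2 g_summable)
  moreover have "(\<Sum>i. if i \<le> k then g i * f (k - i) else 0) = (\<Sum>i\<le>k. g i * f (k - i))" for k
    by (subst suminf_finite[of "{..k}"]) auto
  ultimately have "(\<lambda>k. \<Sum>i\<le>k. g i * f (k - i)) \<longlonglongrightarrow> 0" by simp
  then show ?thesis
    by (rule Lim_null_comparison[rotated]) (auto intro!: always_eventually simp: k_g_le g_nonneg)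
qed

end

text \<open>Telescoping. The hypothesis bounds the error by X - Y and not by an arbitrary quantity;
  this keeps the right side a difference of two products, hence later of two generating
  functions.\<close>

lemma abs_prod_diff_le:
  fixes x y X Y :: "'i \<Rightarrow> real"
  assumes "\<And>i. i \<in> S \<Longrightarrow> \<bar>x i - y i\<bar> \<le> X i - Y i" "\<And>i. i \<in> S \<Longrightarrow> \<bar>x i\<bar> \<le> X i" "\<And>i. i \<in> S \<Longrightarrow> \<bar>y i\<bar> \<le> Y i"
  shows "\<bar>(\<Prod>i\<in>S. x i) - (\<Prod>i\<in>S. y i)\<bar> \<le> (\<Prod>i\<in>S. X i) - (\<Prod>i\<in>S. Y i)"
  using assms
proof (induction S rule: infinite_finite_induct)
  case (insert i S)
  let ?x = "\<Prod>i\<in>S. x i" let ?y = "\<Prod>i\<in>S. y i" let ?X = "\<Prod>i\<in>S. X i" let ?Y = "\<Prod>i\<in>S. Y i"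
  have y: "\<bar>?y\<bar> \<le> ?Y" unfolding abs_prod using insert by (intro prod_mono) auto
  have "\<bar>x i * ?x - y i * ?y\<bar> = \<bar>x i * (?x - ?y) + (x i - y i) * ?y\<bar>" by (simp add: algebra_simps)
  also have "\<dots> \<le> \<bar>x i\<bar> * \<bar>?x - ?y\<bar> + \<bar>x i - y i\<bar> * \<bar>?y\<bar>"
    by (metis abs_mult abs_triangle_ineq)
  also have "\<dots> \<le> X i * (?X - ?Y) + (X i - Y i) * ?Y"
  proof (intro add_mono mult_mono)
    show "\<bar>x i\<bar> \<le> X i" "\<bar>x i - y i\<bar> \<le> X i - Y i" "\<bar>?x - ?y\<bar> \<le> ?X - ?Y"
      using insert by auto
    then show "0 \<le> X i" "0 \<le> X i - Y i" by linarith+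
  qed (use y in auto)
  also have "\<dots> = X i * ?X - Y i * ?Y" by (simp add: algebra_simps)
  finally show ?case using insert by simp
qed auto

context log_perturbation
begin

text \<open>Hybrid weights: \<open>mix {}\<close> gives the Ewens weights, \<open>mix {1..n}\<close>
  those of the structure, \<open>mix {1..m}\<close> the density cut off at m, and
  \<open>mix {J<..n}\<close> the perturbation of the large parts only.\<close>

definition mix :: "nat set \<Rightarrow> nat \<Rightarrow> nat \<Rightarrow> real" where
  "mix I i l = (if i \<in> I then t i l else q i l)"

definition mix_bound :: "nat set \<Rightarrow> nat \<Rightarrow> nat \<Rightarrow> real" where
  "mix_bound I i l = (if i \<in> I then T i l else q i l)"

text \<open>The cutoff m is independent of the size of the partition; \<open>eta\<close> below is
  the case where it equals the size.\<close>

definition R :: "nat \<Rightarrow> (nat \<Rightarrow> nat) \<Rightarrow> real" where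
  "R m \<alpha> = (\<Prod>i=1..m. t i (\<alpha> i) / q i (\<alpha> i))"

lemma ewens_weight_eq: "wt n \<alpha> = (\<Prod>i=1..n. q i (\<alpha> i))"
  unfolding ewens_weight_def q_nth by (intro prod.cong refl) (simp add: power_divide)

lemma abs_t_q_le:
  assumes "i \<ge> 1"
  shows "\<bar>t i l - q i l\<bar> \<le> D i l"
  using t_close[OF assms, of l] t_0[of i] by (auto simp: D_def q_def)

text \<open>The series of \<open>q i\<close> is at least 1 coefficientwise, so D is at most its
  convolution with q, which is T - q.\<close>

lemma abs_t_q_le_T:
  assumes "i \<ge> 1"
  shows "\<bar>t i l - q i l\<bar> \<le> T i l - q i l"
proof -
  have "fps_le (1 * Abs_fps (D i)) (fps_exp (\<theta> / real i) * Abs_fps (D i))"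
    by (intro fps_le_mult fps_le_1_exp) (auto simp: fps_le_def D_nonneg)
  then have "D i l \<le> (fps_exp (\<theta> / real i) * Abs_fps (D i)) $ l"
    by (auto dest: fps_leD[of _ _ l])
  also have "\<dots> = T i l - q i l" by (simp add: T_def H_def q_def algebra_simps)
  finally show ?thesis using abs_t_q_le[OF assms, of l] by simp
qed

lemma t_le_T: "i \<ge> 1 \<Longrightarrow> t i l \<le> T i l"
  using abs_t_q_le_T[of i l] by linarith

lemma q_le_T: "i \<ge> 1 \<Longrightarrow> q i l \<le> T i l"
  using abs_t_q_le_T[of i l] by linarith

lemma abs_prod_mix_diff_le:
  assumes "0 \<notin> S" "I' \<subseteq> I"
  shows "\<bar>(\<Prod>i\<in>S. mix I i (\<alpha> i)) - (\<Prod>i\<in>S. mix I' i (\<alpha> i))\<bar>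
       \<le> (\<Prod>i\<in>S. mix_bound I i (\<alpha> i)) - (\<Prod>i\<in>S. mix_bound I' i (\<alpha> i))"
proof (rule abs_prod_diff_le)
  fix i assume "i \<in> S"
  then have "i \<ge> 1" using assms(1) by (metis One_nat_def Suc_leI gr0I)
  then show "\<bar>mix I i (\<alpha> i) - mix I' i (\<alpha> i)\<bar> \<le> mix_bound I i (\<alpha> i) - mix_bound I' i (\<alpha> i)"
    "\<bar>mix I i (\<alpha> i)\<bar> \<le> mix_bound I i (\<alpha> i)" "\<bar>mix I' i (\<alpha> i)\<bar> \<le> mix_bound I' i (\<alpha> i)"
    using assms(2) abs_t_q_le_T[of i "\<alpha> i"] t_nonneg[of i "\<alpha> i"] t_le_T[of i "\<alpha> i"] q_pos[of i "\<alpha> i"]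
    by (auto simp: mix_def mix_bound_def)
qed

lemma sum_prod_mix_bound:
  assumes "finite S" "0 \<notin> S" "I \<subseteq> S"
  shows "(\<Sum>\<alpha>\<in>wparts S N. \<Prod>i\<in>S. mix_bound I i (\<alpha> i)) = (A S * G I) $ N"
proof -
  have "(\<Prod>i\<in>S. fps_exp (\<theta> / real i) * (if i \<in> I then H i else 1) oo fps_X ^ i)
      = (\<Prod>i\<in>S. (fps_exp (\<theta> / real i) oo fps_X ^ i) * (if i \<in> I then H i oo fps_X ^ i else 1))"
  proof (rule prod.cong[OF refl])
    fix i assume "i \<in> S"
    then have "i \<ge> 1" using assms(2) by (metis One_nat_def Suc_leI gr0I)
    then show "fps_exp (\<theta> / real i) * (if i \<in> I then H i else 1) oo fps_X ^ i
        = (fps_exp (\<theta> / real i) oo fps_X ^ i) * (if i \<in> I then H i oo fps_X ^ i else 1)"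
      by (simp add: fps_compose_X_power_mult)
  qed
  also have "\<dots> = A S * (\<Prod>i\<in>S. if i \<in> I then H i oo fps_X ^ i else 1)"
    by (simp add: prod.distrib A_def)
  also have "(\<Prod>i\<in>S. if i \<in> I then H i oo fps_X ^ i else 1) = G I"
    unfolding G_def using assms by (subst prod.inter_restrict[symmetric]) (auto simp: Int_absorb1)
  finally have "(A S * G I) $ N = (\<Prod>i\<in>S. fps_exp (\<theta> / real i) * (if i \<in> I then H i else 1) oo fps_X ^ i) $ N"
    by simp
  also have "\<dots> = (\<Sum>\<alpha>\<in>wparts S N. \<Prod>i\<in>S. mix_bound I i (\<alpha> i))"
    using assms(1,2) by (subst prod_fps_compose_X_power_nth)
      (auto intro!: sum.cong prod.cong simp: mix_bound_def T_def q_def)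
  finally show ?thesis by simp
qed

text \<open>The majorants sum to coefficient n of \<open>A {1..n} * (G I - G I')\<close>, where only
  coefficients of A up to n enter, and these are the Ewens ones. The difference of the G is
  nonnegative and at most \<open>g\<close>, so the decay of \<open>k * g k\<close> supplies
  B.\<close>

lemma sum_abs_mix_diff_le:
  assumes "n \<ge> 1" "I' \<subseteq> I" "I \<subseteq> {1..n}"
    and B: "\<And>k. n < 2 * k \<Longrightarrow> real k * g k \<le> B"
  shows "(\<Sum>\<alpha>\<in>partitions_of n. \<bar>(\<Prod>i=1..n. mix I i (\<alpha> i)) - (\<Prod>i=1..n. mix I' i (\<alpha> i))\<bar>)
       \<le> a n * (2 * (\<Sum>k\<le>n div 2. G I $ k - G I' $ k) + 2 / \<theta> * B)"
proof -
  have fin: "finite I" "0 \<notin> I" "0 \<notin> I'"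
    using assms by (auto intro: finite_subset[OF assms(3)])
  have "(\<Sum>\<alpha>\<in>partitions_of n. \<bar>(\<Prod>i=1..n. mix I i (\<alpha> i)) - (\<Prod>i=1..n. mix I' i (\<alpha> i))\<bar>)
      \<le> (\<Sum>\<alpha>\<in>wparts {1..n} n. (\<Prod>i=1..n. mix_bound I i (\<alpha> i)) - (\<Prod>i=1..n. mix_bound I' i (\<alpha> i)))"
    unfolding partitions_of_eq_wparts using assms by (intro sum_mono abs_prod_mix_diff_le) auto
  also have "\<dots> = (A {1..n} * G I) $ n - (A {1..n} * G I') $ n"
    using assms by (subst (1 2) sum_prod_mix_bound[symmetric]) (auto simp: sum_subtractf)
  also have "\<dots> = ((G I - G I') * A {1..n}) $ n" by (simp add: algebra_simps)
  also have "\<dots> = (\<Sum>k\<le>n. (G I $ k - G I' $ k) * a (n - k))"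
    unfolding fps_mult_nth atLeast0AtMost by (intro sum.cong refl) (simp add: A_nth[simplified])
  also have "\<dots> \<le> a n * (2 * (\<Sum>k\<le>n div 2. G I $ k - G I' $ k) + 2 / \<theta> * B)"
  proof (rule sum_mult_ewens_coeff_le[OF theta_pos assms(1)])
    show "0 \<le> G I $ k - G I' $ k" for k
      using fps_leD[OF G_mono[OF fin(1,2) assms(2)], of k] by simp
    fix k assume k: "n < 2 * k"
    have "G I $ k - G I' $ k \<le> g k"
      using G_nth_le_g[OF fin(1,2), of k] fps_leD[OF fps_le_0_G[OF fin(3)], of k] by simp
    then have "real k * (G I $ k - G I' $ k) \<le> real k * g k" by (intro mult_left_mono) auto
    also have "\<dots> \<le> B" by (rule B[OF k])
    finally show "real k * (G I $ k - G I' $ k) \<le> B" .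
  qed
  finally show ?thesis .
qed

lemma eventually_k_g_le:
  assumes "\<epsilon> > 0"
  obtains N where "\<And>n k. n \<ge> N \<Longrightarrow> n < 2 * k \<Longrightarrow> real k * g k \<le> \<epsilon>"
proof -
  have "eventually (\<lambda>k. real k * g k < \<epsilon>) sequentially"
    using order_tendstoD(2)[OF k_g_tendsto assms] .
  then obtain N where "\<And>k. k \<ge> N \<Longrightarrow> real k * g k < \<epsilon>" by (auto simp: eventually_sequentially)
  then have "real k * g k \<le> \<epsilon>" if "n \<ge> 2 * N" "n < 2 * k" for n k
    using that by (intro less_imp_le) auto
  then show ?thesis using that by blast
qed

lemma prod_mix_atMost:
  assumes "m \<le> n"
  shows "(\<Prod>i=1..n. mix {1..m} i (\<alpha> i)) = R m \<alpha> * wt n \<alpha>"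
proof -
  have "R m \<alpha> = (\<Prod>i=1..n. if i \<in> {1..m} then t i (\<alpha> i) / q i (\<alpha> i) else 1)"
    unfolding R_def using assms by (subst prod.inter_restrict[symmetric]) (auto intro!: prod.cong)
  then have "R m \<alpha> * wt n \<alpha>
      = (\<Prod>i=1..n. (if i \<in> {1..m} then t i (\<alpha> i) / q i (\<alpha> i) else 1) * q i (\<alpha> i))"
    by (simp add: ewens_weight_eq prod.distrib)
  also have "\<dots> = (\<Prod>i=1..n. mix {1..m} i (\<alpha> i))"
  proof (intro prod.cong refl)
    fix i assume "i \<in> {1..n}"
    then have "q i (\<alpha> i) > 0" by (intro q_pos) auto
    then show "(if i \<in> {1..m} then t i (\<alpha> i) / q i (\<alpha> i) else 1) * q i (\<alpha> i) = mix {1..m} i (\<alpha> i)"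
      by (simp add: mix_def)
  qed
  finally show ?thesis by simp
qed

text \<open>For m \<ge> J the products \<open>G {1..n}\<close> and \<open>G {1..m}\<close> agree
  below degree m, so only a tail of the summable \<open>g\<close> is left, uniformly in n.\<close>

lemma sum_abs_R_diff_le:
  assumes "\<epsilon> > 0"
  obtains m0 where "m0 \<ge> J"
    "\<And>m. m \<ge> m0 \<Longrightarrow> \<forall>\<^sub>F n in sequentially.
       (\<Sum>\<alpha>\<in>partitions_of n. \<bar>R n \<alpha> - R m \<alpha>\<bar> * wt n \<alpha>) \<le> \<epsilon> * a n"
proof -
  have "\<epsilon> / 4 > 0" using assms by simp
  from suminf_exist_split[OF this g_summable] obtain M where
    M: "\<And>m. m \<ge> M \<Longrightarrow> norm (\<Sum>i. g (i + m)) < \<epsilon> / 4" by auto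
  \<comment> \<open>With a tail of \<epsilon> / 4 and B = \<epsilon> * \<theta> / 4, the bound 2 *
    tail + 2 / \<theta> * B equals \<epsilon>.\<close>
  have "\<epsilon> * \<theta> / 4 > 0" using assms theta_pos by simp
  from eventually_k_g_le[OF this] obtain N where
    N: "\<And>n k. n \<ge> N \<Longrightarrow> n < 2 * k \<Longrightarrow> real k * g k \<le> \<epsilon> * \<theta> / 4" by blast
  have "\<forall>\<^sub>F n in sequentially.
       (\<Sum>\<alpha>\<in>partitions_of n. \<bar>R n \<alpha> - R m \<alpha>\<bar> * wt n \<alpha>) \<le> \<epsilon> * a n"
    if m: "m \<ge> max M J" for m
    using eventually_ge_at_top[of "max N (max m 1)"]
  proof eventually_elim
    case (elim n)
    have "(\<Sum>\<alpha>\<in>partitions_of n. \<bar>R n \<alpha> - R m \<alpha>\<bar> * wt n \<alpha>)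
        = (\<Sum>\<alpha>\<in>partitions_of n. \<bar>(\<Prod>i=1..n. mix {1..n} i (\<alpha> i)) - (\<Prod>i=1..n. mix {1..m} i (\<alpha> i))\<bar>)"
    proof (intro sum.cong refl)
      fix \<alpha>
      have "wt n \<alpha> \<ge> 0"
        unfolding ewens_weight_eq by (intro prod_nonneg) (simp add: less_imp_le[OF q_pos])
      then have "\<bar>R n \<alpha> - R m \<alpha>\<bar> * wt n \<alpha> = \<bar>(R n \<alpha> - R m \<alpha>) * wt n \<alpha>\<bar>"
        by (simp add: abs_mult)
      also have "\<dots> = \<bar>(\<Prod>i=1..n. mix {1..n} i (\<alpha> i)) - (\<Prod>i=1..n. mix {1..m} i (\<alpha> i))\<bar>"
        using elim prod_mix_atMost[of n n \<alpha>] prod_mix_atMost[of m n \<alpha>] by (simp add: left_diff_distrib)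
      finally show "\<bar>R n \<alpha> - R m \<alpha>\<bar> * wt n \<alpha>
          = \<bar>(\<Prod>i=1..n. mix {1..n} i (\<alpha> i)) - (\<Prod>i=1..n. mix {1..m} i (\<alpha> i))\<bar>" .
    qed
    also have "\<dots> \<le> a n * (2 * (\<Sum>k\<le>n div 2. G {1..n} $ k - G {1..m} $ k) + 2 / \<theta> * (\<epsilon> * \<theta> / 4))"
      using elim N by (intro sum_abs_mix_diff_le) auto
    also have "\<dots> \<le> a n * (2 * (\<epsilon> / 4) + 2 / \<theta> * (\<epsilon> * \<theta> / 4))"
    proof (intro mult_left_mono add_right_mono)
      have "(\<Sum>k\<le>n div 2. G {1..n} $ k - G {1..m} $ k) \<le> (\<Sum>k\<le>n. if k \<ge> m then g k else 0)"
      proof (rule order_trans[OF sum_mono sum_mono2])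
        fix k assume "k \<in> {..n div 2}"
        show "G {1..n} $ k - G {1..m} $ k \<le> (if k \<ge> m then g k else 0)"
        proof (cases "k \<ge> m")
          case True
          then show ?thesis using G_nth_le_g[of "{1..n}" k] fps_leD[OF fps_le_0_G[of "{1..m}"], of k] by simp
        next
          case False
          then show ?thesis using G_nth_stable[of k m n] m elim by simp
        qed
      qed (auto simp: g_nonneg)
      also have "\<dots> = (\<Sum>k\<in>{m..n}. g k)"
        by (subst sum.inter_filter[symmetric]) (auto intro: sum.cong)
      also have "\<dots> = (\<Sum>i\<le>n - m. g (i + m))"
        using elim by (intro sum.reindex_bij_witness[of _ "\<lambda>i. i + m" "\<lambda>k. k - m"]) auto
      also have "\<dots> \<le> (\<Sum>i. g (i + m))"
        using g_summable by (intro sum_le_suminf) (auto simp: g_nonneg summable_iff_shift)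
      also have "\<dots> \<le> \<epsilon> / 4" using M[of m] m by simp
      finally show "(\<Sum>k\<le>n div 2. G {1..n} $ k - G {1..m} $ k) \<le> \<epsilon> / 4" .
    qed (use ewens_coeff_pos[OF theta_pos, of n] in auto)
    also have "\<dots> = \<epsilon> * a n" using theta_pos by simp
    finally show ?case .
  qed
  then show ?thesis using that[of "max M J"] by simp
qed

subsection \<open>Uniform integrability\<close>

lemma fps_summable_H: "fps_summable (H i)"
proof -
  have "summable (\<lambda>l. (e i / real i) * (real l * c l + c l))"
    by (intro summable_mult summable_add c_summable c_summable')
  then have "summable (\<lambda>l. (real l + 1) * D i l)"
  proof (rule summable_comparison_test'[where N = 0])
    fix l
    have "(real l + 1) * D i l \<le> (real l + 1) * (e i * c l / real i)"
      by (intro mult_left_mono D_le) simp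
    then show "norm ((real l + 1) * D i l) \<le> (e i / real i) * (real l * c l + c l)"
      using D_nonneg[of i l] by (simp add: algebra_simps add_divide_distrib)
  qed
  then have "fps_summable (Abs_fps (D i))"
    by (simp add: fps_summable_def fps_le_def D_nonneg)
  then show ?thesis unfolding H_def by (intro fps_summable_add fps_summable_1)
qed

lemma fps_summable_A: "0 \<notin> I \<Longrightarrow> fps_summable (A I)"
  unfolding A_def using theta_pos
  by (intro fps_summable_prod fps_summable_compose_X_power fps_summable_exp) (auto simp: Suc_le_eq intro: gr0I)

lemma fps_summable_G: "0 \<notin> I \<Longrightarrow> fps_summable (G I)"
  unfolding G_def
  by (intro fps_summable_prod fps_summable_compose_X_power fps_summable_H) (auto simp: Suc_le_eq intro: gr0I)

text \<open>Majorant of the density built from T: its weighted sums are explicit coefficients, and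
  each of its factors is at least 1.\<close>

definition RT :: "nat \<Rightarrow> (nat \<Rightarrow> nat) \<Rightarrow> real" where
  "RT m \<alpha> = (\<Prod>i=1..m. T i (\<alpha> i) / q i (\<alpha> i))"

lemma RT_eq: 
  assumes "m \<le> n"
  shows "RT m \<alpha> * wt n \<alpha> = (\<Prod>i=1..m. T i (\<alpha> i)) * (\<Prod>i=m+1..n. q i (\<alpha> i))"
proof -
  have "{1..n} = {1..m} \<union> {m+1..n}" using assms by auto
  then have "wt n \<alpha> = (\<Prod>i=1..m. q i (\<alpha> i)) * (\<Prod>i=m+1..n. q i (\<alpha> i))"
    by (simp add: ewens_weight_eq prod.union_disjoint)
  moreover have "RT m \<alpha> * (\<Prod>i=1..m. q i (\<alpha> i)) = (\<Prod>i=1..m. T i (\<alpha> i))"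
    unfolding RT_def prod.distrib[symmetric]
  proof (intro prod.cong refl)
    fix i assume "i \<in> {1..m}"
    then have "q i (\<alpha> i) > 0" by (intro q_pos) auto
    then show "T i (\<alpha> i) / q i (\<alpha> i) * q i (\<alpha> i) = T i (\<alpha> i)" by simp
  qed
  ultimately show ?thesis by (simp add: mult.assoc[symmetric])
qed

text \<open>Parts up to m of total size k carry weight \<open>v k\<close>, the other parts at most
  \<open>a (n - k)\<close>. For fixed m the finite product \<open>A {1..m} * G {1..m}\<close> has a
  finite first moment, so \<open>v\<close> has both the small tail and the decay that the
  convolution bound asks for.\<close>

lemma sum_RT_large:
  assumes "\<epsilon> > 0"
  obtains K where "\<forall>\<^sub>F n in sequentially.
       (\<Sum>\<alpha>\<in>partitions_of n. (if K < (\<Sum>i=1..m. i * \<alpha> i) then RT m \<alpha> * wt n \<alpha> else 0)) \<le> \<epsilon> * a n"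
proof -
  define v where "v k = (A {1..m} * G {1..m}) $ k" for k
  have W: "fps_summable (A {1..m} * G {1..m})"
    by (intro fps_summable_mult fps_summable_A fps_summable_G) auto
  then have v0: "v k \<ge> 0" for k by (simp add: v_def fps_summable_def fps_le_def)
  have "summable v" using fps_summable_imp_summable(1)[OF W] by (simp add: v_def[abs_def])
  have vlim: "(\<lambda>k. real k * v k) \<longlonglongrightarrow> 0" using fps_summable_imp_summable(2)[OF W] by (simp add: v_def)
  have "\<epsilon> / 4 > 0" using assms by simp
  from suminf_exist_split[OF this \<open>summable v\<close>] obtain K where
    K: "norm (\<Sum>i. v (i + K)) < \<epsilon> / 4" by auto
  have "\<epsilon> * \<theta> / 4 > 0" using assms theta_pos by simp
  from order_tendstoD(2)[OF vlim this] obtain N where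
    N: "\<And>k. k \<ge> N \<Longrightarrow> real k * v k < \<epsilon> * \<theta> / 4" by (auto simp: eventually_sequentially)
  define w where "w k = (if K < k then v k else 0)" for k
  have "\<forall>\<^sub>F n in sequentially.
       (\<Sum>\<alpha>\<in>partitions_of n. (if K < (\<Sum>i=1..m. i * \<alpha> i) then RT m \<alpha> * wt n \<alpha> else 0)) \<le> \<epsilon> * a n"
    using eventually_ge_at_top[of "max (2 * N) (max m 1)"]
  proof eventually_elim
    case (elim n)
    define \<phi> where "\<phi> \<beta> = (if K < (\<Sum>i=1..m. i * \<beta> i) then \<Prod>i=1..m. T i (\<beta> i) else 0)" for \<beta> :: "nat \<Rightarrow> nat"
    define \<psi> where "\<psi> \<gamma> = (\<Prod>i=m+1..n. q i (\<gamma> i))" for \<gamma> :: "nat \<Rightarrow> nat"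
    have U: "{1..n} = {1..m} \<union> {m+1..n}" using elim by auto
    have "(\<Sum>\<alpha>\<in>partitions_of n. (if K < (\<Sum>i=1..m. i * \<alpha> i) then RT m \<alpha> * wt n \<alpha> else 0))
        = (\<Sum>\<alpha>\<in>wparts {1..n} n. \<phi> (\<lambda>i. if i \<in> {1..m} then \<alpha> i else 0) * \<psi> (\<lambda>i. if i \<in> {m+1..n} then \<alpha> i else 0))"
      unfolding partitions_of_eq_wparts
    proof (intro sum.cong refl)
      fix \<alpha> :: "nat \<Rightarrow> nat"
      have "(\<Sum>i=1..m. i * (if i \<in> {1..m} then \<alpha> i else 0)) = (\<Sum>i=1..m. i * \<alpha> i)"
        "(\<Prod>i=1..m. T i (if i \<in> {1..m} then \<alpha> i else 0)) = (\<Prod>i=1..m. T i (\<alpha> i))"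
        "(\<Prod>i=m+1..n. q i (if i \<in> {m+1..n} then \<alpha> i else 0)) = (\<Prod>i=m+1..n. q i (\<alpha> i))"
        by (auto intro: sum.cong prod.cong)
      then show "(if K < (\<Sum>i=1..m. i * \<alpha> i) then RT m \<alpha> * wt n \<alpha> else 0)
          = \<phi> (\<lambda>i. if i \<in> {1..m} then \<alpha> i else 0) * \<psi> (\<lambda>i. if i \<in> {m+1..n} then \<alpha> i else 0)"
        using elim RT_eq[of m n \<alpha>] unfolding \<phi>_def \<psi>_def by simp
    qed
    also have "\<dots> = (\<Sum>k\<le>n. (\<Sum>\<beta>\<in>wparts {1..m} k. \<phi> \<beta>) * (\<Sum>\<gamma>\<in>wparts {m+1..n} (n - k). \<psi> \<gamma>))"
      unfolding U by (rule sum_wparts_Un) auto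
    also have "\<dots> \<le> (\<Sum>k\<le>n. w k * a (n - k))"
    proof (intro sum_mono)
      fix k assume "k \<in> {..n}"
      have "(\<Sum>\<beta>\<in>wparts {1..m} k. \<phi> \<beta>) = (\<Sum>\<beta>\<in>wparts {1..m} k. if K < k then \<Prod>i=1..m. mix_bound {1..m} i (\<beta> i) else 0)"
        by (intro sum.cong refl) (auto simp: \<phi>_def wparts_def mix_bound_def)
      also have "\<dots> = w k"
        by (simp add: w_def v_def sum_prod_mix_bound)
      finally have 1: "(\<Sum>\<beta>\<in>wparts {1..m} k. \<phi> \<beta>) = w k" .
      have "(\<Sum>\<gamma>\<in>wparts {m+1..n} (n - k). \<psi> \<gamma>) = A {m+1..n} $ (n - k)"
        unfolding \<psi>_def A_def q_def by (subst prod_fps_compose_X_power_nth) auto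
      also have "\<dots> \<le> A {1..n} $ (n - k)" by (intro fps_leD A_mono) auto
      also have "\<dots> = a (n - k)" by (rule A_nth) simp
      finally have 2: "(\<Sum>\<gamma>\<in>wparts {m+1..n} (n - k). \<psi> \<gamma>) \<le> a (n - k)" .
      show "(\<Sum>\<beta>\<in>wparts {1..m} k. \<phi> \<beta>) * (\<Sum>\<gamma>\<in>wparts {m+1..n} (n - k). \<psi> \<gamma>) \<le> w k * a (n - k)"
        unfolding 1 using 2 v0 by (intro mult_left_mono) (auto simp: w_def)
    qed
    also have "\<dots> \<le> a n * (2 * (\<Sum>k\<le>n div 2. w k) + 2 / \<theta> * (\<epsilon> * \<theta> / 4))"
    proof (rule sum_mult_ewens_coeff_le[OF theta_pos])
      fix k assume "n < 2 * k"
      then have "real k * v k \<le> \<epsilon> * \<theta> / 4" using elim by (intro less_imp_le N) auto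
      then show "real k * w k \<le> \<epsilon> * \<theta> / 4" using assms theta_pos by (simp add: w_def)
    qed (use elim v0 in \<open>auto simp: w_def\<close>)
    also have "\<dots> \<le> a n * (2 * (\<epsilon> / 4) + 2 / \<theta> * (\<epsilon> * \<theta> / 4))"
    proof (intro mult_left_mono add_right_mono)
      have "(\<Sum>k\<le>n div 2. w k) = (\<Sum>k\<in>{K<..n div 2}. v k)"
        unfolding w_def by (subst sum.inter_filter[symmetric]) (auto intro: sum.cong)
      also have "\<dots> \<le> (\<Sum>k\<in>{K..n + K}. v k)" using v0 by (intro sum_mono2) auto
      also have "\<dots> = (\<Sum>i\<le>n. v (i + K))"
        by (intro sum.reindex_bij_witness[of _ "\<lambda>i. i + K" "\<lambda>k. k - K"]) auto
      also have "\<dots> \<le> (\<Sum>i. v (i + K))"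
        using \<open>summable v\<close> by (intro sum_le_suminf) (auto simp: v0 summable_iff_shift)
      also have "\<dots> \<le> \<epsilon> / 4" using K by simp
      finally show "(\<Sum>k\<le>n div 2. w k) \<le> \<epsilon> / 4" .
    qed (use ewens_coeff_pos[OF theta_pos, of n] in auto)
    also have "\<dots> = \<epsilon> * a n" using theta_pos by simp
    finally show ?case .
  qed
  then show ?thesis using that by blast
qed

subsection \<open>The mass does not vanish\<close>

definition PT :: "nat set \<Rightarrow> real fps" where
  "PT I = (\<Prod>i\<in>I. Abs_fps (t i) oo fps_X ^ i)"

lemma PT_nth:
  assumes "finite I" "0 \<notin> I"
  shows "PT I $ N = (\<Sum>\<alpha>\<in>wparts I N. \<Prod>i\<in>I. t i (\<alpha> i))"
  unfolding PT_def using assms by (subst prod_fps_compose_X_power_nth) auto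

lemma fps_le_0_PT: "0 \<notin> I \<Longrightarrow> fps_le 0 (PT I)"
  unfolding PT_def
proof (intro fps_le_0_prod)
  fix i assume "0 \<notin> I" "i \<in> I"
  then have "i \<ge> 1" by (metis One_nat_def Suc_leI gr0I)
  then show "fps_le 0 (Abs_fps (t i) oo fps_X ^ i)"
    by (intro fps_le_0_compose_X_power) (auto simp: fps_le_def t_nonneg)
qed

lemma PT_nth_stable:
  assumes "J \<le> m" "N \<le> m" "m \<le> n"
  shows "PT {J<..n} $ N = PT {J<..m} $ N"
  unfolding PT_def using assms by (intro prod_fps_compose_nth_stable) (auto simp: t_0)

lemma PT_tail_nth:
  assumes "N \<le> n"
  shows "PT {J<..n} $ N = PT {J<..N} $ N"
proof (cases "N \<ge> J")
  case True
  then show ?thesis using assms by (intro PT_nth_stable) auto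
next
  case False
  then have "PT {J<..n} $ N = PT {J<..J} $ N"
    by (cases "n \<ge> J") (use PT_nth_stable[of J N n] in auto)
  then show ?thesis using False by simp
qed

lemma sum_mass_eq:
  "(\<Sum>\<alpha>\<in>partitions_of n. R n \<alpha> * wt n \<alpha>) = PT {1..n} $ n"
  unfolding partitions_of_eq_wparts
proof (subst PT_nth, goal_cases)
  case 3
  have "mix {1..n} i l = t i l" if "i \<in> {1..n}" for i l using that by (simp add: mix_def)
  then show ?case using prod_mix_atMost[of n n] by (auto intro!: sum.cong prod.cong)
qed auto

text \<open>With the parts of size at most \<open>J\<close> weighted as in the Ewens measure, the perturbation is small.\<close>

lemma eventually_sum_tail_ge:
  "\<forall>\<^sub>F n in sequentially. (A {1..J} * PT {J<..n}) $ n \<ge> a n / 4"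
proof -
  have "\<theta> / 8 > 0" using theta_pos by simp
  from eventually_k_g_le[OF this] obtain N where
    N: "\<And>n k. n \<ge> N \<Longrightarrow> n < 2 * k \<Longrightarrow> real k * g k \<le> \<theta> / 8" by blast
  show ?thesis
    using eventually_ge_at_top[of "max N (max J 1)"]
  proof eventually_elim
    case (elim n)
    let ?I = "{J<..n}"
    have sI: "(\<Sum>\<alpha>\<in>wparts {1..n} n. \<Prod>i=1..n. mix ?I i (\<alpha> i)) = (A {1..J} * PT ?I) $ n"
    proof -
      have U: "{1..n} = {1..J} \<union> ?I" using elim by auto
      have "(\<Sum>\<alpha>\<in>wparts {1..n} n. \<Prod>i=1..n. mix ?I i (\<alpha> i))
          = (\<Prod>i=1..n. Abs_fps (mix ?I i) oo fps_X ^ i) $ n"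
        by (subst prod_fps_compose_X_power_nth) auto
      also have "(\<Prod>i=1..n. Abs_fps (mix ?I i) oo fps_X ^ i)
          = (\<Prod>i=1..J. Abs_fps (mix ?I i) oo fps_X ^ i) * (\<Prod>i\<in>?I. Abs_fps (mix ?I i) oo fps_X ^ i)"
        unfolding U by (rule prod.union_disjoint) auto
      also have "(\<Prod>i=1..J. Abs_fps (mix ?I i) oo fps_X ^ i) = A {1..J}"
        unfolding A_def
      proof (intro prod.cong refl)
        fix i assume "i \<in> {1..J}"
        then have "Abs_fps (mix ?I i) = fps_exp (\<theta> / real i)"
          by (auto simp: fps_eq_iff mix_def q_def)
        then show "Abs_fps (mix ?I i) oo fps_X ^ i = fps_exp (\<theta> / real i) oo fps_X ^ i" by simp
      qed
      also have "(\<Prod>i\<in>?I. Abs_fps (mix ?I i) oo fps_X ^ i) = PT ?I"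
        unfolding PT_def
      proof (intro prod.cong refl)
        fix i assume "i \<in> ?I"
        then have "Abs_fps (mix ?I i) = Abs_fps (t i)"
          by (auto simp: fps_eq_iff mix_def)
        then show "Abs_fps (mix ?I i) oo fps_X ^ i = Abs_fps (t i) oo fps_X ^ i" by simp
      qed
      finally show ?thesis .
    qed
    have s0: "(\<Sum>\<alpha>\<in>wparts {1..n} n. \<Prod>i=1..n. mix {} i (\<alpha> i)) = a n"
    proof -
      have "(\<Sum>\<alpha>\<in>wparts {1..n} n. \<Prod>i=1..n. mix {} i (\<alpha> i)) = A {1..n} $ n"
        unfolding A_def by (subst prod_fps_compose_X_power_nth) (auto simp: mix_def q_def)
      then show ?thesis by (metis A_nth order_refl)
    qed
    have "(\<Sum>k\<le>n div 2. G ?I $ k - G {} $ k) = (\<Sum>k\<le>n div 2. G ?I $ k) - 1"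
      by (simp add: G_def sum_subtractf fps_one_nth)
    also have "(\<Sum>k\<le>n div 2. G ?I $ k) \<le> exp ((\<Sum>i\<in>?I. e i / real i) * suminf c)"
      by (rule sum_G_nth_le) auto
    also have "\<dots> \<le> exp ((\<Sum>i. e (i + Suc J) / real (i + Suc J)) * suminf c)"
    proof -
      have "(\<Sum>i\<in>?I. e i / real i) = (\<Sum>i\<in>{..<n - J}. e (i + Suc J) / real (i + Suc J))"
        by (intro sum.reindex_bij_witness[of _ "\<lambda>i. i + Suc J" "\<lambda>k. k - Suc J"]) auto
      also have "\<dots> \<le> (\<Sum>i. e (i + Suc J) / real (i + Suc J))"
        using summable_ignore_initial_segment[OF e_summable, of "Suc J"] e_nonneg
        by (intro sum_le_suminf) auto
      finally show ?thesis
        using suminf_nonneg[OF c_summable' c_nonneg] by (simp add: mult_right_mono)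
    qed
    also have "\<dots> \<le> exp (1 / 8)" using small by simp
    \<comment> \<open>The excess over 1 is 9/64, which doubled is still below 1/2. With B = \<theta>
      / 8 adding 1/4, at most 3/4 of \<open>a n\<close> is lost.\<close>
    also have "exp (1 / 8 :: real) \<le> 1 + 1 / 8 + (1 / 8)\<^sup>2" by (rule exp_bound) auto
    finally have "2 * (\<Sum>k\<le>n div 2. G ?I $ k - G {} $ k) \<le> 1 / 2" by (simp add: power2_eq_square)
    then have "2 * (\<Sum>k\<le>n div 2. G ?I $ k - G {} $ k) + 2 / \<theta> * (\<theta> / 8) \<le> 3 / 4"
      using theta_pos by simp
    then have b: "a n * (2 * (\<Sum>k\<le>n div 2. G ?I $ k - G {} $ k) + 2 / \<theta> * (\<theta> / 8)) \<le> a n * (3 / 4)"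
      using ewens_coeff_pos[OF theta_pos, of n] by (intro mult_left_mono) auto
    have "a n - (A {1..J} * PT ?I) $ n
        = - (\<Sum>\<alpha>\<in>partitions_of n. (\<Prod>i=1..n. mix ?I i (\<alpha> i)) - (\<Prod>i=1..n. mix {} i (\<alpha> i)))"
      by (simp add: sum_subtractf partitions_of_eq_wparts sI[unfolded One_nat_def] s0[unfolded One_nat_def])
    also have "\<dots> \<le> \<bar>\<Sum>\<alpha>\<in>partitions_of n. (\<Prod>i=1..n. mix ?I i (\<alpha> i)) - (\<Prod>i=1..n. mix {} i (\<alpha> i))\<bar>"
      by (rule abs_ge_minus_self)
    also have "\<dots> \<le> (\<Sum>\<alpha>\<in>partitions_of n. \<bar>(\<Prod>i=1..n. mix ?I i (\<alpha> i)) - (\<Prod>i=1..n. mix {} i (\<alpha> i))\<bar>)"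
      by (rule sum_abs)
    also have "\<dots> \<le> a n * (2 * (\<Sum>k\<le>n div 2. G ?I $ k - G {} $ k) + 2 / \<theta> * (\<theta> / 8))"
      using elim N by (intro sum_abs_mix_diff_le) auto
    finally show ?case using b by simp
  qed
qed

text \<open>The available lower bound concerns r, the mass on parts above J, convolved with u, the
  coefficients of \<open>A {1..J}\<close>; the claim concerns the full mass z. The link is p * r N
  \<le> z (N + s), where p > 0 comes from a fixed partition of s with parts up to J.\<close>

lemma mass_not_tendsto_0:
  "\<not> (\<lambda>n. (\<Sum>\<alpha>\<in>partitions_of n. R n \<alpha> * wt n \<alpha>) / a n) \<longlonglongrightarrow> 0"
proof
  have a: "a n > 0" for n by (rule ewens_coeff_pos[OF theta_pos])
  define z where "z n = PT {1..n} $ n" for n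
  define r where "r n = PT {J<..n} $ n" for n
  assume "(\<lambda>n. (\<Sum>\<alpha>\<in>partitions_of n. R n \<alpha> * wt n \<alpha>) / a n) \<longlonglongrightarrow> 0"
  then have z: "(\<lambda>n. z n / a n) \<longlonglongrightarrow> 0" by (simp add: sum_mass_eq z_def)
  have r0: "r n \<ge> 0" for n using fps_leD[OF fps_le_0_PT, of "{J<..n}" n] by (simp add: r_def)
  \<comment> \<open>The empty choice of small parts will not do in general, since
    \<open>t i 0\<close> may vanish for i \<le> J.\<close>
  have "\<exists>b. \<forall>i\<in>{1..J}. t i (b i) > 0"
    using t_pos by (intro bchoice) auto
  then obtain b where b: "\<And>i. i \<in> {1..J} \<Longrightarrow> t i (b i) > 0" by blast
  define \<beta> where "\<beta> i = (if i \<in> {1..J} then b i else 0)" for i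
  define s where "s = (\<Sum>i=1..J. i * \<beta> i)"
  define p where "p = PT {1..J} $ s"
  have "0 < (\<Prod>i=1..J. t i (\<beta> i))" by (intro prod_pos) (simp add: \<beta>_def b)
  also have "\<dots> \<le> (\<Sum>\<alpha>\<in>wparts {1..J} s. \<Prod>i=1..J. t i (\<alpha> i))"
  proof (rule member_le_sum)
    show "\<beta> \<in> wparts {1..J} s" by (auto simp: wparts_def s_def \<beta>_def)
    show "finite (wparts {1..J} s)" by (rule finite_wparts) auto
  qed (auto intro!: prod_nonneg t_nonneg)
  also have "\<dots> = p" unfolding p_def by (rule PT_nth[symmetric]) auto
  finally have p: "p > 0" .
  have zr: "p * r N \<le> z (N + s)" if "N \<ge> J" for N
  proof -
    have U: "{1..N + s} = {1..J} \<union> {J<..N + s}" using that by auto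
    have dis: "{1..J} \<inter> {J<..N + s} = {}" by auto
    have "z (N + s) = (PT {1..J} * PT {J<..N + s}) $ (N + s)"
      unfolding z_def U PT_def
      by (subst prod.union_disjoint[OF finite_atLeastAtMost finite_greaterThanAtMost dis]) (rule refl)
    also have "\<dots> \<ge> PT {1..J} $ s * PT {J<..N + s} $ (N + s - s)"
      unfolding fps_mult_nth
    proof (rule member_le_sum)
      fix i
      show "0 \<le> PT {1..J} $ i * PT {J<..N + s} $ (N + s - i)"
        using fps_leD[OF fps_le_0_PT, of "{1..J}" i] fps_leD[OF fps_le_0_PT, of "{J<..N + s}" "N + s - i"] by simp
    qed auto
    also have "PT {J<..N + s} $ (N + s - s) = r N"
      unfolding r_def using PT_tail_nth[of N "N + s"] by simp
    finally show ?thesis by (simp add: p_def)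
  qed
  have rlim: "(\<lambda>N. r N / a N) \<longlonglongrightarrow> 0"
  proof (rule Lim_null_comparison)
    show "\<forall>\<^sub>F N in sequentially. norm (r N / a N) \<le> ((\<theta> + 1) ^ s / p) * (z (N + s) / a (N + s))"
      using eventually_ge_at_top[of J]
    proof eventually_elim
      case (elim N)
      have "r N / a N * a (N + s) \<le> r N / a N * ((\<theta> + 1) ^ s * a N)"
        using r0[of N] a[of N] by (intro mult_left_mono ewens_coeff_add_le theta_pos) auto
      also have "\<dots> = (\<theta> + 1) ^ s * r N" using a[of N] by simp
      also have "\<dots> \<le> (\<theta> + 1) ^ s * (z (N + s) / p)"
        using zr[OF elim] p theta_pos by (intro mult_left_mono) (auto simp: field_simps)
      finally have "r N / a N \<le> (\<theta> + 1) ^ s * (z (N + s) / p) / a (N + s)"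
        using a[of "N + s"] by (simp only: pos_le_divide_eq)
      then show ?case using r0[of N] a[of N] by simp
    qed
    show "(\<lambda>N. ((\<theta> + 1) ^ s / p) * (z (N + s) / a (N + s))) \<longlonglongrightarrow> 0"
      using LIMSEQ_ignore_initial_segment[OF z, of s] by (rule tendsto_mult_right_zero)
  qed
  define u where "u k = A {1..J} $ k" for k
  have W: "fps_summable (A {1..J})" by (rule fps_summable_A) simp
  then have u0: "u k \<ge> 0" for k by (simp add: u_def fps_summable_def fps_le_def)
  have us: "summable u" using fps_summable_imp_summable(1)[OF W] by (simp add: u_def[abs_def])
  have ulim: "(\<lambda>k. real k * u k) \<longlonglongrightarrow> 0" using fps_summable_imp_summable(2)[OF W] by (simp add: u_def)
  obtain B where B0: "B > 0" and B: "\<And>k. real k * u k \<le> B" using tendsto_0_bounded[OF ulim] by blast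
  define C where "C = 2 * suminf u + 2 / \<theta> * B"
  have C: "C \<ge> 0" unfolding C_def using theta_pos B0 suminf_nonneg[OF us u0] by simp
  \<comment> \<open>The contributions of N \<ge> N0 and of N < N0 both become at most
    \<open>a n / 16\<close>, together less than \<open>a n / 4\<close>.\<close>
  define \<delta> where "\<delta> = 1 / (16 * (C + 1))"
  have \<delta>: "\<delta> > 0" "\<delta> * C \<le> 1 / 16" using C by (auto simp: \<delta>_def field_simps)
  obtain N0 where N0: "\<And>N. N \<ge> N0 \<Longrightarrow> r N \<le> \<delta> * a N"
    using order_tendstoD(2)[OF rlim \<delta>(1)] a
    by (auto simp: eventually_sequentially pos_divide_less_eq intro: less_imp_le)
  have rest: "(\<lambda>n. \<Sum>N<N0. (real n * u (n - N)) * (r N / \<theta>)) \<longlonglongrightarrow> 0"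
  proof (intro tendsto_null_sum tendsto_mult_left_zero)
    fix N
    have "(\<lambda>n. real (n + N) * u n) \<longlonglongrightarrow> 0"
      using tendsto_add[OF ulim tendsto_mult_right_zero[OF summable_LIMSEQ_zero[OF us], of "real N"]]
      by (simp add: algebra_simps)
    then have "(\<lambda>n. real (n - N + N) * u (n - N)) \<longlonglongrightarrow> 0"
      by (rule filterlim_compose[OF _ filterlim_minus_const_nat_at_top])
    then show "(\<lambda>n. real n * u (n - N)) \<longlonglongrightarrow> 0"
      by (rule Lim_transform_eventually) (use eventually_ge_at_top[of N] in \<open>eventually_elim, simp\<close>)
  qed
  have "\<forall>\<^sub>F n in sequentially. False"
    using eventually_sum_tail_ge order_tendstoD(2)[OF rest, of "1/16", simplified] eventually_ge_at_top[of "max N0 1"]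
  proof eventually_elim
    case (elim n)
    have "a n / 4 \<le> (A {1..J} * PT {J<..n}) $ n" using elim by simp
    also have "\<dots> = (\<Sum>k\<le>n. u k * r (n - k))"
      unfolding fps_mult_nth atLeast0AtMost u_def r_def by (intro sum.cong refl arg_cong2[where f = "(*)"] PT_tail_nth) simp
    also have "\<dots> \<le> (\<Sum>k\<le>n. u k * (\<delta> * a (n - k)) + u k * (if n - k < N0 then r (n - k) else 0))"
    proof (intro sum_mono)
      fix k
      have "r (n - k) \<le> \<delta> * a (n - k) + (if n - k < N0 then r (n - k) else 0)"
        using N0[of "n - k"] a[of "n - k"] \<delta> by (simp add: not_less)
      from mult_left_mono[OF this u0[of k]]
      show "u k * r (n - k) \<le> u k * (\<delta> * a (n - k)) + u k * (if n - k < N0 then r (n - k) else 0)"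
        by (simp add: distrib_left)
    qed
    also have "\<dots> = \<delta> * (\<Sum>k\<le>n. u k * a (n - k)) + (\<Sum>k\<le>n. u k * (if n - k < N0 then r (n - k) else 0))"
      by (simp add: sum.distrib sum_distrib_left mult_ac)
    also have "(\<Sum>k\<le>n. u k * (if n - k < N0 then r (n - k) else 0)) = (\<Sum>N\<le>n. u (n - N) * (if N < N0 then r N else 0))"
      by (rule sum.reindex_bij_witness[of _ "\<lambda>N. n - N" "\<lambda>k. n - k"]) auto
    also have "\<dots> = (\<Sum>N<N0. u (n - N) * r N)"
      using elim by (intro sum.mono_neutral_cong_right) auto
    also have "\<dots> \<le> (\<Sum>N<N0. a n * ((real n * u (n - N)) * (r N / \<theta>)))"
    proof (intro sum_mono)
      fix N
      have "\<theta> * (u (n - N) * r N) \<le> (real n * a n) * (u (n - N) * r N)"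
        using elim u0[of "n - N"] r0[of N] by (intro mult_right_mono ewens_coeff_ge theta_pos) auto
      then show "u (n - N) * r N \<le> a n * ((real n * u (n - N)) * (r N / \<theta>))"
        using theta_pos by (simp add: field_simps)
    qed
    also have "\<dots> = a n * (\<Sum>N<N0. (real n * u (n - N)) * (r N / \<theta>))"
      by (simp add: sum_distrib_left)
    also have "\<dots> \<le> a n * (1 / 16)"
      using elim a[of n] by (intro mult_left_mono) auto
    also have "(\<Sum>k\<le>n. u k * a (n - k)) \<le> a n * (2 * (\<Sum>k\<le>n div 2. u k) + 2 / \<theta> * B)"
      by (rule sum_mult_ewens_coeff_le[OF theta_pos]) (use elim u0 B in auto)
    also have "\<dots> \<le> a n * C"
      unfolding C_def using a[of n] us u0 by (intro mult_left_mono add_right_mono sum_le_suminf) auto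
    finally have "a n / 4 \<le> \<delta> * (a n * C) + a n * (1 / 16)" using \<delta> by (simp add: mult_left_mono)
    also have "\<delta> * (a n * C) \<le> a n * (1 / 16)"
      using mult_left_mono[OF \<delta>(2), of "a n"] a[of n] by (simp add: mult_ac)
    finally show False using a[of n] by simp
  qed
  then show False by simp
qed

end

section \<open>The Feller coupling\<close>

text \<open>Each coefficient of index s \<ge> 1 is at least \<theta> / s, so the recurrence bounds
  the product below by \<theta>^2 times a harmonic sum. This makes the bound of
  \<open>prob_small_sum_le\<close> vanish as m grows.\<close>

lemma ewens_coeff_mult_at_top:
  assumes "\<theta> > 0"
  shows "filterlim (\<lambda>m. real m * ewens_coeff \<theta> m) at_top sequentially"
proof -
  have le: "\<theta>\<^sup>2 * harm (m - 1) \<le> real m * ewens_coeff \<theta> m" for m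
  proof -
    have "\<theta>\<^sup>2 * harm (m - 1) = \<theta> * (\<Sum>s=1..m-1. \<theta> / real s)"
      by (simp add: harm_def power2_eq_square sum_distrib_left divide_inverse mult_ac)
    also have "\<dots> \<le> \<theta> * (\<Sum>s=1..m-1. ewens_coeff \<theta> s)"
      using ewens_coeff_ge[OF assms] assms
      by (intro mult_left_mono sum_mono) (auto simp: pos_divide_le_eq mult.commute)
    also have "\<dots> \<le> \<theta> * (\<Sum>s<m. ewens_coeff \<theta> s)"
      using assms by (intro mult_left_mono sum_mono2) (auto simp: less_imp_le[OF ewens_coeff_pos])
    also have "\<dots> = real m * ewens_coeff \<theta> m" by (simp add: ewens_coeff_recurrence)
    finally show ?thesis .
  qed
  have "filterlim (\<lambda>m. \<theta>\<^sup>2 * harm (m - 1)) at_top sequentially"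
    by (rule filterlim_tendsto_pos_mult_at_top[OF tendsto_const _
          filterlim_compose[OF harm_at_top filterlim_minus_const_nat_at_top]]) (use assms in simp)
  then show ?thesis
    by (rule filterlim_at_top_mono) (rule always_eventually, rule allI, rule le)
qed

section \<open>Combinatorics of spacings in a binary string\<close>

definition spacing :: "(nat \<Rightarrow> bool) \<Rightarrow> nat \<Rightarrow> nat \<Rightarrow> bool" where
  "spacing \<xi> i j \<longleftrightarrow> \<xi> j \<and> (\<forall>k\<in>{j+1..j+i-1}. \<not> \<xi> k) \<and> \<xi> (i + j)"

text \<open>The spacing closed by the additional 1 that is appended at position n + 1.\<close>

definition last_spacing :: "(nat \<Rightarrow> bool) \<Rightarrow> nat \<Rightarrow> nat \<Rightarrow> bool" where
  "last_spacing \<xi> n i \<longleftrightarrow> \<xi> (n - i + 1) \<and> (\<forall>k\<in>{n-i+2..n}. \<not> \<xi> k)"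

lemma prod_one_minus_of_bool:
  assumes "finite K"
  shows "(\<Prod>k\<in>K. 1 - of_bool (\<xi> k) :: nat) = of_bool (\<forall>k\<in>K. \<not> \<xi> k)"
  using assms by (induction K rule: finite_induct) auto

lemma feller_count_eq:
  assumes "1 \<le> i" "i \<le> n"
  shows "feller_count n \<xi> i = (\<Sum>j=1..n-i. of_bool (spacing \<xi> i j)) + of_bool (last_spacing \<xi> n i)"
proof -
  have "(\<Sum>j=1..n-i. of_bool (\<xi> j) * (\<Prod>k=j+1..j+i-1. 1 - of_bool (\<xi> k)) * of_bool (\<xi> (i+j)))
      = (\<Sum>j=1..n-i. of_bool (spacing \<xi> i j) :: nat)"
    by (intro sum.cong refl, subst prod_one_minus_of_bool) (auto simp: spacing_def)
  moreover have "of_bool (\<xi> (n-i+1)) * (\<Prod>k=n-i+2..n. 1 - of_bool (\<xi> k)) = (of_bool (last_spacing \<xi> n i) :: nat)"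
    by (subst prod_one_minus_of_bool) (auto simp: last_spacing_def)
  ultimately show ?thesis using assms by (simp only: feller_count_def) simp
qed

lemma feller_count_outside: "i \<notin> {1..n} \<Longrightarrow> feller_count n \<xi> i = 0"
  by (auto simp: feller_count_def)

lemma feller_count_cong:
  assumes "\<And>k. k \<in> {1..n} \<Longrightarrow> \<xi> k = \<xi>' k"
  shows "feller_count n \<xi> = feller_count n \<xi>'"
proof
  fix i
  show "feller_count n \<xi> i = feller_count n \<xi>' i"
  proof (cases "1 \<le> i \<and> i \<le> n")
    case True
    have "spacing \<xi> i j = spacing \<xi>' i j" if "j \<in> {1..n-i}" for j
      unfolding spacing_def using that True assms by (intro conj_cong ball_cong refl arg_cong[where f = Not]) auto
    moreover have "last_spacing \<xi> n i = last_spacing \<xi>' n i"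
      unfolding last_spacing_def using True assms by (intro conj_cong ball_cong refl arg_cong[where f = Not]) auto
    ultimately show ?thesis using True by (simp add: feller_count_eq)
  qed (auto simp: feller_count_def)
qed

lemma last_spacing_unique:
  assumes "last_spacing \<xi> n i" "last_spacing \<xi> n i'" "i \<in> {1..n}" "i' \<in> {1..n}"
  shows "i = i'"
proof (rule ccontr)
  assume "i \<noteq> i'"
  then consider "i < i'" | "i' < i" by linarith
  then show False
  proof cases
    case 1
    then have "n - i + 1 \<in> {n - i' + 2..n}" using assms by auto
    then show False using assms by (auto simp: last_spacing_def)
  next
    case 2
    then have "n - i' + 1 \<in> {n - i + 2..n}" using assms by auto
    then show False using assms by (auto simp: last_spacing_def)
  qed
qed

text \<open>Cutting off the last spacing leaves the string of length n - i, whose appended 1 falls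
  on n - i + 1, where a genuine 1 stands; so all other spacings are unchanged. Iteration gives both
  that the counts form a partition and their law.\<close>

lemma feller_count_last:
  assumes "1 \<le> i" "i \<le> n" "last_spacing \<xi> n i"
  shows "feller_count n \<xi> = (feller_count (n - i) \<xi>)(i := feller_count (n - i) \<xi> i + 1)"
proof
  fix l
  have one: "\<xi> (n - i + 1)" and zero: "\<And>k. n - i + 1 < k \<Longrightarrow> k \<le> n \<Longrightarrow> \<not> \<xi> k"
    using assms by (auto simp: last_spacing_def)
  show "feller_count n \<xi> l = ((feller_count (n - i) \<xi>)(i := feller_count (n - i) \<xi> i + 1)) l"
  proof (cases "1 \<le> l \<and> l \<le> n")
    case l: True
    have last: "last_spacing \<xi> n l \<longleftrightarrow> l = i"
      using last_spacing_unique[of \<xi> n l i] assms l by auto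
    have sp0: "\<not> spacing \<xi> l j" if "n - i + 1 < l + j" "l + j \<le> n" for j
      using zero that by (auto simp: spacing_def)
    show ?thesis
    proof (cases "l \<le> n - i")
      case True
      \<comment> \<open>A spacing ending after n - i + 1 would have to end at a 0, so the last
        admissible start is j = n - i + 1 - l.\<close>
      have "(\<Sum>j=1..n-l. of_bool (spacing \<xi> l j) :: nat) = (\<Sum>j=1..Suc (n-i-l). of_bool (spacing \<xi> l j))"
        using True l assms sp0 by (intro sum.mono_neutral_right) auto
      also have "\<dots> = (\<Sum>j=1..n-i-l. of_bool (spacing \<xi> l j)) + of_bool (spacing \<xi> l (Suc (n - i - l)))"
        by simp
      also have "spacing \<xi> l (Suc (n - i - l)) \<longleftrightarrow> last_spacing \<xi> (n - i) l"
      proof -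
        have e: "l + Suc (n - i - l) = n - i + 1" "Suc (n - i - l) + l - 1 = n - i"
          "Suc (n - i - l) + 1 = n - i - l + 2" "Suc (n - i - l) = n - i - l + 1" using True by auto
        show ?thesis unfolding spacing_def last_spacing_def e(1-3) unfolding e(4) using one by blast
      qed
      finally have "feller_count n \<xi> l = feller_count (n - i) \<xi> l + of_bool (last_spacing \<xi> n l)"
        using l True by (simp add: feller_count_eq)
      then show ?thesis using last by simp
    next
      case False
      have "(\<Sum>j=1..n-l. of_bool (spacing \<xi> l j) :: nat) = 0"
        using False sp0 by (intro sum.neutral) auto
      moreover have "feller_count (n - i) \<xi> l = 0" using False by (intro feller_count_outside) auto
      ultimately show ?thesis using l last by (cases "l = i") (simp_all add: feller_count_eq)
    qed
  next
    case False
    then show ?thesis using assms by (auto simp: feller_count_outside)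
  qed
qed

lemma ex_last_spacing:
  assumes "\<xi> 1" "n \<ge> 1"
  shows "\<exists>i\<in>{1..n}. last_spacing \<xi> n i"
proof -
  define p where "p = Max {k\<in>{1..n}. \<xi> k}"
  have fin: "finite {k\<in>{1..n}. \<xi> k}" and ne: "{k\<in>{1..n}. \<xi> k} \<noteq> {}" using assms by auto
  have p: "p \<in> {1..n}" "\<xi> p" using Max_in[OF fin ne] by (auto simp: p_def)
  have "\<not> \<xi> k" if "p < k" "k \<le> n" for k
    using Max_ge[OF fin, of k] that p unfolding p_def[symmetric] by auto
  then have "last_spacing \<xi> n (n - p + 1)"
    using p by (auto simp: last_spacing_def)
  then show ?thesis using p by (intro bexI[of _ "n - p + 1"]) auto
qed

lemma partitions_of_add_part:
  assumes "\<alpha> \<in> partitions_of (n - i)" "1 \<le> i" "i \<le> n"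
  shows "\<alpha>(i := \<alpha> i + 1) \<in> partitions_of n"
proof -
  have z: "\<alpha> j = 0" if "j \<notin> {1..n-i}" for j using assms that by (auto simp: partitions_of_def)
  have "(\<Sum>j=1..n. j * (\<alpha>(i := \<alpha> i + 1)) j) = (\<Sum>j=1..n. j * \<alpha> j + (if j = i then i else 0))"
    by (intro sum.cong refl) auto
  also have "\<dots> = (\<Sum>j=1..n. j * \<alpha> j) + i"
    using assms by (simp add: sum.distrib)
  also have "(\<Sum>j=1..n. j * \<alpha> j) = (\<Sum>j=1..n-i. j * \<alpha> j)"
    using z by (intro sum.mono_neutral_right) auto
  also have "\<dots> = n - i" using assms by (simp add: partitions_of_def)
  finally show ?thesis using assms z by (auto simp: partitions_of_def)
qed

lemma partitions_of_remove_part: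
  assumes "\<alpha> \<in> partitions_of n" "1 \<le> i" "i \<le> n" "\<alpha> i \<ge> 1"
  shows "\<alpha>(i := \<alpha> i - 1) \<in> partitions_of (n - i)"
proof -
  let ?\<beta> = "\<alpha>(i := \<alpha> i - 1)"
  have z: "\<alpha> j = 0" if "j \<notin> {1..n}" for j using assms that by (auto simp: partitions_of_def)
  have "i * \<alpha> i = i * (\<alpha> i - 1) + i" using assms(4) by (cases "\<alpha> i") auto
  then have "(\<Sum>j=1..n. j * \<alpha> j) = (\<Sum>j=1..n. j * ?\<beta> j + (if j = i then i else 0))"
    by (intro sum.cong refl) auto
  also have "\<dots> = (\<Sum>j=1..n. j * ?\<beta> j) + i"
    using assms by (simp add: sum.distrib)
  finally have "(\<Sum>j=1..n. j * ?\<beta> j) + i = n" using assms(1) unfolding partitions_of_def by simp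
  then have s: "(\<Sum>j=1..n. j * ?\<beta> j) = n - i" by linarith
  have "?\<beta> j = 0" if "j \<in> {1..n}" "n - i < j" for j
  proof (rule ccontr)
    assume "?\<beta> j \<noteq> 0"
    then have "j * 1 \<le> j * ?\<beta> j" by (intro mult_left_mono) auto
    also have "\<dots> \<le> (\<Sum>j=1..n. j * ?\<beta> j)" using that by (intro member_le_sum) auto
    finally show False using s that by simp
  qed
  then have b: "?\<beta> j = 0" if "j \<notin> {1..n-i}" for j using that z[of j] by (cases "j \<in> {1..n}") auto
  have "(\<Sum>j=1..n-i. j * ?\<beta> j) = (\<Sum>j=1..n. j * ?\<beta> j)"
    using b by (intro sum.mono_neutral_left) auto
  then show ?thesis using s b by (simp add: partitions_of_def)
qed

lemma feller_count_in_partitions: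
  assumes "\<xi> 1"
  shows "feller_count n \<xi> \<in> partitions_of n"
proof (induction n rule: less_induct)
  case (less n)
  show ?case
  proof (cases "n = 0")
    case True
    then show ?thesis by (auto simp: partitions_of_def feller_count_def)
  next
    case False
    then obtain i where i: "i \<in> {1..n}" "last_spacing \<xi> n i" using ex_last_spacing[of \<xi> n] assms by auto
    then have i': "1 \<le> i" "i \<le> n" by auto
    have "feller_count (n - i) \<xi> \<in> partitions_of (n - i)" using i' by (intro less) auto
    then show ?thesis unfolding feller_count_last[OF i' i(2)] by (rule partitions_of_add_part[OF _ i'])
  qed
qed

text \<open>If some \<open>\<xi>\<^sub>k\<close> with \<open>J < k \<le> m\<close> is 1, the spacings up to \<open>k\<close> form a partition of \<open>k - 1 \<ge> J\<close>.\<close>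

lemma no_ones_of_small_sum:
  assumes "\<xi> 1" "m \<le> n" "(\<Sum>i=1..m. i * feller_count n \<xi> i) < J" "k \<in> {J<..m}"
  shows "\<not> \<xi> k"
proof
  assume k: "\<xi> k"
  have le: "feller_count (k - 1) \<xi> i \<le> feller_count n \<xi> i" if "i \<in> {1..k-1}" for i
  proof -
    have e: "i + (k - i) = k" "k - 1 - i + 1 = k - i" "k - i + i - 1 = k - 1" "k - 1 - i + 2 = k - i + 1" "k - i = Suc (k - 1 - i)"
      using that by auto
    have "feller_count (k - 1) \<xi> i = (\<Sum>j=1..k-1-i. of_bool (spacing \<xi> i j)) + of_bool (last_spacing \<xi> (k - 1) i)"
      using that by (intro feller_count_eq) auto
    \<comment> \<open>Since \<xi> k holds, the 1 appended to the string of length k - 1 is a genuine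
      one, and this spacing survives in the longer string.\<close>
    also have "last_spacing \<xi> (k - 1) i \<longleftrightarrow> spacing \<xi> i (k - i)"
      unfolding last_spacing_def spacing_def e(1-4) using k by simp
    also have "(\<Sum>j=1..k-1-i. of_bool (spacing \<xi> i j)) + of_bool (spacing \<xi> i (k - i))
        = (\<Sum>j=1..k-i. of_bool (spacing \<xi> i j) :: nat)"
      unfolding e(5) by simp
    also have "\<dots> \<le> (\<Sum>j=1..n-i. of_bool (spacing \<xi> i j))"
      using assms by (intro sum_mono2) auto
    also have "\<dots> \<le> feller_count n \<xi> i"
      using that assms by (subst feller_count_eq) auto
    finally show ?thesis .
  qed
  have "k - 1 = (\<Sum>i=1..k-1. i * feller_count (k - 1) \<xi> i)"
    using feller_count_in_partitions[of \<xi> "k - 1"] assms(1) by (simp add: partitions_of_def)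
  also have "\<dots> \<le> (\<Sum>i=1..k-1. i * feller_count n \<xi> i)"
    by (intro sum_mono mult_left_mono le) auto
  also have "\<dots> \<le> (\<Sum>i=1..m. i * feller_count n \<xi> i)"
    using assms by (intro sum_mono2) auto
  finally show False using assms by auto
qed

text \<open>A change between n and n' needs a last spacing at one of the two ends or a new spacing
  in between; each forces a 1, or two of them, at high indices, where they are rare.\<close>

lemma feller_count_neqD:
  assumes "n \<le> n'" "1 \<le> i" "i \<le> n" "feller_count n \<xi> i \<noteq> feller_count n' \<xi> i"
  shows "\<xi> (n - i + 1) \<or> \<xi> (n' - i + 1) \<or> (\<exists>j\<in>{n-i<..n'-i}. \<xi> j \<and> \<xi> (i + j))"
proof (rule ccontr)
  assume h: "\<not> ?thesis"
  then have "\<not> spacing \<xi> i j" if "j \<in> {n-i<..n'-i}" for j using that by (auto simp: spacing_def)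
  then have "(\<Sum>j=1..n-i. of_bool (spacing \<xi> i j) :: nat) = (\<Sum>j=1..n'-i. of_bool (spacing \<xi> i j))"
    using assms by (intro sum.mono_neutral_left) auto
  moreover have "\<not> last_spacing \<xi> n i" "\<not> last_spacing \<xi> n' i"
    using h by (auto simp: last_spacing_def)
  ultimately show False using assms by (simp add: feller_count_eq)
qed


subsection \<open>The law of the Feller coupling\<close>

definition feller_prob :: "real \<Rightarrow> nat \<Rightarrow> bool \<Rightarrow> real" where
  "feller_prob \<theta> k b = (if b then \<theta> / (\<theta> + real k - 1) else (real k - 1) / (\<theta> + real k - 1))"

lemma pmf_feller:
  assumes "\<theta> > 0" "k \<ge> 1"
  shows "pmf (bernoulli_pmf (\<theta> / (\<theta> + real k - 1))) b = feller_prob \<theta> k b"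
proof -
  have p: "\<theta> + real k - 1 > 0" using assms by simp
  have "0 \<le> \<theta> / (\<theta> + real k - 1)" "\<theta> / (\<theta> + real k - 1) \<le> 1"
    using assms p by (auto simp: divide_le_eq)
  then show ?thesis using p by (cases b) (auto simp: feller_prob_def field_simps)
qed

context feller
begin

abbreviation "F \<equiv> feller_measure \<theta>"

sublocale FP: product_prob_space "\<lambda>i. measure_pmf (bernoulli_pmf (\<theta> / (\<theta> + real i - 1)))" "{1..}"
  by unfold_locales

sublocale prob_space F
  unfolding feller_measure_def by (rule FP.P.prob_space_axioms)

lemma space_F: "space F = ({1..} \<rightarrow>\<^sub>E UNIV)"
  by (simp add: feller_measure_def space_PiM)

lemma prob_coordinates:
  assumes "finite K" "0 \<notin> K"
  shows "{\<xi> \<in> space F. \<forall>k\<in>K. \<xi> k = x k} \<in> sets F" (is ?A)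
    and "prob {\<xi> \<in> space F. \<forall>k\<in>K. \<xi> k = x k} = (\<Prod>k\<in>K. feller_prob \<theta> k (x k))" (is ?B)
proof -
  have K: "K \<subseteq> {1..}" using assms(2) by (auto simp: Suc_le_eq intro: gr0I)
  have e: "{\<xi> \<in> space F. \<forall>k\<in>K. \<xi> k = x k} = prod_emb {1..} (\<lambda>i. measure_pmf (bernoulli_pmf (\<theta> / (\<theta> + real i - 1)))) K (\<Pi>\<^sub>E k\<in>K. {x k})"
    using K by (auto simp: prod_emb_def space_F PiE_iff restrict_def extensional_def)
  show ?A unfolding e unfolding feller_measure_def using assms(1) K by (intro sets_PiM_I) auto
  have "prob {\<xi> \<in> space F. \<forall>k\<in>K. \<xi> k = x k} = (\<Prod>k\<in>K. measure (measure_pmf (bernoulli_pmf (\<theta> / (\<theta> + real k - 1)))) {x k})"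
    unfolding e unfolding feller_measure_def by (rule FP.measure_PiM_emb) (use assms(1) K in auto)
  also have "\<dots> = (\<Prod>k\<in>K. feller_prob \<theta> k (x k))"
    using K theta_pos by (intro prod.cong refl) (auto simp: measure_pmf_single pmf_feller subset_eq)
  finally show ?B .
qed

lemma measurable_restrict_F:
  "(\<lambda>\<xi>. restrict \<xi> {1..n}) \<in> measurable F (count_space ({1..n} \<rightarrow>\<^sub>E UNIV))"
proof (subst measurable_count_space_eq2)
  show "finite ({1..n} \<rightarrow>\<^sub>E (UNIV :: bool set))"
    by (intro finite_PiE) auto
  show "(\<lambda>\<xi>. restrict \<xi> {1..n}) \<in> space F \<rightarrow> ({1..n} \<rightarrow>\<^sub>E UNIV) \<and>
    (\<forall>x\<in>{1..n} \<rightarrow>\<^sub>E UNIV. (\<lambda>\<xi>. restrict \<xi> {1..n}) -` {x} \<inter> space F \<in> sets F)"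
  proof (intro conjI ballI)
    fix x :: "nat \<Rightarrow> bool" assume x: "x \<in> {1..n} \<rightarrow>\<^sub>E UNIV"
    have eq: "restrict \<xi> {1..n} = x \<longleftrightarrow> (\<forall>k\<in>{1..n}. \<xi> k = x k)" for \<xi>
    proof
      assume "restrict \<xi> {1..n} = x"
      then show "\<forall>k\<in>{1..n}. \<xi> k = x k" by (metis restrict_apply')
    next
      assume "\<forall>k\<in>{1..n}. \<xi> k = x k"
      then have "restrict \<xi> {1..n} = restrict x {1..n}" by (intro restrict_ext) blast
      then show "restrict \<xi> {1..n} = x" using PiE_restrict[OF x] by simp
    qed
    have "(\<lambda>\<xi>. restrict \<xi> {1..n}) -` {x} \<inter> space F = {\<xi> \<in> space F. restrict \<xi> {1..n} = x}"
      by auto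
    also have "\<dots> = {\<xi> \<in> space F. \<forall>k\<in>{1..n}. \<xi> k = x k}"
      by (simp only: eq)
    also have "\<dots> \<in> sets F" by (rule prob_coordinates(1)) auto
    finally show "(\<lambda>\<xi>. restrict \<xi> {1..n}) -` {x} \<inter> space F \<in> sets F" .
  qed auto
qed

text \<open>Such a function factors through the finite set of strings of length n, which makes it
  measurable into any type with the discrete sigma-algebra, in particular into functions on
  nat.\<close>

lemma measurable_finitely_many:
  assumes "\<And>\<xi> \<xi>'. (\<And>k. k \<in> {1..n} \<Longrightarrow> \<xi> k = \<xi>' k) \<Longrightarrow> f \<xi> = f \<xi>'"
  shows "f \<in> measurable F (count_space UNIV)"
proof -
  have "(\<lambda>\<xi>. f (restrict \<xi> {1..n})) \<in> measurable F (count_space UNIV)"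
    by (rule measurable_compose[OF measurable_restrict_F]) simp
  moreover have "f (restrict \<xi> {1..n}) = f \<xi>" for \<xi> by (rule assms) simp
  ultimately show ?thesis by simp
qed

lemma measurable_count: "feller_count n \<in> measurable F (count_space UNIV)"
  by (rule measurable_finitely_many[of n]) (rule feller_count_cong)

lemma AE_first: "AE \<xi> in F. \<xi> 1"
proof -
  have "prob {\<xi> \<in> space F. \<forall>k\<in>{1}. \<xi> k = False} = 0"
    by (subst prob_coordinates) (auto simp: feller_prob_def)
  then have "{\<xi> \<in> space F. \<not> \<xi> 1} \<in> null_sets F"
    using prob_coordinates(1)[of "{1}" "\<lambda>_. False"] by (auto simp: null_sets_def emeasure_eq_measure)
  then show ?thesis by (rule AE_I') auto
qed

lemma AE_count: "AE \<xi> in F. feller_count n \<xi> \<in> partitions_of n"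
  using AE_first by eventually_elim (rule feller_count_in_partitions)

text \<open>The product formula is summed over the finitely many strings of length n that satisfy S.
  Taking L empty in \<open>main\<close> then identifies this sum as the probability of S.\<close>

lemma prob_independent:
  assumes S: "\<And>\<xi> \<xi>'. (\<And>k. k \<in> {1..n} \<Longrightarrow> \<xi> k = \<xi>' k) \<Longrightarrow> S \<xi> = S \<xi>'"
    and K: "finite K" "K \<subseteq> {n<..}"
  shows "prob {\<xi> \<in> space F. S \<xi> \<and> (\<forall>k\<in>K. \<xi> k = x k)}
       = prob {\<xi> \<in> space F. S \<xi>} * (\<Prod>k\<in>K. feller_prob \<theta> k (x k))"
proof -
  have main: "prob {\<xi> \<in> space F. S \<xi> \<and> (\<forall>k\<in>L. \<xi> k = x k)}
      = (\<Sum>y\<in>{y \<in> {1..n} \<rightarrow>\<^sub>E UNIV. S y}. \<Prod>k\<in>{1..n}. feller_prob \<theta> k (y k)) * (\<Prod>k\<in>L. feller_prob \<theta> k (x k))"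
    if L: "finite L" "L \<subseteq> {n<..}" for L
  proof -
    let ?Y = "{y \<in> {1..n} \<rightarrow>\<^sub>E UNIV. S y}"
    define E where "E y = {\<xi> \<in> space F. \<forall>k\<in>{1..n} \<union> L. \<xi> k = (if k \<le> n then y k else x k)}" for y
    have finY: "finite ?Y" by (intro finite_subset[OF _ finite_PiE[of "{1..n}" "\<lambda>_. UNIV :: bool set"]]) auto
    have E: "E y \<in> sets F" "prob (E y) = (\<Prod>k\<in>{1..n}. feller_prob \<theta> k (y k)) * (\<Prod>k\<in>L. feller_prob \<theta> k (x k))" for y
    proof -
      have U: "finite ({1..n} \<union> L)" "0 \<notin> {1..n} \<union> L" "{1..n} \<inter> L = {}" using L by auto
      show "E y \<in> sets F" unfolding E_def by (rule prob_coordinates(1)[OF U(1,2)])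
      have "prob (E y) = (\<Prod>k\<in>{1..n} \<union> L. feller_prob \<theta> k (if k \<le> n then y k else x k))"
        unfolding E_def by (rule prob_coordinates(2)[OF U(1,2)])
      also have "\<dots> = (\<Prod>k\<in>{1..n}. feller_prob \<theta> k (if k \<le> n then y k else x k)) * (\<Prod>k\<in>L. feller_prob \<theta> k (if k \<le> n then y k else x k))"
        using U L by (intro prod.union_disjoint) auto
      also have "\<dots> = (\<Prod>k\<in>{1..n}. feller_prob \<theta> k (y k)) * (\<Prod>k\<in>L. feller_prob \<theta> k (x k))"
        using L by (intro arg_cong2[where f = "(*)"] prod.cong) auto
      finally show "prob (E y) = (\<Prod>k\<in>{1..n}. feller_prob \<theta> k (y k)) * (\<Prod>k\<in>L. feller_prob \<theta> k (x k))" .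
    qed
    have "{\<xi> \<in> space F. S \<xi> \<and> (\<forall>k\<in>L. \<xi> k = x k)} = (\<Union>y\<in>?Y. E y)"
    proof (intro equalityI subsetI)
      fix \<xi> assume \<xi>: "\<xi> \<in> {\<xi> \<in> space F. S \<xi> \<and> (\<forall>k\<in>L. \<xi> k = x k)}"
      have "S (restrict \<xi> {1..n}) = S \<xi>" by (rule S) simp
      then have "restrict \<xi> {1..n} \<in> ?Y" using \<xi> by simp
      moreover have "\<xi> \<in> E (restrict \<xi> {1..n})" using \<xi> L by (auto simp: E_def)
      ultimately show "\<xi> \<in> (\<Union>y\<in>?Y. E y)" by blast
    next
      fix \<xi> assume "\<xi> \<in> (\<Union>y\<in>?Y. E y)"
      then obtain y where y: "y \<in> ?Y" "\<xi> \<in> E y" by blast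
      have "S \<xi> = S y" by (rule S) (use y in \<open>auto simp: E_def\<close>)
      moreover have "\<xi> k = x k" if "k \<in> L" for k
      proof -
        have "k > n" using that L by auto
        then show ?thesis using that y by (auto simp: E_def)
      qed
      ultimately show "\<xi> \<in> {\<xi> \<in> space F. S \<xi> \<and> (\<forall>k\<in>L. \<xi> k = x k)}" using y by (auto simp: E_def)
    qed
    moreover have "disjoint_family_on E ?Y"
      unfolding disjoint_family_on_def
    proof (intro ballI impI equals0I)
      fix y y' \<xi> assume y: "y \<in> ?Y" "y' \<in> ?Y" "y \<noteq> y'" "\<xi> \<in> E y \<inter> E y'"
      have "y k = y' k" for k
      proof (cases "k \<in> {1..n}")
        case True
        have "\<forall>k\<in>{1..n} \<union> L. \<xi> k = (if k \<le> n then y k else x k)"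
          "\<forall>k\<in>{1..n} \<union> L. \<xi> k = (if k \<le> n then y' k else x k)"
          using y(4) unfolding E_def by blast+
        from this[THEN bspec[of _ _ k]] True have "\<xi> k = y k" "\<xi> k = y' k" by auto
        then show ?thesis by simp
      qed (use y in \<open>auto simp: PiE_iff extensional_def\<close>)
      then show False using y by auto
    qed
    then have "prob (\<Union>y\<in>?Y. E y) = (\<Sum>y\<in>?Y. prob (E y))"
      using E(1) finY by (intro finite_measure_finite_Union) auto
    ultimately have "prob {\<xi> \<in> space F. S \<xi> \<and> (\<forall>k\<in>L. \<xi> k = x k)} = (\<Sum>y\<in>?Y. prob (E y))"
      by (simp only:)
    then show ?thesis by (simp add: E sum_distrib_right)
  qed
  show ?thesis using main[OF K] main[of "{}"] by simp
qed

text \<open>The value (k - 1) / (\<theta> + k - 1) is written as a quotient of consecutive values of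
  \<open>k * a k\<close> so that products over intervals telescope.\<close>

lemma feller_prob_False: "k \<ge> 1 \<Longrightarrow> feller_prob \<theta> k False = real (k - 1) * a (k - 1) / (real k * a k)"
proof -
  assume k: "k \<ge> 1"
  have p: "\<theta> + real (k - 1) > 0" using theta_pos by (simp add: add_pos_nonneg)
  have "real k * a k = (\<theta> + real (k - 1)) * a (k - 1)"
    using ewens_coeff_Suc[of "k - 1" \<theta>] k by simp
  then show ?thesis using ewens_coeff_pos[OF theta_pos, of "k - 1"] p k
    by (simp add: feller_prob_def of_nat_diff add_diff_eq)
qed

lemma prod_feller_prob_False:
  assumes "1 \<le> m" "m \<le> n"
  shows "(\<Prod>k\<in>{m<..n}. feller_prob \<theta> k False) = real m * a m / (real n * a n)"
  using assms(2)
proof (induction n rule: dec_induct)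
  case base
  then show ?case using assms ewens_coeff_pos[OF theta_pos, of m] by simp
next
  case (step n)
  have "{m<..Suc n} = insert (Suc n) {m<..n}" using step.hyps by auto
  then have "(\<Prod>k\<in>{m<..Suc n}. feller_prob \<theta> k False) = feller_prob \<theta> (Suc n) False * (\<Prod>k\<in>{m<..n}. feller_prob \<theta> k False)"
    by simp
  also have "\<dots> = (real n * a n / (real (Suc n) * a (Suc n))) * (real m * a m / (real n * a n))"
    unfolding step.IH by (subst feller_prob_False) simp_all
  also have "\<dots> = real m * a m / (real (Suc n) * a (Suc n))"
    using ewens_coeff_pos[OF theta_pos, of n] step.hyps assms(1) by simp
  finally show ?case .
qed

lemma ewens_weight_remove_part:
  assumes "\<alpha> \<in> partitions_of n" "1 \<le> i" "i \<le> n" "\<alpha> i \<ge> 1"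
  shows "wt (n - i) (\<alpha>(i := \<alpha> i - 1)) * \<theta> = wt n \<alpha> * real (i * \<alpha> i)"
proof -
  let ?\<beta> = "\<alpha>(i := \<alpha> i - 1)"
  let ?w = "\<lambda>\<alpha> i. \<theta> ^ \<alpha> i / (real i ^ \<alpha> i * fact (\<alpha> i))"
  have "wt (n - i) ?\<beta> = (\<Prod>j=1..n. ?w ?\<beta> j)"
    unfolding ewens_weight_def
    using partitions_of_remove_part[OF assms] by (intro prod.mono_neutral_left) (auto simp: partitions_of_def)
  also have "\<dots> = ?w ?\<beta> i * (\<Prod>j\<in>{1..n} - {i}. ?w ?\<beta> j)"
    using assms by (intro prod.remove) auto
  also have "(\<Prod>j\<in>{1..n} - {i}. ?w ?\<beta> j) = (\<Prod>j\<in>{1..n} - {i}. ?w \<alpha> j)"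
    by (intro prod.cong) auto
  also have "?w ?\<beta> i * \<dots> * \<theta> = ?w \<alpha> i * (\<Prod>j\<in>{1..n} - {i}. ?w \<alpha> j) * real (i * \<alpha> i)"
  proof -
    obtain a where a: "\<alpha> i = Suc a" using assms(4) by (cases "\<alpha> i") auto
    have "?w ?\<beta> i * \<theta> = ?w \<alpha> i * real (i * \<alpha> i)"
      using a assms(2) by (simp add: fact_Suc field_simps del: of_nat_Suc) (simp add: algebra_simps)
    moreover have "A * X * B = C * X * D" if "A * B = C * D" for A B C D X :: real
    proof -
      have "A * X * B = (A * B) * X" by (simp only: mult_ac)
      also have "\<dots> = C * X * D" unfolding that by (simp only: mult_ac)
      finally show ?thesis .
    qed
    ultimately show ?thesis by blast
  qed
  also have "?w \<alpha> i * (\<Prod>j\<in>{1..n} - {i}. ?w \<alpha> j) = wt n \<alpha>"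
    unfolding ewens_weight_def using assms by (intro prod.remove[symmetric]) auto
  finally show ?thesis .
qed

text \<open>Decomposition by the last spacing i: the event splits into independent conditions on the
  first n - i coordinates, a 1 at n - i + 1 and zeros afterwards. The zeros telescope, and index i
  contributes the fraction \<open>i * \<alpha> i / n\<close> of the claimed value; these fractions
  add up to 1.\<close>

lemma prob_count:
  assumes "\<alpha> \<in> partitions_of n"
  shows "prob {\<xi> \<in> space F. feller_count n \<xi> = \<alpha>} = wt n \<alpha> / a n"
  using assms
proof (induction n arbitrary: \<alpha> rule: less_induct)
  case (less n)
  show ?case
  proof (cases "n = 0")
    case True
    then have "\<alpha> = (\<lambda>_. 0)" using less.prems by (auto simp: partitions_of_def)
    then have "{\<xi> \<in> space F. feller_count n \<xi> = \<alpha>} = space F"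
      using True by (auto simp: feller_count_def)
    then show ?thesis using True by (simp add: prob_space ewens_weight_def)
  next
    case False
      have a: "a k > 0" for k by (rule ewens_coeff_pos[OF theta_pos])
    define E where "E i = {\<xi> \<in> space F. feller_count n \<xi> = \<alpha> \<and> last_spacing \<xi> n i}" for i
    have meas: "E i \<in> sets F" if "i \<in> {1..n}" for i
    proof -
      have "(\<lambda>\<xi>. feller_count n \<xi> = \<alpha> \<and> last_spacing \<xi> n i) \<in> measurable F (count_space UNIV)"
      proof (rule measurable_finitely_many[of n])
        fix \<xi> \<xi>' :: "nat \<Rightarrow> bool" assume h: "\<And>k. k \<in> {1..n} \<Longrightarrow> \<xi> k = \<xi>' k"
        have "last_spacing \<xi> n i = last_spacing \<xi>' n i"
          unfolding last_spacing_def using that h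
          by (intro conj_cong ball_cong refl arg_cong[where f = Not]) auto
        then show "(feller_count n \<xi> = \<alpha> \<and> last_spacing \<xi> n i) = (feller_count n \<xi>' = \<alpha> \<and> last_spacing \<xi>' n i)"
          using feller_count_cong[of n \<xi> \<xi>'] h by simp
      qed
      then show ?thesis unfolding E_def by measurable
    qed
    have "prob {\<xi> \<in> space F. feller_count n \<xi> = \<alpha>} = prob (\<Union>i\<in>{1..n}. E i)"
    proof (rule measure_eq_AE)
      show "AE \<xi> in F. \<xi> \<in> {\<xi> \<in> space F. feller_count n \<xi> = \<alpha>} \<longleftrightarrow> \<xi> \<in> (\<Union>i\<in>{1..n}. E i)"
        using AE_first
      proof eventually_elim
        case (elim \<xi>)
        then show ?case using ex_last_spacing[of \<xi> n] False by (auto simp: E_def)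
      qed
      have [measurable]: "feller_count n \<in> measurable F (count_space UNIV)" by (rule measurable_count)
      show "{\<xi> \<in> space F. feller_count n \<xi> = \<alpha>} \<in> sets F" by measurable
    qed (use meas in auto)
    also have "\<dots> = (\<Sum>i=1..n. prob (E i))"
    proof (rule finite_measure_finite_Union)
      show "disjoint_family_on E {1..n}"
        unfolding disjoint_family_on_def E_def using last_spacing_unique by blast
    qed (use meas in auto)
    also have "\<dots> = (\<Sum>i=1..n. wt n \<alpha> * real (i * \<alpha> i) / (real n * a n))"
    proof (intro sum.cong refl)
      fix i assume i: "i \<in> {1..n}"
      define m where "m = n - i"
      have mn: "m < n" "n - m = i" using i by (auto simp: m_def)
      show "prob (E i) = wt n \<alpha> * real (i * \<alpha> i) / (real n * a n)"
      proof (cases "\<alpha> i = 0")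
        case True
        have "E i = {}" using i True feller_count_last[of i n] by (force simp: E_def)
        then show ?thesis using True by simp
      next
        case ai: False
        define \<beta> where "\<beta> = \<alpha>(i := \<alpha> i - 1)"
        have \<beta>: "\<beta> \<in> partitions_of m" unfolding \<beta>_def m_def
          using partitions_of_remove_part[OF less.prems, of i] i ai by simp
        define x where "x k = (k = m + 1)" for k :: nat
        have "E i = {\<xi> \<in> space F. feller_count m \<xi> = \<beta> \<and> (\<forall>k\<in>{m<..n}. \<xi> k = x k)}"
        proof -
          have "(feller_count n \<xi> = \<alpha> \<and> last_spacing \<xi> n i) \<longleftrightarrow> (feller_count m \<xi> = \<beta> \<and> (\<forall>k\<in>{m<..n}. \<xi> k = x k))" for \<xi>
          proof -
            have "last_spacing \<xi> n i \<longleftrightarrow> (\<forall>k\<in>{m<..n}. \<xi> k = x k)"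
            proof -
              have "{m<..n} = insert (m + 1) {m + 2..n}" using mn by auto
              then show ?thesis by (auto simp: last_spacing_def x_def m_def)
            qed
            moreover have "feller_count n \<xi> = \<alpha> \<longleftrightarrow> feller_count m \<xi> = \<beta>" if "last_spacing \<xi> n i"
              using feller_count_last[of i n \<xi>] that i ai unfolding \<beta>_def m_def[symmetric]
              by (auto simp: fun_eq_iff)
            ultimately show ?thesis by blast
          qed
          then show ?thesis by (simp add: E_def)
        qed
        then have "prob (E i) = prob {\<xi> \<in> space F. feller_count m \<xi> = \<beta> \<and> (\<forall>k\<in>{m<..n}. \<xi> k = x k)}"
          by (rule arg_cong)
        also have "\<dots> = prob {\<xi> \<in> space F. feller_count m \<xi> = \<beta>} * (\<Prod>k\<in>{m<..n}. feller_prob \<theta> k (x k))"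
        proof (rule prob_independent)
          show "(feller_count m \<xi> = \<beta>) = (feller_count m \<xi>' = \<beta>)"
            if "\<And>k. k \<in> {1..m} \<Longrightarrow> \<xi> k = \<xi>' k" for \<xi> \<xi>'
            by (rule arg_cong[OF feller_count_cong[OF that]])
        qed auto
        also have "prob {\<xi> \<in> space F. feller_count m \<xi> = \<beta>} = wt m \<beta> / a m"
          by (rule less.IH[OF mn(1) \<beta>])
        also have "(\<Prod>k\<in>{m<..n}. feller_prob \<theta> k (x k)) = feller_prob \<theta> (m + 1) True * (\<Prod>k\<in>{m+1<..n}. feller_prob \<theta> k False)"
        proof -
          have "{m<..n} = insert (m + 1) {m + 1<..n}" using mn by auto
          then show ?thesis by (auto simp: x_def intro!: prod.cong)
        qed
        also have "(\<Prod>k\<in>{m+1<..n}. feller_prob \<theta> k False) = real (m + 1) * a (m + 1) / (real n * a n)"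
          using mn by (intro prod_feller_prob_False) auto
        also have "real (m + 1) * a (m + 1) = (\<theta> + real m) * a m"
          using ewens_coeff_Suc[of m \<theta>] by simp
        also have "wt m \<beta> / a m * (feller_prob \<theta> (m + 1) True * ((\<theta> + real m) * a m / (real n * a n)))
            = wt m \<beta> * \<theta> / (real n * a n)"
        proof -
          have "\<theta> + real m > 0" using theta_pos by (simp add: add_pos_nonneg)
          then show ?thesis using a[of m] by (simp add: feller_prob_def)
        qed
        also have "wt m \<beta> * \<theta> = wt n \<alpha> * real (i * \<alpha> i)"
          unfolding \<beta>_def m_def using ewens_weight_remove_part[OF less.prems, of i] i ai by simp
        finally show ?thesis .
      qed
    qed
    also have "\<dots> = wt n \<alpha> * real (\<Sum>i=1..n. i * \<alpha> i) / (real n * a n)"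
      by (simp add: sum_distrib_left sum_divide_distrib)
    also have "(\<Sum>i=1..n. i * \<alpha> i) = n" using less.prems by (simp add: partitions_of_def)
    finally show ?thesis using False by simp
  qed
qed

lemma
  fixes \<phi> :: "(nat \<Rightarrow> nat) \<Rightarrow> real"
  shows integrable_count: "integrable F (\<lambda>\<xi>. \<phi> (feller_count n \<xi>))"
    and expectation_count: "expectation (\<lambda>\<xi>. \<phi> (feller_count n \<xi>))
      = (\<Sum>\<alpha>\<in>partitions_of n. \<phi> \<alpha> * wt n \<alpha>) / a n"
proof -
  define X where "X \<alpha> = {\<xi> \<in> space F. feller_count n \<xi> = \<alpha>}" for \<alpha>
  have [measurable]: "feller_count n \<in> measurable F (count_space UNIV)" by (rule measurable_count)
  have X [measurable]: "X \<alpha> \<in> sets F" for \<alpha> unfolding X_def by measurable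
  have m: "(\<lambda>\<xi>. \<phi> (feller_count n \<xi>)) \<in> borel_measurable F"
    by (rule measurable_compose[OF measurable_count]) simp
  have fin: "finite (partitions_of n)" by (rule finite_partitions_of)
  have ae: "AE \<xi> in F. \<phi> (feller_count n \<xi>) = (\<Sum>\<alpha>\<in>partitions_of n. \<phi> \<alpha> * indicator (X \<alpha>) \<xi>)"
    using AE_count[of n] AE_space
  proof eventually_elim
    case (elim \<xi>)
    then have "(\<Sum>\<alpha>\<in>partitions_of n. \<phi> \<alpha> * indicator (X \<alpha>) \<xi>)
        = (\<Sum>\<alpha>\<in>partitions_of n. if \<alpha> = feller_count n \<xi> then \<phi> \<alpha> else 0)"
      by (intro sum.cong refl) (auto simp: X_def indicator_def)
    then show ?case using elim fin by simp
  qed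
  have i: "integrable F (\<lambda>\<xi>. \<Sum>\<alpha>\<in>partitions_of n. \<phi> \<alpha> * indicator (X \<alpha>) \<xi>)"
    by (intro Bochner_Integration.integrable_sum integrable_mult_right integrable_real_indicator X)
       (simp add: emeasure_eq_measure)
  then show "integrable F (\<lambda>\<xi>. \<phi> (feller_count n \<xi>))"
    using ae m by (subst integrable_cong_AE[OF m _ ae]) auto
  have "expectation (\<lambda>\<xi>. \<phi> (feller_count n \<xi>)) = expectation (\<lambda>\<xi>. \<Sum>\<alpha>\<in>partitions_of n. \<phi> \<alpha> * indicator (X \<alpha>) \<xi>)"
    using i by (intro integral_cong_AE m ae) auto
  also have "\<dots> = (\<Sum>\<alpha>\<in>partitions_of n. \<phi> \<alpha> * prob (X \<alpha>))"
    by (subst Bochner_Integration.integral_sum)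
       (auto intro!: integrable_mult_right integrable_real_indicator X sum.cong simp: emeasure_eq_measure)
  also have "\<dots> = (\<Sum>\<alpha>\<in>partitions_of n. \<phi> \<alpha> * wt n \<alpha>) / a n"
    unfolding X_def by (simp add: prob_count sum_divide_distrib)
  finally show "expectation (\<lambda>\<xi>. \<phi> (feller_count n \<xi>))
      = (\<Sum>\<alpha>\<in>partitions_of n. \<phi> \<alpha> * wt n \<alpha>) / a n" .
qed

end

section \<open>Convergence in \<open>L\<^sup>1\<close>\<close>

text \<open>Riesz-Fischer: a subsequence converges almost everywhere, and Fatou's lemma along it
  bounds the distance of every late \<open>s n\<close> to the limit.\<close>

lemma L1_complete:
  fixes s :: "nat \<Rightarrow> 'a \<Rightarrow> real"
  assumes int: "\<And>n. integrable M (s n)"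
    and cau: "\<And>e. e > 0 \<Longrightarrow> \<exists>N. \<forall>i\<ge>N. \<forall>j\<ge>N. (\<integral>x. \<bar>s i x - s j x\<bar> \<partial>M) < e"
  obtains g where "L1_limit M s g"
proof -
  have [measurable]: "s n \<in> borel_measurable M" for n using int by (rule borel_measurable_integrable)
  obtain r where r: "strict_mono r" and ae: "AE x in M. Cauchy (\<lambda>i. s (r i) x)"
    using cauchy_L1_AE_cauchy_subseq[of M s] int cau by (auto simp: real_norm_def)
  define g where "g x = lim (\<lambda>i. s (r i) x)" for x
  have [measurable]: "g \<in> borel_measurable M" unfolding g_def by measurable
  have conv: "AE x in M. (\<lambda>i. s (r i) x) \<longlonglongrightarrow> g x"
    using ae by eventually_elim (simp add: g_def Cauchy_convergent_iff convergent_LIMSEQ_iff)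
  have bound: "\<exists>N. \<forall>n\<ge>N. (\<integral>\<^sup>+x. ennreal \<bar>s n x - g x\<bar> \<partial>M) \<le> ennreal e" if e: "e > 0" for e
  proof -
    obtain N where N: "\<And>i j. i \<ge> N \<Longrightarrow> j \<ge> N \<Longrightarrow> (\<integral>x. \<bar>s i x - s j x\<bar> \<partial>M) < e" using cau[OF e] by blast
    have "(\<integral>\<^sup>+x. ennreal \<bar>s n x - g x\<bar> \<partial>M) \<le> ennreal e" if n: "n \<ge> N" for n
    proof -
      have "(\<integral>\<^sup>+x. ennreal \<bar>s n x - g x\<bar> \<partial>M) = (\<integral>\<^sup>+x. liminf (\<lambda>i. ennreal \<bar>s n x - s (r i) x\<bar>) \<partial>M)"
      proof (rule nn_integral_cong_AE, use conv in eventually_elim)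
        case (elim x)
        have "(\<lambda>i. ennreal \<bar>s n x - s (r i) x\<bar>) \<longlonglongrightarrow> ennreal \<bar>s n x - g x\<bar>"
          by (intro tendsto_ennrealI tendsto_rabs tendsto_diff tendsto_const elim)
        then show ?case by (intro lim_imp_Liminf[symmetric]) simp_all
      qed
      also have "\<dots> \<le> liminf (\<lambda>i. \<integral>\<^sup>+x. ennreal \<bar>s n x - s (r i) x\<bar> \<partial>M)"
        by (rule nn_integral_liminf) measurable
      also have "\<dots> \<le> liminf (\<lambda>i. ennreal e)"
      proof (rule Liminf_mono, use eventually_ge_at_top[of N] in eventually_elim)
        case (elim i)
        then have "r i \<ge> N" using seq_suble[OF r, of i] by simp
        then have "(\<integral>x. \<bar>s n x - s (r i) x\<bar> \<partial>M) \<le> e" using N[OF n] by (simp add: less_imp_le)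
        moreover have "(\<integral>\<^sup>+x. ennreal \<bar>s n x - s (r i) x\<bar> \<partial>M) = ennreal (\<integral>x. \<bar>s n x - s (r i) x\<bar> \<partial>M)"
          by (intro nn_integral_eq_integral integrable_abs Bochner_Integration.integrable_diff int) simp
        ultimately show ?case by (simp add: ennreal_leI)
      qed
      also have "\<dots> = ennreal e" by (simp add: Liminf_const)
      finally show ?thesis .
    qed
    then show ?thesis by blast
  qed
  have intd: "\<exists>N. \<forall>n\<ge>N. integrable M (\<lambda>x. s n x - g x)"
  proof -
    obtain N where N: "\<And>n. n \<ge> N \<Longrightarrow> (\<integral>\<^sup>+x. ennreal \<bar>s n x - g x\<bar> \<partial>M) \<le> ennreal 1" using bound[of 1] by auto
    have "integrable M (\<lambda>x. s n x - g x)" if "n \<ge> N" for n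
      by (rule integrableI_bounded) (use le_less_trans[OF N[OF that] ennreal_less_top] in auto)
    then show ?thesis by blast
  qed
  then obtain N1 where N1: "\<And>n. n \<ge> N1 \<Longrightarrow> integrable M (\<lambda>x. s n x - g x)" by blast
  have "integrable M (\<lambda>x. s N1 x - (s N1 x - g x))"
    by (intro Bochner_Integration.integrable_diff int N1) simp
  then have g: "integrable M g" by simp
  have "(\<lambda>n. \<integral>x. \<bar>s n x - g x\<bar> \<partial>M) \<longlonglongrightarrow> 0"
  proof (rule tendstoI)
    fix e :: real assume "e > 0"
    then have "e / 2 > 0" by simp
    from bound[OF this] obtain N where N: "\<And>n. n \<ge> N \<Longrightarrow> (\<integral>\<^sup>+x. ennreal \<bar>s n x - g x\<bar> \<partial>M) \<le> ennreal (e / 2)" by blast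
    show "\<forall>\<^sub>F n in sequentially. dist (\<integral>x. \<bar>s n x - g x\<bar> \<partial>M) 0 < e"
      using eventually_ge_at_top[of N]
    proof eventually_elim
      case (elim n)
      have "ennreal (\<integral>x. \<bar>s n x - g x\<bar> \<partial>M) = (\<integral>\<^sup>+x. ennreal \<bar>s n x - g x\<bar> \<partial>M)"
        by (intro nn_integral_eq_integral[symmetric] integrable_abs Bochner_Integration.integrable_diff int g) simp
      also have "\<dots> \<le> ennreal (e / 2)" by (rule N[OF elim])
      finally have "(\<integral>x. \<bar>s n x - g x\<bar> \<partial>M) \<le> e / 2" using \<open>e > 0\<close> by simp
      moreover have "(\<integral>x. \<bar>s n x - g x\<bar> \<partial>M) \<ge> 0" by simp
      ultimately show ?case using \<open>e > 0\<close> by (simp add: dist_real_def)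
    qed
  qed
  then show ?thesis using that[of g] int g by (simp add: L1_limit_def)
qed

lemma L1_triangle:
  fixes a b c :: "'a \<Rightarrow> real"
  assumes "integrable M a" "integrable M b" "integrable M c"
  shows "(\<integral>x. \<bar>a x - c x\<bar> \<partial>M) \<le> (\<integral>x. \<bar>a x - b x\<bar> \<partial>M) + (\<integral>x. \<bar>b x - c x\<bar> \<partial>M)"
proof -
  have "(\<integral>x. \<bar>a x - c x\<bar> \<partial>M) \<le> (\<integral>x. \<bar>a x - b x\<bar> + \<bar>b x - c x\<bar> \<partial>M)"
    using assms by (intro integral_mono) auto
  also have "\<dots> = (\<integral>x. \<bar>a x - b x\<bar> \<partial>M) + (\<integral>x. \<bar>b x - c x\<bar> \<partial>M)"
    using assms by (intro Bochner_Integration.integral_add) auto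
  finally show ?thesis .
qed

text \<open>The functions \<open>F n m\<close> approximate \<open>f n\<close> only from a threshold
  in n that depends on m. So m is fixed first; f inherits the Cauchy property up to a small error,
  and letting n tend to infinity compares \<open>h m\<close> with g.\<close>

lemma L1_double_limit:
  fixes f :: "nat \<Rightarrow> 'a \<Rightarrow> real" and F :: "nat \<Rightarrow> nat \<Rightarrow> 'a \<Rightarrow> real"
  assumes f: "\<And>n. integrable M (f n)" and F: "\<And>n m. integrable M (F n m)"
    and cau: "\<And>m e. m \<ge> 1 \<Longrightarrow> e > 0 \<Longrightarrow> \<exists>N. \<forall>i\<ge>N. \<forall>j\<ge>N. (\<integral>x. \<bar>F i m x - F j m x\<bar> \<partial>M) < e"
    and approx: "\<And>e. e > 0 \<Longrightarrow> \<exists>m0. \<forall>m\<ge>m0. \<forall>\<^sub>F n in sequentially. (\<integral>x. \<bar>f n x - F n m x\<bar> \<partial>M) \<le> e"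
  obtains g h where "L1_limit M f g" "\<And>m. m \<ge> 1 \<Longrightarrow> L1_limit M (\<lambda>n. F n m) (h m)" "L1_limit M h g"
proof -
  have comm: "(\<integral>x. \<bar>a x - b x\<bar> \<partial>M) = (\<integral>x. \<bar>b x - a x\<bar> \<partial>M)" for a b :: "'a \<Rightarrow> real"
    by (simp add: abs_minus_commute)
  have "\<exists>g. L1_limit M (\<lambda>n. F n m) g" if "m \<ge> 1" for m
    by (rule L1_complete[of M "\<lambda>n. F n m"]) (use F cau[OF that] in auto)
  then obtain h where h: "\<And>m. m \<ge> 1 \<Longrightarrow> L1_limit M (\<lambda>n. F n m) (h m)" by metis
  have "\<exists>N. \<forall>i\<ge>N. \<forall>j\<ge>N. (\<integral>x. \<bar>f i x - f j x\<bar> \<partial>M) < e" if e: "e > 0" for e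
  proof -
    have "e / 4 > 0" using e by simp
    from approx[OF this] obtain m0 where m0: "\<And>m. m \<ge> m0 \<Longrightarrow> \<forall>\<^sub>F n in sequentially. (\<integral>x. \<bar>f n x - F n m x\<bar> \<partial>M) \<le> e / 4"
      by blast
    define m where "m = max m0 1"
    from m0[of m] obtain N1 where N1: "\<And>n. n \<ge> N1 \<Longrightarrow> (\<integral>x. \<bar>f n x - F n m x\<bar> \<partial>M) \<le> e / 4"
      by (auto simp: m_def eventually_sequentially)
    from cau[of m "e / 4"] e obtain N2 where N2: "\<And>i j. i \<ge> N2 \<Longrightarrow> j \<ge> N2 \<Longrightarrow> (\<integral>x. \<bar>F i m x - F j m x\<bar> \<partial>M) < e / 4"
      by (auto simp: m_def)
    have "(\<integral>x. \<bar>f i x - f j x\<bar> \<partial>M) < e" if "i \<ge> max N1 N2" "j \<ge> max N1 N2" for i j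
      using L1_triangle[OF f[of i] F[of i m] f[of j]] L1_triangle[OF F[of i m] F[of j m] f[of j]]
        N1[of i] N1[of j] N2[of i j] that comm[of "F j m" "f j"] e by simp
    then show ?thesis by blast
  qed
  from L1_complete[OF f this] obtain g where g: "L1_limit M f g" by blast
  have gi: "integrable M g" using g by (simp add: L1_limit_def)
  have hi: "integrable M (h m)" if "m \<ge> 1" for m using h[OF that] by (simp add: L1_limit_def)
  have "(\<lambda>m. \<integral>x. \<bar>h m x - g x\<bar> \<partial>M) \<longlonglongrightarrow> 0"
  proof (rule tendstoI)
    fix e :: real assume e: "e > 0"
    then have "e / 4 > 0" by simp
    from approx[OF this] obtain m0 where m0: "\<And>m. m \<ge> m0 \<Longrightarrow> \<forall>\<^sub>F n in sequentially. (\<integral>x. \<bar>f n x - F n m x\<bar> \<partial>M) \<le> e / 4"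
      by blast
    show "\<forall>\<^sub>F m in sequentially. dist (\<integral>x. \<bar>h m x - g x\<bar> \<partial>M) 0 < e"
      using eventually_ge_at_top[of "max m0 1"]
    proof eventually_elim
      case (elim m)
      have 1: "\<forall>\<^sub>F n in sequentially. (\<integral>x. \<bar>F n m x - h m x\<bar> \<partial>M) < e / 4"
        using h[of m] elim e by (intro order_tendstoD(2)[of _ 0]) (auto simp: L1_limit_def)
      have 2: "\<forall>\<^sub>F n in sequentially. (\<integral>x. \<bar>f n x - g x\<bar> \<partial>M) < e / 4"
        using g e by (intro order_tendstoD(2)[of _ 0]) (auto simp: L1_limit_def)
      have 3: "\<forall>\<^sub>F n in sequentially. (\<integral>x. \<bar>f n x - F n m x\<bar> \<partial>M) \<le> e / 4"
        using m0[of m] elim by simp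
      have "\<forall>\<^sub>F n in sequentially. (\<integral>x. \<bar>h m x - g x\<bar> \<partial>M) < e"
        using 1 2 3
      proof eventually_elim
        case (elim n)
        show ?case
          using L1_triangle[OF hi F[of n m] gi, of m] L1_triangle[OF F[of n m] f[of n] gi] elim
            comm[of "F n m" "h m"] comm[of "F n m" "f n"] e \<open>max m0 1 \<le> m\<close> by simp
      qed
      then show ?case by (simp add: dist_real_def)
    qed
  qed
  moreover have "\<forall>\<^sub>F m in sequentially. integrable M (h m)"
    using eventually_ge_at_top[of 1] by eventually_elim (rule hi)
  ultimately have "L1_limit M h g" using gi by (simp add: L1_limit_def)
  then show ?thesis using that g h by blast
qed

section \<open>Small sums and stabilisation of the counts in the Feller coupling\<close>

context feller
begin

lemma prob_coordinate: "k \<ge> 1 \<Longrightarrow> prob {\<xi> \<in> space F. \<xi> k} = \<theta> / (\<theta> + real (k - 1))"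
  using prob_coordinates(2)[of "{k}" "\<lambda>_. True"] by (simp add: feller_prob_def of_nat_diff add_diff_eq)

lemma prob_two_coordinates:
  assumes "1 \<le> j" "1 \<le> i"
  shows "prob {\<xi> \<in> space F. \<xi> j \<and> \<xi> (i + j)} = \<theta> / (\<theta> + real (j - 1)) * (\<theta> / (\<theta> + real (i + j - 1)))"
  using prob_coordinates(2)[of "{j, i + j}" "\<lambda>_. True"] assms
  by (simp add: feller_prob_def of_nat_diff add_diff_eq)

text \<open>A small sum excludes ones in \<open>{J<..m}\<close>, and the probabilities of zeros
  telescope. For J = 0 the event is empty and the right side is 0.\<close>

lemma prob_small_sum_le:
  assumes "J \<le> m" "m \<le> n" "1 \<le> m"
  shows "prob {\<xi> \<in> space F. (\<Sum>i=1..m. i * feller_count n \<xi> i) < J}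
    \<le> real J * a J / (real m * a m)"
proof (cases "J = 0")
  case False
  have "prob {\<xi> \<in> space F. (\<Sum>i=1..m. i * feller_count n \<xi> i) < J}
      \<le> prob {\<xi> \<in> space F. \<forall>k\<in>{J<..m}. \<xi> k = False}"
  proof (rule finite_measure_mono_AE)
    show "AE \<xi> in F. \<xi> \<in> {\<xi> \<in> space F. (\<Sum>i=1..m. i * feller_count n \<xi> i) < J}
        \<longrightarrow> \<xi> \<in> {\<xi> \<in> space F. \<forall>k\<in>{J<..m}. \<xi> k = False}"
      using AE_first by eventually_elim (use no_ones_of_small_sum assms in blast)
    show "{\<xi> \<in> space F. \<forall>k\<in>{J<..m}. \<xi> k = False} \<in> sets F" by (rule prob_coordinates(1)) auto
  qed
  also have "\<dots> = (\<Prod>k\<in>{J<..m}. feller_prob \<theta> k False)" by (rule prob_coordinates(2)) auto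
  also have "\<dots> = real J * a J / (real m * a m)"
    using False assms by (intro prod_feller_prob_False) auto
  finally show ?thesis .
qed simp

definition count_neq :: "nat \<Rightarrow> nat \<Rightarrow> nat \<Rightarrow> (nat \<Rightarrow> bool) set" where
  "count_neq m n n' = {\<xi> \<in> space F. \<exists>i\<in>{1..m}. feller_count n \<xi> i \<noteq> feller_count n' \<xi> i}"

lemma count_neq_commute: "count_neq m n n' = count_neq m n' n"
  unfolding count_neq_def by metis

lemma sets_count_neq: "count_neq m n n' \<in> sets F"
proof -
  have "(\<lambda>\<xi>. \<exists>i\<in>{1..m}. feller_count n \<xi> i \<noteq> feller_count n' \<xi> i) \<in> measurable F (count_space UNIV)"
  proof (rule measurable_finitely_many[of "max n n'"])
    fix \<xi> \<xi>' :: "nat \<Rightarrow> bool" assume h: "\<And>k. k \<in> {1..max n n'} \<Longrightarrow> \<xi> k = \<xi>' k"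
    have "feller_count n \<xi> = feller_count n \<xi>'" "feller_count n' \<xi> = feller_count n' \<xi>'"
      using h by (auto intro!: feller_count_cong)
    then show "(\<exists>i\<in>{1..m}. feller_count n \<xi> i \<noteq> feller_count n' \<xi> i) = (\<exists>i\<in>{1..m}. feller_count n \<xi>' i \<noteq> feller_count n' \<xi>' i)"
      by simp
  qed
  then show ?thesis unfolding count_neq_def by measurable
qed

text \<open>Union bound over i \<le> m of the events in \<open>feller_count_neqD\<close>. All
  indices involved exceed p = n - m: a single 1 there has probability at most \<theta> / p, and the
  pairs at distance i sum to a tail of a convergent series.\<close>

lemma prob_count_neq_le:
  assumes "m < n" "n \<le> n'"
  shows "prob (count_neq m n n')
    \<le> real m * (2 * (\<theta> / real (n - m)) + (\<Sum>j. \<theta>\<^sup>2 / (real (j + (n - m)))\<^sup>2))"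
proof -
  define p where "p = n - m"
  have p: "p \<ge> 1" using assms by (simp add: p_def)
  define S where "S k = {\<xi> \<in> space F. \<xi> k}" for k
  define S2 where "S2 i j = {\<xi> \<in> space F. \<xi> j \<and> \<xi> (i + j)}" for i j
  have S: "S k \<in> sets F" if "k \<ge> 1" for k
    using prob_coordinates(1)[of "{k}" "\<lambda>_. True"] that by (simp add: S_def)
  have S2: "S2 i j \<in> sets F" if "j \<ge> 1" for i j
    using prob_coordinates(1)[of "{j, i + j}" "\<lambda>_. True"] that by (simp add: S2_def)
  define U where "U i = S (n - i + 1) \<union> S (n' - i + 1) \<union> (\<Union>j\<in>{n-i<..n'-i}. S2 i j)" for i
  have Um: "U i \<in> sets F" for i unfolding U_def using S S2 by auto
  have summ: "summable (\<lambda>j. \<theta>\<^sup>2 / (real (j + p))\<^sup>2)"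
    using summable_ignore_initial_segment[OF summable_mult[OF inverse_power_summable[of 2, where 'a = real]], of "\<theta>\<^sup>2" p]
    by (simp add: divide_inverse)
  have single: "prob (S k) \<le> \<theta> / real p" if "k \<ge> p + 1" for k
  proof -
    have "prob (S k) = \<theta> / (\<theta> + real (k - 1))" unfolding S_def using that by (intro prob_coordinate) auto
    also have "\<dots> \<le> \<theta> / real p"
      using that p theta_pos by (intro divide_left_mono mult_pos_pos) auto
    finally show ?thesis .
  qed
  have double: "prob (S2 i j) \<le> \<theta>\<^sup>2 / (real (j - 1))\<^sup>2" if "j \<ge> 2" "i \<ge> 1" for i j
  proof -
    have "prob (S2 i j) = \<theta> / (\<theta> + real (j - 1)) * (\<theta> / (\<theta> + real (i + j - 1)))"
      unfolding S2_def using that by (intro prob_two_coordinates) auto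
    also have "\<dots> \<le> \<theta> / real (j - 1) * (\<theta> / real (j - 1))"
      using that theta_pos by (intro mult_mono divide_left_mono mult_pos_pos) auto
    finally show ?thesis by (simp add: power2_eq_square)
  qed
  have Ub: "prob (U i) \<le> 2 * (\<theta> / real p) + (\<Sum>j. \<theta>\<^sup>2 / (real (j + p))\<^sup>2)" if i: "i \<in> {1..m}" for i
  proof -
    have "prob (U i) \<le> prob (S (n - i + 1)) + prob (S (n' - i + 1)) + prob (\<Union>j\<in>{n-i<..n'-i}. S2 i j)"
      unfolding U_def using S S2
      by (intro order_trans[OF measure_Un_le] add_mono measure_Un_le order_refl) auto
    also have "prob (S (n - i + 1)) \<le> \<theta> / real p" using i assms by (intro single) (auto simp: p_def)
    also have "prob (S (n' - i + 1)) \<le> \<theta> / real p" using i assms by (intro single) (auto simp: p_def)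
    also have "prob (\<Union>j\<in>{n-i<..n'-i}. S2 i j) \<le> (\<Sum>j\<in>{n-i<..n'-i}. prob (S2 i j))"
      using S2 by (intro finite_measure_subadditive_finite) auto
    \<comment> \<open>The form j - 1 - p + p anticipates the substitution l = j - 1 - p; the
      subtraction is genuine because j > n - i \<ge> p.\<close>
    also have "\<dots> \<le> (\<Sum>j\<in>{n-i<..n'-i}. \<theta>\<^sup>2 / (real (j - 1 - p + p))\<^sup>2)"
    proof (rule sum_mono)
      fix j assume j: "j \<in> {n-i<..n'-i}"
      then have "j - 1 - p + p = j - 1" "j \<ge> 2" using i assms by (auto simp: p_def)
      then show "prob (S2 i j) \<le> \<theta>\<^sup>2 / (real (j - 1 - p + p))\<^sup>2" using double[of j i] i by simp
    qed
    also have "\<dots> = (\<Sum>l\<in>(\<lambda>j. j - 1 - p) ` {n-i<..n'-i}. \<theta>\<^sup>2 / (real (l + p))\<^sup>2)"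
      using i assms by (subst sum.reindex) (auto simp: inj_on_def p_def)
    also have "\<dots> \<le> (\<Sum>j. \<theta>\<^sup>2 / (real (j + p))\<^sup>2)"
      using summ by (intro sum_le_suminf) auto
    finally show ?thesis by simp
  qed
  have "prob (count_neq m n n') \<le> prob (\<Union>i\<in>{1..m}. U i)"
  proof (rule finite_measure_mono)
    show "count_neq m n n' \<subseteq> (\<Union>i\<in>{1..m}. U i)"
    proof
      fix \<xi> assume "\<xi> \<in> count_neq m n n'"
      then obtain i where i: "\<xi> \<in> space F" "i \<in> {1..m}" "feller_count n \<xi> i \<noteq> feller_count n' \<xi> i"
        unfolding count_neq_def by blast
      with feller_count_neqD[of n n' i \<xi>] assms have "\<xi> \<in> U i" by (auto simp: U_def S_def S2_def)
      then show "\<xi> \<in> (\<Union>i\<in>{1..m}. U i)" using i by blast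
    qed
  qed (use Um in auto)
  also have "\<dots> \<le> (\<Sum>i\<in>{1..m}. prob (U i))"
    using Um by (intro finite_measure_subadditive_finite) auto
  also have "\<dots> \<le> (\<Sum>i\<in>{1..m}. 2 * (\<theta> / real p) + (\<Sum>j. \<theta>\<^sup>2 / (real (j + p))\<^sup>2))"
    by (rule sum_mono) (rule Ub)
  finally show ?thesis by (simp add: p_def)
qed

lemma prob_count_neq_small:
  assumes "e > 0"
  obtains N where "\<And>n n'. n \<ge> N \<Longrightarrow> n' \<ge> N \<Longrightarrow>
    prob (count_neq m n n') \<le> e"
proof -
  define b where "b p = real m * (2 * (\<theta> / real p) + (\<Sum>j. \<theta>\<^sup>2 / (real (j + p))\<^sup>2))" for p
  have summ: "summable (\<lambda>j. \<theta>\<^sup>2 / (real j)\<^sup>2)"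
    using summable_mult[OF inverse_power_summable[of 2, where 'a = real], of "\<theta>\<^sup>2"]
    by (simp add: divide_inverse)
  have 1: "(\<lambda>p. \<theta> / real p) \<longlonglongrightarrow> 0" by (rule lim_const_over_n)
  have 2: "(\<lambda>p. \<Sum>j. \<theta>\<^sup>2 / (real (j + p))\<^sup>2) \<longlonglongrightarrow> 0"
    by (rule LIMSEQ_I) (use suminf_exist_split[OF _ summ] in auto)
  have "b \<longlonglongrightarrow> real m * (2 * 0 + 0)" unfolding b_def by (intro tendsto_intros 1 2)
  then have "\<forall>\<^sub>F p in sequentially. b p < e" using assms by (intro order_tendstoD(2)[of _ 0]) auto
  then obtain P where P: "\<And>p. p \<ge> P \<Longrightarrow> b p < e" by (auto simp: eventually_sequentially)
  have main: "prob (count_neq m n n') \<le> e"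
    if "n \<ge> P + m + 1" "n \<le> n'" for n n'
  proof -
    have "prob (count_neq m n n') \<le> b (n - m)"
      unfolding b_def using that by (intro prob_count_neq_le) auto
    also have "\<dots> < e" using that by (intro P) auto
    finally show ?thesis by simp
  qed
  have "prob (count_neq m n n') \<le> e"
    if "n \<ge> P + m + 1" "n' \<ge> P + m + 1" for n n'
  proof (cases "n \<le> n'")
    case False
    then show ?thesis using main[of n' n] that by (simp add: count_neq_commute[of m n])
  qed (use main that in auto)
  then show ?thesis using that by blast
qed

end

section \<open>The density as a function of the partition alone, and its limits\<close>

definition parts_sum :: "(nat \<Rightarrow> nat) \<Rightarrow> nat" where
  "parts_sum \<alpha> = (\<Sum>i | \<alpha> i \<noteq> 0. i * \<alpha> i)"

lemma parts_sum_eq: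
  assumes "finite S" "\<And>i. i \<notin> S \<Longrightarrow> \<alpha> i = 0"
  shows "parts_sum \<alpha> = (\<Sum>i\<in>S. i * \<alpha> i)"
  unfolding parts_sum_def
proof (rule sum.mono_neutral_left)
  show "{i. \<alpha> i \<noteq> 0} \<subseteq> S"
  proof
    fix i assume "i \<in> {i. \<alpha> i \<noteq> 0}"
    then show "i \<in> S" using assms(2)[of i] by auto
  qed
qed (use assms(1) in auto)

lemma parts_sum_partitions_of: "\<alpha> \<in> partitions_of n \<Longrightarrow> parts_sum \<alpha> = n"
  using parts_sum_eq[of "{1..n}" \<alpha>] by (auto simp: partitions_of_def)

lemma partitions_of_parts_sum:
  assumes "finite S" "\<And>i. i \<notin> S \<Longrightarrow> \<alpha> i = 0" "\<alpha> 0 = 0"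
  shows "\<alpha> \<in> partitions_of (parts_sum \<alpha>)"
proof -
  have s: "parts_sum \<alpha> = (\<Sum>i\<in>S. i * \<alpha> i)" by (rule parts_sum_eq) (use assms in auto)
  have z: "\<alpha> i = 0" if "i \<notin> {1..parts_sum \<alpha>}" for i
  proof (rule ccontr)
    assume a: "\<alpha> i \<noteq> 0"
    then have "i \<in> S" "i \<noteq> 0" using assms by metis+
    have "i * 1 \<le> i * \<alpha> i" using a by (intro mult_left_mono) auto
    also have "\<dots> \<le> parts_sum \<alpha>" unfolding s using \<open>i \<in> S\<close> assms(1) by (intro member_le_sum) auto
    finally show False using that \<open>i \<noteq> 0\<close> by auto
  qed
  then have "(\<Sum>i=1..parts_sum \<alpha>. i * \<alpha> i) = parts_sum \<alpha>"
    using parts_sum_eq[of "{1..parts_sum \<alpha>}" \<alpha>] by auto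
  then show ?thesis using z by (auto simp: partitions_of_def)
qed

context log_perturbation
begin

text \<open>The cutoff is the size of the partition, so no n enters. Once the size is at least J,
  the normalisation of \<open>t i 0\<close> makes every larger cutoff equivalent.\<close>

definition eta :: "(nat \<Rightarrow> nat) \<Rightarrow> real" where
  "eta \<alpha> = R (parts_sum \<alpha>) \<alpha>"

definition trunc :: "nat \<Rightarrow> (nat \<Rightarrow> nat) \<Rightarrow> nat \<Rightarrow> nat" where
  "trunc m \<alpha> = (\<lambda>i. if i \<le> m then \<alpha> i else 0)"

lemma eta_trunc_eq: "eta_trunc eta n m \<xi> = eta (trunc m (feller_count n \<xi>))"
  by (simp add: eta_trunc_def trunc_def)

lemma R_nonneg: "R m \<alpha> \<ge> 0"
  unfolding R_def by (intro prod_nonneg divide_nonneg_nonneg t_nonneg less_imp_le[OF q_pos]) auto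

lemma R_cong_large:
  assumes "J \<le> m" "m \<le> k" "\<And>i. m < i \<Longrightarrow> \<alpha> i = 0"
  shows "R k \<alpha> = R m \<alpha>"
proof -
  have one: "t i (\<alpha> i) / q i (\<alpha> i) = 1" if "i \<in> {1..k} - {1..m}" for i
  proof -
    have "i > m" using that by auto
    then have "\<alpha> i = 0" "t i 0 = 1" using assms by (auto intro: t_0)
    then show ?thesis by simp
  qed
  show ?thesis unfolding R_def
  proof (rule prod.mono_neutral_right)
    show "\<forall>i\<in>{1..k} - {1..m}. t i (\<alpha> i) / q i (\<alpha> i) = 1" using one by blast
  qed (use assms(2) in auto)
qed

lemma ratio_le_T: "i \<ge> 1 \<Longrightarrow> t i l / q i l \<le> T i l / q i l"
  using t_le_T[of i l] q_pos[of i l] by (simp add: divide_right_mono)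

lemma ratio_T_ge_1: "i \<ge> 1 \<Longrightarrow> 1 \<le> T i l / q i l"
  using q_le_T[of i l] q_pos[of i l] by simp

lemma RT_ge_1: "1 \<le> RT m \<alpha>"
  unfolding RT_def by (intro prod_ge_1 ratio_T_ge_1) auto

text \<open>The cutoff k may lie on either side of m: factors beyond m are
  \<open>t i 0 \<le> 1\<close>, and factors of \<open>RT\<close> without a counterpart on the left
  are at least 1.\<close>

lemma R_le_RT:
  assumes "\<And>i. m < i \<Longrightarrow> \<alpha> i = 0"
  shows "R k \<alpha> \<le> RT m \<alpha>"
proof -
  have "R k \<alpha> \<le> (\<Prod>i=1..k. if i \<le> m then T i (\<alpha> i) / q i (\<alpha> i) else 1)"
    unfolding R_def
  proof (intro prod_mono conjI)
    fix i assume i: "i \<in> {1..k}"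
    show "0 \<le> t i (\<alpha> i) / q i (\<alpha> i)"
      using i by (intro divide_nonneg_nonneg t_nonneg less_imp_le[OF q_pos]) auto
    show "t i (\<alpha> i) / q i (\<alpha> i) \<le> (if i \<le> m then T i (\<alpha> i) / q i (\<alpha> i) else 1)"
      using i assms[of i] t_0_le[of i] by (auto intro: ratio_le_T)
  qed
  also have "\<dots> = (\<Prod>i\<in>{i\<in>{1..k}. i \<le> m}. T i (\<alpha> i) / q i (\<alpha> i))"
    by (rule prod.inter_filter[symmetric]) simp
  also have "\<dots> \<le> (\<Prod>i=1..m. T i (\<alpha> i) / q i (\<alpha> i))"
  proof (rule prod_mono2)
    fix i assume "i \<in> {i\<in>{1..k}. i \<le> m}"
    then show "0 \<le> T i (\<alpha> i) / q i (\<alpha> i)" using order_trans[OF zero_le_one ratio_T_ge_1] by auto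
  qed (auto intro: ratio_T_ge_1)
  finally show ?thesis by (simp add: RT_def)
qed

lemma eta_nonneg: "eta \<alpha> \<ge> 0"
  by (simp add: eta_def R_nonneg)

lemma eta_trunc_le_RT: "eta (trunc m \<alpha>) \<le> RT m \<alpha>"
proof -
  have "eta (trunc m \<alpha>) \<le> RT m (trunc m \<alpha>)" unfolding eta_def by (rule R_le_RT) (simp add: trunc_def)
  also have "\<dots> = RT m \<alpha>" unfolding RT_def by (intro prod.cong) (auto simp: trunc_def)
  finally show ?thesis .
qed

lemma parts_sum_trunc:
  assumes "\<alpha> 0 = 0"
  shows "parts_sum (trunc m \<alpha>) = (\<Sum>i=1..m. i * \<alpha> i)"
proof -
  have "parts_sum (trunc m \<alpha>) = (\<Sum>i=1..m. i * trunc m \<alpha> i)"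
    using assms by (intro parts_sum_eq) (auto simp: trunc_def not_le Suc_le_eq)
  also have "\<dots> = (\<Sum>i=1..m. i * \<alpha> i)" by (intro sum.cong) (auto simp: trunc_def)
  finally show ?thesis .
qed

lemma trunc_in_partitions:
  assumes "\<alpha> 0 = 0"
  shows "trunc m \<alpha> \<in> partitions_of (\<Sum>i=1..m. i * \<alpha> i)"
  unfolding parts_sum_trunc[of \<alpha> m, OF assms, symmetric]
  by (rule partitions_of_parts_sum[of "{..m}"]) (use assms in \<open>auto simp: trunc_def\<close>)

lemma integrable_eta: "integrable F (eta_trunc eta n m)"
proof -
  have "integrable F (\<lambda>\<xi>. eta (trunc m (feller_count n \<xi>)))"
    by (rule integrable_count[where \<phi> = "\<lambda>\<alpha>. eta (trunc m \<alpha>)"])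
  then show ?thesis by (simp add: eta_trunc_eq[abs_def])
qed

lemma AE_eta_diag: "AE \<xi> in F. eta_trunc eta n n \<xi> = R n (feller_count n \<xi>)"
  using AE_count[of n]
proof eventually_elim
  case (elim \<xi>)
  then have "trunc n (feller_count n \<xi>) = feller_count n \<xi>"
    by (auto simp: trunc_def partitions_of_def fun_eq_iff)
  then show ?case using elim by (simp add: eta_trunc_eq eta_def parts_sum_partitions_of)
qed

text \<open>Truncation at \<open>m\<close> changes \<open>\<eta>\<close> only when the truncated partition has size less than \<open>J\<close>.\<close>

lemma R_eta_trunc_diff:
  obtains K where "K \<ge> 0" "\<And>m n \<xi>. m \<ge> J \<Longrightarrow>
    \<bar>R m (feller_count n \<xi>) - eta_trunc eta n m \<xi>\<bar> \<le> (if (\<Sum>i=1..m. i * feller_count n \<xi> i) < J then K else 0)"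
proof -
  \<comment> \<open>Only finitely many partitions have size below J, so the sum of all values
    involved serves as a uniform bound.\<close>
  define K where "K = (\<Sum>k<J. \<Sum>\<alpha>\<in>partitions_of k. R J \<alpha> + R k \<alpha>)"
  have K: "R J \<alpha> + R k \<alpha> \<le> K" if "k < J" "\<alpha> \<in> partitions_of k" for k \<alpha>
  proof -
    have "R J \<alpha> + R k \<alpha> \<le> (\<Sum>\<alpha>\<in>partitions_of k. R J \<alpha> + R k \<alpha>)"
      using that by (intro member_le_sum finite_partitions_of) (auto simp: R_nonneg intro: add_nonneg_nonneg)
    also have "\<dots> \<le> K"
      unfolding K_def using that
      by (intro member_le_sum[where f = "\<lambda>k. \<Sum>\<alpha>\<in>partitions_of k. R J \<alpha> + R k \<alpha>"]) (auto intro!: sum_nonneg add_nonneg_nonneg simp: R_nonneg)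
    finally show ?thesis .
  qed
  have "\<bar>R m (feller_count n \<xi>) - eta_trunc eta n m \<xi>\<bar> \<le> (if (\<Sum>i=1..m. i * feller_count n \<xi> i) < J then K else 0)"
    if m: "m \<ge> J" for m n \<xi>
  proof -
    define \<alpha> where "\<alpha> = trunc m (feller_count n \<xi>)"
    define k where "k = (\<Sum>i=1..m. i * feller_count n \<xi> i)"
    have c0: "feller_count n \<xi> 0 = 0" by (simp add: feller_count_outside)
    have \<alpha>: "\<alpha> \<in> partitions_of k" unfolding \<alpha>_def k_def using c0 by (rule trunc_in_partitions)
    have z: "\<alpha> i = 0" if "k < i \<or> m < i" for i
    proof (cases "k < i")
      case True
      then show ?thesis using \<alpha> unfolding partitions_of_def by auto
    next
      case False
      then show ?thesis using that by (simp add: \<alpha>_def trunc_def)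
    qed
    have eta: "eta_trunc eta n m \<xi> = R k \<alpha>"
      using parts_sum_partitions_of[OF \<alpha>] by (simp add: eta_trunc_eq eta_def \<alpha>_def)
    have R: "R m (feller_count n \<xi>) = R m \<alpha>" unfolding R_def by (intro prod.cong) (auto simp: \<alpha>_def trunc_def)
    show ?thesis
    proof (cases "k < J")
      case True
      have "R m \<alpha> = R J \<alpha>" using m z True by (intro R_cong_large) auto
      then show ?thesis using K[OF True \<alpha>] R_nonneg[of J \<alpha>] R_nonneg[of k \<alpha>] True
        unfolding eta R k_def[symmetric] by simp
    next
      case False
      have "R m \<alpha> = R k \<alpha>"
      proof (cases "m \<le> k")
        case True
        then show ?thesis using m z by (intro R_cong_large[symmetric]) auto
      next
        case 2: False
        then show ?thesis using False z by (intro R_cong_large) auto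
      qed
      then show ?thesis using False unfolding eta R k_def[symmetric] by simp
    qed
  qed
  moreover have "K \<ge> 0" unfolding K_def by (intro sum_nonneg add_nonneg_nonneg R_nonneg)
  ultimately show ?thesis using that by blast
qed

text \<open>There are two errors: from cutoff n to cutoff m, bounded by
  \<open>sum_abs_R_diff_le\<close>, and from \<open>R m\<close> to \<open>eta\<close> of the
  truncation, at most K on an event whose probability vanishes as m grows.\<close>

lemma eta_approx:
  assumes "\<epsilon> > 0"
  shows "\<exists>m0. \<forall>m\<ge>m0. \<forall>\<^sub>F n in sequentially. (\<integral>\<xi>. \<bar>eta_trunc eta n n \<xi> - eta_trunc eta n m \<xi>\<bar> \<partial>F) \<le> \<epsilon>"
proof -
  obtain K where K0: "K \<ge> 0" and K: "\<And>m n \<xi>. m \<ge> J \<Longrightarrow>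
    \<bar>R m (feller_count n \<xi>) - eta_trunc eta n m \<xi>\<bar> \<le> (if (\<Sum>i=1..m. i * feller_count n \<xi> i) < J then K else 0)"
    using R_eta_trunc_diff by blast
  have "\<epsilon> / 2 > 0" using assms by simp
  from sum_abs_R_diff_le[OF this] obtain m1 where m1: "m1 \<ge> J" "\<And>m. m \<ge> m1 \<Longrightarrow> \<forall>\<^sub>F n in sequentially.
       (\<Sum>\<alpha>\<in>partitions_of n. \<bar>R n \<alpha> - R m \<alpha>\<bar> * wt n \<alpha>) \<le> \<epsilon> / 2 * a n" by blast
  have "(\<lambda>m. K * (real J * a J / (real m * a m))) \<longlonglongrightarrow> 0"
    by (intro tendsto_mult_right_zero tendsto_divide_0[OF tendsto_const]
          filterlim_at_top_imp_at_infinity ewens_coeff_mult_at_top theta_pos)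
  then have "\<forall>\<^sub>F m in sequentially. K * (real J * a J / (real m * a m)) < \<epsilon> / 2"
    using assms by (intro order_tendstoD(2)[of _ 0]) auto
  then obtain m2 where m2: "\<And>m. m \<ge> m2 \<Longrightarrow> K * (real J * a J / (real m * a m)) < \<epsilon> / 2"
    by (auto simp: eventually_sequentially)
  have "\<forall>\<^sub>F n in sequentially. (\<integral>\<xi>. \<bar>eta_trunc eta n n \<xi> - eta_trunc eta n m \<xi>\<bar> \<partial>F) \<le> \<epsilon>"
    if m: "m \<ge> max m1 (max m2 1)" for m
  proof -
    have m1': "\<forall>\<^sub>F n in sequentially.
       (\<Sum>\<alpha>\<in>partitions_of n. \<bar>R n \<alpha> - R m \<alpha>\<bar> * wt n \<alpha>) \<le> \<epsilon> / 2 * a n"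
      using m1(2)[of m] m by simp
    show ?thesis
    using m1' eventually_ge_at_top[of m]
  proof eventually_elim
    case (elim n)
    define S where "S = {\<xi> \<in> space F. (\<Sum>i=1..m. i * feller_count n \<xi> i) < J}"
    have mc: "(\<lambda>\<xi>. \<phi> (feller_count n \<xi>)) \<in> measurable F (count_space UNIV)" for \<phi> :: "(nat \<Rightarrow> nat) \<Rightarrow> 'z"
      by (rule measurable_compose[OF measurable_count]) simp
    have S: "S \<in> sets F"
    proof -
      have "(\<lambda>\<xi>. (\<Sum>i=1..m. i * feller_count n \<xi> i) < J) \<in> measurable F (count_space UNIV)"
        by (rule mc)
      then show ?thesis unfolding S_def by measurable
    qed
    have "(\<integral>\<xi>. \<bar>eta_trunc eta n n \<xi> - eta_trunc eta n m \<xi>\<bar> \<partial>F)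
        \<le> (\<integral>\<xi>. \<bar>R n (feller_count n \<xi>) - R m (feller_count n \<xi>)\<bar> + K * indicator S \<xi> \<partial>F)"
    proof (rule integral_mono_AE)
      show "AE \<xi> in F. \<bar>eta_trunc eta n n \<xi> - eta_trunc eta n m \<xi>\<bar>
          \<le> \<bar>R n (feller_count n \<xi>) - R m (feller_count n \<xi>)\<bar> + K * indicator S \<xi>"
        using AE_eta_diag[of n] AE_space
      proof eventually_elim
        case (elim \<xi>)
        have "\<bar>R m (feller_count n \<xi>) - eta_trunc eta n m \<xi>\<bar> \<le> K * indicator S \<xi>"
          using K[of m n \<xi>] m m1(1) elim(2) by (auto simp: S_def indicator_def)
        then show ?case using elim(1) by linarith
      qed
      show "integrable F (\<lambda>\<xi>. \<bar>eta_trunc eta n n \<xi> - eta_trunc eta n m \<xi>\<bar>)"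
        by (intro integrable_abs Bochner_Integration.integrable_diff integrable_eta)
      show "integrable F (\<lambda>\<xi>. \<bar>R n (feller_count n \<xi>) - R m (feller_count n \<xi>)\<bar> + K * indicator S \<xi>)"
        by (intro Bochner_Integration.integrable_add integrable_count[where \<phi> = "\<lambda>\<alpha>. \<bar>R n \<alpha> - R m \<alpha>\<bar>"]
            integrable_mult_right integrable_real_indicator S) (simp add: emeasure_eq_measure)
    qed
    also have "\<dots> = (\<integral>\<xi>. \<bar>R n (feller_count n \<xi>) - R m (feller_count n \<xi>)\<bar> \<partial>F) + K * prob S"
      using S by (subst Bochner_Integration.integral_add)
        (auto intro!: integrable_count[where \<phi> = "\<lambda>\<alpha>. \<bar>R n \<alpha> - R m \<alpha>\<bar>"] integrable_mult_right integrable_real_indicator simp: emeasure_eq_measure)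
    also have "(\<integral>\<xi>. \<bar>R n (feller_count n \<xi>) - R m (feller_count n \<xi>)\<bar> \<partial>F)
        = (\<Sum>\<alpha>\<in>partitions_of n. \<bar>R n \<alpha> - R m \<alpha>\<bar> * wt n \<alpha>) / a n"
      by (rule expectation_count[where \<phi> = "\<lambda>\<alpha>. \<bar>R n \<alpha> - R m \<alpha>\<bar>"])
    also have "\<dots> \<le> \<epsilon> / 2"
      using elim(1) ewens_coeff_pos[OF theta_pos, of n] by (simp add: pos_divide_le_eq)
    also have "K * prob S \<le> K * (real J * a J / (real m * a m))"
      unfolding S_def using elim(2) m m1(1) K0 by (intro mult_left_mono prob_small_sum_le) auto
    also have "\<dots> \<le> \<epsilon> / 2" using m2[of m] m by simp
    finally show ?case by simp
  qed
  qed
  then show ?thesis by blast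
qed

text \<open>Where the counts up to m agree, the integrand is 0. Elsewhere each value is at most C if
  the truncated size is at most K, and otherwise is absorbed by L, whose expectation is small
  uniformly in n \<ge> N1.\<close>

lemma eta_Cauchy:
  assumes "\<epsilon> > 0"
  shows "\<exists>N. \<forall>n\<ge>N. \<forall>n'\<ge>N. (\<integral>\<xi>. \<bar>eta_trunc eta n m \<xi> - eta_trunc eta n' m \<xi>\<bar> \<partial>F) < \<epsilon>"
proof -
  have "\<epsilon> / 5 > 0" using assms by simp
  from sum_RT_large[OF this, of m] obtain K N1 where N1: "\<And>n. n \<ge> N1 \<Longrightarrow>
     (\<Sum>\<alpha>\<in>partitions_of n. (if K < (\<Sum>i=1..m. i * \<alpha> i) then RT m \<alpha> * wt n \<alpha> else 0)) \<le> \<epsilon> / 5 * a n"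
    unfolding eventually_sequentially by blast
  define C where "C = (\<Sum>k\<le>K. \<Sum>\<alpha>\<in>partitions_of k. eta \<alpha>)"
  have C: "eta \<alpha> \<le> C" if "k \<le> K" "\<alpha> \<in> partitions_of k" for k \<alpha>
  proof -
    have "eta \<alpha> \<le> (\<Sum>\<alpha>\<in>partitions_of k. eta \<alpha>)"
      using that by (intro member_le_sum finite_partitions_of) (auto simp: eta_nonneg)
    also have "\<dots> \<le> C"
      unfolding C_def using that
      by (intro member_le_sum[where f = "\<lambda>k. \<Sum>\<alpha>\<in>partitions_of k. eta \<alpha>"]) (auto intro!: sum_nonneg eta_nonneg)
    finally show ?thesis .
  qed
  have C0: "C \<ge> 0" unfolding C_def by (intro sum_nonneg eta_nonneg)
  define L where "L \<alpha> = (if K < (\<Sum>i=1..m. i * \<alpha> i) then RT m \<alpha> else 0)" for \<alpha>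
  have L0: "L \<alpha> \<ge> 0" for \<alpha> using RT_ge_1[of m \<alpha>] by (simp add: L_def)
  have etaL: "eta_trunc eta n m \<xi> \<le> C + L (feller_count n \<xi>)" for n \<xi>
  proof (cases "K < (\<Sum>i=1..m. i * feller_count n \<xi> i)")
    case True
    then show ?thesis using eta_trunc_le_RT[of m "feller_count n \<xi>"] C0 by (simp add: eta_trunc_eq L_def)
  next
    case False
    have "feller_count n \<xi> 0 = 0" by (simp add: feller_count_outside)
    from trunc_in_partitions[of "feller_count n \<xi>" m, OF this] C[of "\<Sum>i=1..m. i * feller_count n \<xi> i"] False
    show ?thesis using L0[of "feller_count n \<xi>"] by (simp add: eta_trunc_eq add_increasing2)
  qed
  have EL: "expectation (\<lambda>\<xi>. L (feller_count n \<xi>)) \<le> \<epsilon> / 5" if "n \<ge> N1" for n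
  proof -
    have "expectation (\<lambda>\<xi>. L (feller_count n \<xi>)) = (\<Sum>\<alpha>\<in>partitions_of n. L \<alpha> * wt n \<alpha>) / a n"
      by (rule expectation_count)
    also have "(\<Sum>\<alpha>\<in>partitions_of n. L \<alpha> * wt n \<alpha>)
        = (\<Sum>\<alpha>\<in>partitions_of n. (if K < (\<Sum>i=1..m. i * \<alpha> i) then RT m \<alpha> * wt n \<alpha> else 0))"
      by (intro sum.cong) (auto simp: L_def)
    also have "\<dots> / a n \<le> \<epsilon> / 5"
      using N1[OF that] ewens_coeff_pos[OF theta_pos, of n] by (simp add: pos_divide_le_eq)
    finally show ?thesis .
  qed
  \<comment> \<open>C may be 0, hence 2 C + 1 in the denominator.\<close>
  have "\<epsilon> / (5 * (2 * C + 1)) > 0" using assms C0 by simp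
  from prob_count_neq_small[OF this, where m = m] obtain N2 where N2: "\<And>n n'. n \<ge> N2 \<Longrightarrow> n' \<ge> N2 \<Longrightarrow>
    prob (count_neq m n n') \<le> \<epsilon> / (5 * (2 * C + 1))" by blast
  have "(\<integral>\<xi>. \<bar>eta_trunc eta n m \<xi> - eta_trunc eta n' m \<xi>\<bar> \<partial>F) < \<epsilon>"
    if n: "n \<ge> max N1 N2" "n' \<ge> max N1 N2" for n n'
  proof -
    define A where "A = count_neq m n n'"
    have A: "A \<in> sets F" unfolding A_def by (rule sets_count_neq)
    have iL: "integrable F (\<lambda>\<xi>. L (feller_count n \<xi>))" for n by (rule integrable_count)
    have iA: "integrable F (\<lambda>\<xi>. 2 * C * indicator A \<xi>)"
      by (intro integrable_mult_right integrable_real_indicator A) (simp add: emeasure_eq_measure)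
    have "(\<integral>\<xi>. \<bar>eta_trunc eta n m \<xi> - eta_trunc eta n' m \<xi>\<bar> \<partial>F)
        \<le> (\<integral>\<xi>. (2 * C * indicator A \<xi> + L (feller_count n \<xi>)) + L (feller_count n' \<xi>) \<partial>F)"
    proof (rule integral_mono)
      show "integrable F (\<lambda>\<xi>. \<bar>eta_trunc eta n m \<xi> - eta_trunc eta n' m \<xi>\<bar>)"
        by (intro integrable_abs Bochner_Integration.integrable_diff integrable_eta)
      show "integrable F (\<lambda>\<xi>. (2 * C * indicator A \<xi> + L (feller_count n \<xi>)) + L (feller_count n' \<xi>))"
        by (intro Bochner_Integration.integrable_add iA iL)
      fix \<xi> assume sp: "\<xi> \<in> space F"
      show "\<bar>eta_trunc eta n m \<xi> - eta_trunc eta n' m \<xi>\<bar>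
          \<le> (2 * C * indicator A \<xi> + L (feller_count n \<xi>)) + L (feller_count n' \<xi>)"
      proof (cases "\<xi> \<in> A")
        case True
        have "0 \<le> eta_trunc eta n m \<xi>" "0 \<le> eta_trunc eta n' m \<xi>" by (simp_all add: eta_trunc_eq eta_nonneg)
        then show ?thesis using etaL[of n \<xi>] etaL[of n' \<xi>] True L0 C0 by (simp add: abs_le_iff)
      next
        case False
        then have eq: "\<And>i. i \<in> {1..m} \<Longrightarrow> feller_count n \<xi> i = feller_count n' \<xi> i" using sp by (auto simp: A_def count_neq_def)
        have "trunc m (feller_count n \<xi>) i = trunc m (feller_count n' \<xi>) i" for i
          using eq[of i] feller_count_outside[of i n] feller_count_outside[of i n'] by (cases "i = 0") (auto simp: trunc_def)
        then have "trunc m (feller_count n \<xi>) = trunc m (feller_count n' \<xi>)" by blast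
        then show ?thesis using False L0 by (simp add: eta_trunc_eq)
      qed
    qed
    also have "\<dots> = 2 * C * prob A + expectation (\<lambda>\<xi>. L (feller_count n \<xi>)) + expectation (\<lambda>\<xi>. L (feller_count n' \<xi>))"
      using A iA by (simp add: Bochner_Integration.integral_add iL)
    also have "2 * C * prob A \<le> (2 * C + 1) * (\<epsilon> / (5 * (2 * C + 1)))"
      unfolding A_def using N2[of n n'] n C0 by (intro mult_mono) auto
    also have "\<dots> = \<epsilon> / 5"
    proof -
      have "x * (\<epsilon> / (5 * x)) = \<epsilon> / 5" if "x \<noteq> 0" for x using that by simp
      then show ?thesis using C0 by (metis add_nonneg_pos less_irrefl mult_nonneg_nonneg zero_le_numeral zero_less_one)
    qed
    also have "expectation (\<lambda>\<xi>. L (feller_count n \<xi>)) \<le> \<epsilon> / 5" using n by (intro EL) auto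
    also have "expectation (\<lambda>\<xi>. L (feller_count n' \<xi>)) \<le> \<epsilon> / 5" using n by (intro EL) auto
    finally show ?thesis using assms by simp
  qed
  then show ?thesis by blast
qed

lemma expectation_eta_diag:
  "expectation (eta_trunc eta n n) = (\<Sum>\<alpha>\<in>partitions_of n. R n \<alpha> * wt n \<alpha>) / a n"
proof -
  have "expectation (eta_trunc eta n n) = expectation (\<lambda>\<xi>. R n (feller_count n \<xi>))"
    by (intro integral_cong_AE AE_eta_diag borel_measurable_integrable integrable_eta integrable_count)
  then show ?thesis using expectation_count[of "R n" n] by simp
qed

text \<open>The expectation of g is the limit of the masses divided by \<open>a n\<close>; it is
  nonnegative, and \<open>mass_not_tendsto_0\<close> excludes 0.\<close>

lemma eta_limits:
  obtains g h where "L1_limit F (\<lambda>n. eta_trunc eta n n) g"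
    "\<And>m. m \<ge> 1 \<Longrightarrow> L1_limit F (\<lambda>n. eta_trunc eta n m) (h m)"
    "L1_limit F h g" "expectation g > 0"
proof -
  obtain g h where gh: "L1_limit F (\<lambda>n. eta_trunc eta n n) g"
    "\<And>m. m \<ge> 1 \<Longrightarrow> L1_limit F (\<lambda>n. eta_trunc eta n m) (h m)" "L1_limit F h g"
    using L1_double_limit[of F "\<lambda>n. eta_trunc eta n n" "eta_trunc eta"] integrable_eta eta_Cauchy eta_approx by blast
  have gi: "integrable F g" and lim: "(\<lambda>n. \<integral>\<xi>. \<bar>eta_trunc eta n n \<xi> - g \<xi>\<bar> \<partial>F) \<longlonglongrightarrow> 0"
    using gh(1) by (auto simp: L1_limit_def)
  have "(\<lambda>n. expectation (eta_trunc eta n n) - expectation g) \<longlonglongrightarrow> 0"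
  proof (rule Lim_null_comparison[OF always_eventually lim], intro allI)
    fix n
    have "expectation (eta_trunc eta n n) - expectation g = (\<integral>\<xi>. eta_trunc eta n n \<xi> - g \<xi> \<partial>F)"
      by (simp add: Bochner_Integration.integral_diff integrable_eta gi)
    then show "norm (expectation (eta_trunc eta n n) - expectation g) \<le> (\<integral>\<xi>. \<bar>eta_trunc eta n n \<xi> - g \<xi>\<bar> \<partial>F)"
      using integral_abs_bound[of F "\<lambda>\<xi>. eta_trunc eta n n \<xi> - g \<xi>"] by simp
  qed
  then have Elim: "(\<lambda>n. expectation (eta_trunc eta n n)) \<longlonglongrightarrow> expectation g" by (rule LIM_zero_cancel)
  have "expectation g \<ge> 0"
    by (rule LIMSEQ_le_const[OF Elim]) (auto intro!: exI[of _ 0] integral_nonneg simp: eta_trunc_eq eta_nonneg)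
  moreover have "expectation g \<noteq> 0"
    using Elim mass_not_tendsto_0 by (auto simp: expectation_eta_diag)
  ultimately have "expectation g > 0" by linarith
  then show ?thesis using gh that[of g h] by blast
qed

end

section \<open>Uniform logarithmic structures\<close>

text \<open>For l \<ge> 2 the Poisson weight is of second order in 1 / i. One factor is the 1 / i of
  the required bound, the other goes into the error sequence.\<close>

lemma fact_power_div_le:
  assumes "(\<theta>::real) > 0" "i \<ge> 1" "l \<ge> 2"
  shows "(\<theta> / real i) ^ l / fact l \<le> (\<theta> ^ l / fact l) / real i / real i"
proof -
  have "real i ^ 2 \<le> real i ^ l" using assms by (intro power_increasing) auto
  then have "(\<theta> ^ l / fact l) / real i ^ l \<le> (\<theta> ^ l / fact l) / real i ^ 2"
    using assms by (intro divide_left_mono mult_pos_pos zero_less_power divide_nonneg_nonneg) auto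
  then show ?thesis by (simp add: power_divide power2_eq_square mult_ac)
qed

lemma (in prob_space) joint_law:
  assumes ind: "indep_vars (\<lambda>_. count_space UNIV) Y {1..}" and n: "n \<ge> (1::nat)"
  shows "prob {\<omega> \<in> space M. \<forall>i\<in>{1..n}. Y i \<omega> = \<alpha> i} = (\<Prod>i=1..n. prob {\<omega> \<in> space M. Y i \<omega> = \<alpha> i})"
    and "{\<omega> \<in> space M. \<forall>i\<in>{1..n}. Y i \<omega> = (\<alpha> i :: nat)} \<in> events"
proof -
  have rv: "Y i \<in> measurable M (count_space UNIV)" if "i \<ge> 1" for i
    using ind that by (auto simp: indep_vars_def)
  have e: "{\<omega> \<in> space M. \<forall>i\<in>{1..n}. Y i \<omega> = \<alpha> i} = (\<Inter>i\<in>{1..n}. Y i -` {\<alpha> i} \<inter> space M)"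
    using n by auto
  have "prob (\<Inter>i\<in>{1..n}. Y i -` {\<alpha> i} \<inter> space M) = (\<Prod>i\<in>{1..n}. prob (Y i -` {\<alpha> i} \<inter> space M))"
    by (rule indep_varsD[OF ind]) (use n in auto)
  moreover have "Y i -` {\<alpha> i} \<inter> space M = {\<omega> \<in> space M. Y i \<omega> = \<alpha> i}" for i by auto
  ultimately show "prob {\<omega> \<in> space M. \<forall>i\<in>{1..n}. Y i \<omega> = \<alpha> i} = (\<Prod>i=1..n. prob {\<omega> \<in> space M. Y i \<omega> = \<alpha> i})"
    by (simp only: e)
  have "Y i -` {\<alpha> i} \<inter> space M \<in> events" if "i \<in> {1..n}" for i
    using rv[of i] that by (intro measurable_sets[where A = "count_space UNIV"]) auto
  then show "{\<omega> \<in> space M. \<forall>i\<in>{1..n}. Y i \<omega> = \<alpha> i} \<in> events"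
    unfolding e using n by (intro sets.finite_INT) auto
qed

lemma (in prob_space) prob_weighted_sum:
  assumes ind: "indep_vars (\<lambda>_. count_space UNIV) Y {1..}" and n: "n \<ge> (1::nat)"
  shows "prob {\<omega> \<in> space M. (\<Sum>i=1..n. i * Y i \<omega>) = n}
    = (\<Sum>\<alpha>\<in>partitions_of n. \<Prod>i=1..n. prob {\<omega> \<in> space M. Y i \<omega> = \<alpha> i})"
proof -
  define E where "E \<alpha> = {\<omega> \<in> space M. \<forall>i\<in>{1..n}. Y i \<omega> = \<alpha> i}" for \<alpha>
  have E: "E \<alpha> \<in> events" "prob (E \<alpha>) = (\<Prod>i=1..n. prob {\<omega> \<in> space M. Y i \<omega> = \<alpha> i})" for \<alpha>
    unfolding E_def using joint_law[OF ind n] by auto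
  have "{\<omega> \<in> space M. (\<Sum>i=1..n. i * Y i \<omega>) = n} = (\<Union>\<alpha>\<in>partitions_of n. E \<alpha>)"
  proof (intro equalityI subsetI)
    fix \<omega> assume \<omega>: "\<omega> \<in> {\<omega> \<in> space M. (\<Sum>i=1..n. i * Y i \<omega>) = n}"
    define \<alpha> where "\<alpha> i = (if i \<in> {1..n} then Y i \<omega> else 0)" for i
    have "(\<Sum>i=1..n. i * \<alpha> i) = n" using \<omega> by (simp add: \<alpha>_def)
    then have "\<alpha> \<in> partitions_of n" by (auto simp: partitions_of_def \<alpha>_def)
    moreover have "\<omega> \<in> E \<alpha>" using \<omega> by (simp add: E_def \<alpha>_def)
    ultimately show "\<omega> \<in> (\<Union>\<alpha>\<in>partitions_of n. E \<alpha>)" by blast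
  next
    fix \<omega> assume "\<omega> \<in> (\<Union>\<alpha>\<in>partitions_of n. E \<alpha>)"
    then obtain \<alpha> where \<alpha>: "\<alpha> \<in> partitions_of n" "\<omega> \<in> E \<alpha>" by blast
    have "(\<Sum>i=1..n. i * Y i \<omega>) = (\<Sum>i=1..n. i * \<alpha> i)" using \<alpha>(2) by (intro sum.cong) (auto simp: E_def)
    then show "\<omega> \<in> {\<omega> \<in> space M. (\<Sum>i=1..n. i * Y i \<omega>) = n}" using \<alpha> by (auto simp: partitions_of_def E_def)
  qed
  also have "prob \<dots> = (\<Sum>\<alpha>\<in>partitions_of n. prob (E \<alpha>))"
  proof (rule finite_measure_finite_Union[OF finite_partitions_of])
    show "disjoint_family_on E (partitions_of n)"
      unfolding disjoint_family_on_def
    proof (intro ballI impI equals0I)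
      fix \<alpha> \<beta> \<omega> assume h: "\<alpha> \<in> partitions_of n" "\<beta> \<in> partitions_of n" "\<alpha> \<noteq> \<beta>" "\<omega> \<in> E \<alpha> \<inter> E \<beta>"
      have "\<alpha> i = \<beta> i" for i
      proof (cases "i \<in> {1..n}")
        case True
        then have "Y i \<omega> = \<alpha> i" "Y i \<omega> = \<beta> i" using h(4) unfolding E_def by blast+
        then show ?thesis by simp
      next
        case False
        then have "\<alpha> i = 0" "\<beta> i = 0" using h(1,2) unfolding partitions_of_def by blast+
        then show ?thesis by simp
      qed
      then show False using h(3) by blast
    qed
  qed (use E in auto)
  finally show ?thesis by (simp add: E)
qed

text \<open>Finitely many \<open>p i 0\<close> may vanish, so \<open>p i\<close> is divided by \<open>p i 0\<close> only for \<open>i > J\<close>.\<close>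

lemma log_perturbation_exists:
  fixes p :: "nat \<Rightarrow> nat \<Rightarrow> real"
  assumes \<theta>: "\<theta> > 0"
    and p0: "\<And>i l. p i l \<ge> 0" and p1: "\<And>i. i \<ge> 1 \<Longrightarrow> p i sums 1"
    and e0: "\<And>i. i \<ge> 1 \<Longrightarrow> e i \<ge> 0" and c0: "\<And>l. l \<ge> 2 \<Longrightarrow> c l \<ge> 0"
    and e: "e \<longlonglongrightarrow> 0" "summable (\<lambda>i. e i / real i)"
    and c: "summable (\<lambda>l. real l * c l)"
    and close1: "\<And>i. i \<ge> 1 \<Longrightarrow> \<bar>real i * p i 1 - \<theta>\<bar> \<le> e i"
    and close2: "\<And>i l. i \<ge> 1 \<Longrightarrow> l \<ge> 2 \<Longrightarrow> real i * p i l \<le> e i * c l"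
  obtains J t e' c' s where "log_perturbation \<theta> J t e' c'"
    "\<And>i. s i > 0" "\<And>i l. i \<ge> 1 \<Longrightarrow> t i l = s i * p i l"
proof -
  \<comment> \<open>The hypotheses leave the signs of e 0, c 0 and c 1 open; these values are set to
    0 to have nonnegativity at every index.\<close>
  define ee where "ee i = (if i = 0 then 0 else e i)" for i
  define cc where "cc l = (if l < 2 then 0 else c l)" for l
  have ee0: "ee i \<ge> 0" for i using e0[of i] by (simp add: ee_def)
  have cc0: "cc l \<ge> 0" for l using c0[of l] by (simp add: cc_def)
  have eelim: "ee \<longlonglongrightarrow> 0"
    by (rule Lim_transform_eventually[OF e(1)]) (use eventually_ge_at_top[of 1] in \<open>eventually_elim, simp add: ee_def\<close>)
  have ees: "summable (\<lambda>i. ee i / real i)"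
    using e(2) by (rule summable_cong[THEN iffD1, rotated]) (auto simp: ee_def)
  have ccs: "summable (\<lambda>l. real l * cc l)"
    by (rule summable_cong[THEN iffD1, OF _ c]) (use eventually_ge_at_top[of 2] in \<open>eventually_elim, simp add: cc_def\<close>)
  have ccs': "summable cc" by (rule summable_of_summable_mult_nat[OF ccs cc0])
  obtain E where E: "E > 0" and eE: "\<And>i. ee i \<le> E" using tendsto_0_bounded[OF eelim] by blast
  \<comment> \<open>B / i bounds the probability of the values l \<ge> 1:
    \<open>(\<theta> + ee i) / i\<close> for l = 1 and \<open>ee i * suminf cc / i\<close> for l
    \<ge> 2.\<close>
  define B where "B = \<theta> + E * (1 + suminf cc)"
  have scc: "suminf cc \<ge> 0" by (rule suminf_nonneg[OF ccs' cc0])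
  have B: "B > 0" unfolding B_def using \<theta> E scc by (simp add: add_pos_nonneg)
  have p1le: "p i 1 \<le> (\<theta> + ee i) / real i" if "i \<ge> 1" for i
    using close1[OF that] that by (simp add: ee_def field_simps abs_le_iff)
  have p2le: "p i l \<le> ee i * cc l / real i" if "i \<ge> 1" "l \<ge> 2" for i l
    using close2[OF that] that by (simp add: ee_def cc_def field_simps)
  have p0ge: "p i 0 \<ge> 1 - B / real i" if i: "i \<ge> 1" for i
  proof -
    have s: "summable (p i)" "suminf (p i) = 1" using p1[OF i] by (auto simp: sums_iff)
    have "1 = p i 0 + p i 1 + (\<Sum>l. p i (l + 2))"
      using suminf_split_initial_segment[OF s(1), of 2] s(2) by (simp add: numeral_2_eq_2)
    also have "(\<Sum>l. p i (l + 2)) \<le> (\<Sum>l. ee i / real i * cc (l + 2))"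
    proof (rule suminf_le)
      show "p i (l + 2) \<le> ee i / real i * cc (l + 2)" for l using p2le[OF i, of "l + 2"] by simp
      show "summable (\<lambda>l. p i (l + 2))" using summable_ignore_initial_segment[OF s(1), of 2] by simp
      show "summable (\<lambda>l. ee i / real i * cc (l + 2))"
        using summable_ignore_initial_segment[OF ccs', of 2] by (intro summable_mult) simp
    qed
    also have "\<dots> = ee i / real i * (\<Sum>l. cc (l + 2))"
      using summable_ignore_initial_segment[OF ccs', of 2] by (intro suminf_mult) simp
    also have "(\<Sum>l. cc (l + 2)) = suminf cc"
      using suminf_split_initial_segment[OF ccs', of 2] by (simp add: numeral_2_eq_2 cc_def)
    also have "p i 1 \<le> (\<theta> + ee i) / real i" by (rule p1le[OF i])
    finally have "1 - p i 0 \<le> (\<theta> + ee i * (1 + suminf cc)) / real i" by (simp add: field_simps add_divide_distrib)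
    also have "\<dots> \<le> B / real i"
      unfolding B_def using eE[of i] scc by (intro divide_right_mono add_left_mono mult_right_mono) auto
    finally show ?thesis by simp
  qed
  \<comment> \<open>2 B^2 pays for dividing p i 1 by p i 0, and the 1 for the Poisson weights at l
    \<ge> 2.\<close>
  define B1 where "B1 = 2 * B\<^sup>2 + 1"
  define d where "d i = 2 * ee i + B1 / real i" for i
  have B1: "B1 \<ge> 1" by (simp add: B1_def)
  have d0: "d i \<ge> 0" for i using ee0[of i] B1 by (simp add: d_def)
  \<comment> \<open>The three summands serve l < 2, the weights of the structure at l \<ge> 2, and
    the Poisson weights.\<close>
  define k where "k l = (if l < 2 then 1 else 0) + cc l + \<theta> ^ l / fact l" for l :: nat
  have k0: "k l \<ge> 0" for l using cc0[of l] \<theta> by (simp add: k_def)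
  have ex: "fps_summable (fps_exp \<theta>)" by (rule fps_summable_exp) (use \<theta> in simp)
  have fin: "summable (\<lambda>l::nat. if l < 2 then (1::real) else 0)"
    by (rule summable_finite[of "{..<2}"]) auto
  have fin': "summable (\<lambda>l::nat. if l < 2 then real l else 0)"
    by (rule summable_finite[of "{..<2}"]) auto
  have ks: "summable (\<lambda>l. real l * k l)"
  proof -
    have "summable (\<lambda>l. real l * (\<theta> ^ l / fact l))"
    proof (rule summable_comparison_test'[where N = 0])
      show "summable (\<lambda>l. (real l + 1) * fps_exp \<theta> $ l)" using ex by (simp add: fps_summable_def)
      show "norm (real l * (\<theta> ^ l / fact l)) \<le> (real l + 1) * fps_exp \<theta> $ l" for l
        using \<theta> by (simp add: field_simps)
    qed
    from summable_add[OF summable_add[OF fin' ccs] this]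
    show ?thesis by (rule summable_cong[THEN iffD1, rotated]) (auto simp: k_def algebra_simps)
  qed
  have ks': "summable k"
    unfolding k_def using summable_add[OF summable_add[OF fin ccs'] fps_summable_imp_summable(1)[OF ex]] by simp
  have ds: "summable (\<lambda>i. d i / real i)"
  proof -
    have "summable (\<lambda>i. 2 * (ee i / real i) + B1 * inverse (real i ^ 2))"
      by (intro summable_add summable_mult ees inverse_power_summable) simp
    then show ?thesis
      by (rule summable_cong[THEN iffD1, rotated]) (auto simp: d_def power2_eq_square divide_inverse algebra_simps)
  qed
  have "1 / (8 * (suminf k + 1)) > 0" using suminf_nonneg[OF ks' k0] by simp
  from suminf_exist_split[OF this ds] obtain N where
    N: "\<And>n. n \<ge> N \<Longrightarrow> norm (\<Sum>i. d (i + n) / real (i + n)) < 1 / (8 * (suminf k + 1))" by blast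
  \<comment> \<open>N makes the tail of \<open>d i / i\<close> small, and 2 B makes p i 0 \<ge> 1 /
    2 for i > J.\<close>
  define J where "J = max N (max 1 (nat \<lceil>2 * B\<rceil>))"
  have "2 * B \<le> real (nat \<lceil>2 * B\<rceil>)" by (rule real_nat_ceiling_ge)
  also have "\<dots> \<le> real J" unfolding J_def of_nat_le_iff by (intro max.coboundedI2 order_refl)
  finally have JB: "2 * B \<le> real J" .
  have J: "J \<ge> N" "J \<ge> 1" by (auto simp: J_def)
  have half: "p i 0 \<ge> 1 / 2" if "i > J" for i
  proof -
    have "2 * B \<le> real i" "real i > 0" using JB J that by linarith+
    then have "B / real i \<le> 1 / 2" by (simp add: field_simps)
    then show ?thesis using p0ge[of i] that J by linarith
  qed
  define s where "s i = (if i \<le> J then 1 else 1 / p i 0)" for i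
  define t where "t i l = s i * p i l" for i l
  have s: "s i > 0" for i
  proof (cases "i \<le> J")
    case False
    then have "p i 0 > 0" using half[of i] by linarith
    then show ?thesis using False by (simp add: s_def)
  qed (simp add: s_def)
  have s2: "s i \<le> 2" for i using half[of i] by (auto simp: s_def field_simps)
  \<comment> \<open>For i \<le> J the distance of t i 0 from 1 is bounded only by 1, which J^2 / i
    \<ge> 1 covers. Finitely many changes affect neither the limit, nor summability, nor the tail
    beyond J.\<close>
  define \<epsilon> where "\<epsilon> i = d i + (if i \<le> J then (real J)\<^sup>2 else 0)" for i
  have \<epsilon>0: "\<epsilon> i \<ge> 0" for i using d0[of i] by (simp add: \<epsilon>_def)
  have d_le: "d i \<le> \<epsilon> i" for i by (simp add: \<epsilon>_def)
  have ple1: "p i l \<le> 1" if "i \<ge> 1" for i l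
    using p1[OF that] sum_le_suminf[of "p i" "{l}"] p0 by (auto simp: sums_iff)
  have key1: "\<bar>t i 1 - \<theta> / real i\<bar> \<le> d i / real i" if i: "i \<ge> 1" for i
  proof -
    have 1: "\<bar>p i 1 - \<theta> / real i\<bar> \<le> ee i / real i"
    proof -
      have "\<bar>p i 1 - \<theta> / real i\<bar> = \<bar>real i * p i 1 - \<theta>\<bar> / real i"
      proof -
        have "p i 1 - \<theta> / real i = (real i * p i 1 - \<theta>) / real i" using i by (simp add: field_simps)
        then show ?thesis by (simp only: abs_divide abs_of_nat)
      qed
      then show ?thesis using close1[OF i] i by (simp add: ee_def divide_right_mono)
    qed
    have 2: "\<bar>t i 1 - p i 1\<bar> \<le> 2 * B\<^sup>2 / real i / real i"
    proof (cases "i \<le> J")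
      case False
      then have h: "p i 0 \<ge> 1 / 2" by (intro half) simp
      \<comment> \<open>Both p i 1 and 1 - p i 0 are O(1 / i), so the renormalisation error is of
        second order.\<close>
      have "t i 1 - p i 1 = p i 1 * ((1 - p i 0) / p i 0)" using False h by (simp add: t_def s_def field_simps)
      moreover have "0 \<le> \<dots>" using p0 ple1[OF i, of 0] by simp
      moreover have "p i 1 * ((1 - p i 0) / p i 0) \<le> (B / real i) * (2 * (B / real i))"
      proof (intro mult_mono)
        have "(\<theta> + ee i) / real i \<le> B / real i"
          unfolding B_def using eE[of i] scc E by (intro divide_right_mono) (auto simp: distrib_left intro!: add_increasing2)
        then show "p i 1 \<le> B / real i" using p1le[OF i] by linarith
        have "(1 - p i 0) / p i 0 \<le> (1 - p i 0) / (1 / 2)"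
          using h ple1[OF i, of 0] by (intro divide_left_mono) auto
        also have "\<dots> \<le> 2 * (B / real i)" using p0ge[OF i] by simp
        finally show "(1 - p i 0) / p i 0 \<le> 2 * (B / real i)" .
        show "0 \<le> (1 - p i 0) / p i 0" using p0 ple1[OF i, of 0] by simp
      qed (use B in auto)
      ultimately have "\<bar>t i 1 - p i 1\<bar> \<le> (B / real i) * (2 * (B / real i))" by (simp only: abs_of_nonneg)
      also have "\<dots> = 2 * B\<^sup>2 / real i / real i" by (simp add: power2_eq_square)
      finally show ?thesis .
    qed (use B in \<open>simp add: t_def s_def\<close>)
    have "\<bar>t i 1 - \<theta> / real i\<bar> \<le> ee i / real i + 2 * B\<^sup>2 / real i / real i" using 1 2 by linarith
    also have "\<dots> = (ee i + 2 * B\<^sup>2 / real i) / real i" by (simp add: add_divide_distrib)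
    also have "\<dots> \<le> d i / real i"
      unfolding d_def B1_def using ee0[of i] by (intro divide_right_mono add_mono divide_right_mono) auto
    finally show ?thesis .
  qed
  have key2: "\<bar>t i l - (\<theta> / real i) ^ l / fact l\<bar> \<le> d i * (cc l + \<theta> ^ l / fact l) / real i" if i: "i \<ge> 1" and l: "l \<ge> 2" for i l
  proof -
    have "t i l \<le> 2 * (ee i * cc l / real i)"
      unfolding t_def using s2[of i] s[of i] p2le[OF i l] p0 by (intro mult_mono) auto
    moreover have "t i l \<ge> 0" unfolding t_def using s[of i] p0 by simp
    moreover have "(\<theta> / real i) ^ l / fact l \<ge> 0" using \<theta> by simp
    ultimately have "\<bar>t i l - (\<theta> / real i) ^ l / fact l\<bar> \<le> 2 * (ee i * cc l / real i) + (\<theta> ^ l / fact l) / real i / real i"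
      using fact_power_div_le[OF \<theta> i l] by linarith
    also have "\<dots> = (2 * ee i * cc l + (1 / real i) * (\<theta> ^ l / fact l)) / real i" by (simp add: add_divide_distrib mult_ac)
    also have "\<dots> \<le> (d i * cc l + d i * (\<theta> ^ l / fact l)) / real i"
    proof (intro divide_right_mono add_mono mult_right_mono)
      show "2 * ee i \<le> d i" using B1 by (simp add: d_def)
      have "1 / real i \<le> B1 / real i" using B1 by (intro divide_right_mono) auto
      then show "1 / real i \<le> d i" using ee0[of i] by (simp add: d_def)
    qed (use cc0[of l] \<theta> in auto)
    finally show ?thesis by (simp add: distrib_left)
  qed
  have "log_perturbation \<theta> J t \<epsilon> k"
  proof unfold_locales
    show "\<theta> > 0" by (rule \<theta>)
    show "t i l \<ge> 0" for i l unfolding t_def using s[of i] p0 by simp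
    show t0: "t i 0 = 1" if "i > J" for i using half[OF that] that by (auto simp: t_def s_def)
    show "t i 0 \<le> 1" if "i \<ge> 1" for i
      using ple1[OF that, of 0] t0[of i] by (cases "i \<le> J") (auto simp: t_def s_def)
    show "\<exists>l. t i l > 0" if "i \<ge> 1" for i
    proof (rule ccontr)
      assume "\<not> ?thesis"
      then have "p i l = 0" for l using s[of i] p0[of i l] by (auto simp: t_def not_less mult_le_0_iff order_antisym)
      then have "p i = (\<lambda>_. 0)" by blast
      then show False using p1[OF that] sums_unique2[OF p1[OF that], of 0] by simp
    qed
    show "\<bar>t i l - fps_exp (\<theta> / real i) $ l\<bar> \<le> \<epsilon> i * k l / real i" if i: "i \<ge> 1" for i l
    proof -
      consider "l = 0" | "l = 1" | "l \<ge> 2" by linarith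
      then show ?thesis
      proof cases
        case 1
        show ?thesis
        proof (cases "i \<le> J")
          case True
          have "\<bar>t i 0 - 1\<bar> \<le> 1" using ple1[OF i, of 0] p0[of i 0] True by (simp add: t_def s_def)
          also have "1 \<le> (real J)\<^sup>2 / real i"
          proof -
            have "real i * 1 \<le> real J * real J" using True J by (intro mult_mono) auto
            then show ?thesis using i by (simp add: power2_eq_square)
          qed
          also have "\<dots> \<le> \<epsilon> i / real i" using True d0[of i] by (intro divide_right_mono) (auto simp: \<epsilon>_def)
          also have "\<dots> \<le> \<epsilon> i * k 0 / real i"
            using \<epsilon>0[of i] by (intro divide_right_mono) (auto simp: k_def cc_def)
          finally show ?thesis using 1 by simp
        next
          case False
          then show ?thesis using 1 t0[of i] \<epsilon>0[of i] k0[of 0] by simp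
        qed
      next
        case 2
        have "d i * 1 \<le> \<epsilon> i * k 1"
          using d_le[of i] \<epsilon>0[of i] d0[of i] \<theta> by (intro mult_mono) (auto simp: k_def cc_def)
        then have "d i / real i \<le> \<epsilon> i * k 1 / real i" by (intro divide_right_mono) auto
        then show ?thesis using key1[OF i] 2 by simp
      next
        case 3
        have "d i * (cc l + \<theta> ^ l / fact l) \<le> \<epsilon> i * k l"
          using 3 d_le[of i] \<epsilon>0[of i] cc0[of l] \<theta> by (intro mult_mono) (auto simp: k_def)
        then have "d i * (cc l + \<theta> ^ l / fact l) / real i \<le> \<epsilon> i * k l / real i" by (intro divide_right_mono) auto
        then show ?thesis using key2[OF i 3] by simp
      qed
    qed
    show "\<epsilon> i \<ge> 0" "k l \<ge> 0" for i l by (rule \<epsilon>0, rule k0)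
    have ev: "\<forall>\<^sub>F i in sequentially. d i = \<epsilon> i"
      using eventually_gt_at_top[of J] by eventually_elim (simp add: \<epsilon>_def)
    have "d \<longlonglongrightarrow> 2 * 0 + 0" unfolding d_def by (intro tendsto_intros eelim lim_const_over_n)
    then show "\<epsilon> \<longlonglongrightarrow> 0" using Lim_transform_eventually[OF _ ev] by simp
    show "summable (\<lambda>i. \<epsilon> i / real i)"
      by (rule summable_cong[THEN iffD1, OF _ ds]) (use ev in \<open>eventually_elim, simp\<close>)
    show "summable (\<lambda>l. real l * k l)" by (rule ks)
    have "(\<Sum>i. \<epsilon> (i + Suc J) / real (i + Suc J)) = (\<Sum>i. d (i + Suc J) / real (i + Suc J))"
      by (simp add: \<epsilon>_def)
    also have "\<dots> \<le> 1 / (8 * (suminf k + 1))" using N[of "Suc J"] J by simp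
    finally have "(\<Sum>i. \<epsilon> (i + Suc J) / real (i + Suc J)) * suminf k \<le> 1 / (8 * (suminf k + 1)) * suminf k"
      by (intro mult_right_mono suminf_nonneg ks' k0)
    also have "\<dots> \<le> 1 / 8" using suminf_nonneg[OF ks' k0] by (simp add: field_simps)
    finally show "(\<Sum>i. \<epsilon> (i + Suc J) / real (i + Suc J)) * suminf k \<le> 1 / 8" .
  qed
  then show ?thesis by (rule that[where s = s]) (auto simp: s t_def)
qed

theorem theorem4p2:
  fixes \<theta> :: real and M :: "'a measure" and P :: "nat \<Rightarrow> (nat \<Rightarrow> nat) pmf"
  assumes "\<theta> > 0"
    and "uniform_logarithmic_structure M \<theta> P"
  shows "asymptotically_Ewens \<theta> P"
proof -
  from assms(2) obtain Y where pm: "partition_measures P" and "prob_space M"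
    and ind: "prob_space.indep_vars M (\<lambda>_. count_space UNIV) Y {1..}"
    and cr: "conditioning_relation M Y P" and "uniform_logarithmic_condition M Y \<theta>"
    unfolding uniform_logarithmic_structure_def by blast
  then obtain e c :: "nat \<Rightarrow> real" where ec: "\<forall>i\<ge>1. e i \<ge> 0" "\<forall>l\<ge>2. c l \<ge> 0"
    "e \<longlonglongrightarrow> 0" "summable (\<lambda>i. e i / real i)" "summable (\<lambda>l. real l * c l)"
    "\<forall>i\<ge>1. \<bar>real i * \<P>(\<omega> in M. Y i \<omega> = 1) - \<theta>\<bar> \<le> e i"
    "\<forall>i\<ge>1. \<forall>l\<ge>2. real i * \<P>(\<omega> in M. Y i \<omega> = l) \<le> e i * c l"
    unfolding uniform_logarithmic_condition_def by blast
  interpret M: prob_space M by fact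
  define p where "p i l = \<P>(\<omega> in M. Y i \<omega> = l)" for i l
  have psums: "p i sums 1" if i: "i \<ge> 1" for i
  proof -
    have rv: "Y i \<in> measurable M (count_space UNIV)"
      using ind i by (auto simp: M.indep_vars_def)
    define A where "A l = Y i -` {l} \<inter> space M" for l
    have "range A \<subseteq> sets M" using rv unfolding A_def by (auto intro: measurable_sets)
    moreover have "disjoint_family A" unfolding A_def disjoint_family_on_def by auto
    ultimately have "(\<lambda>l. M.prob (A l)) sums M.prob (\<Union>l. A l)" by (rule M.finite_measure_UNION)
    moreover have "(\<Union>l. A l) = space M" by (auto simp: A_def)
    moreover have "A l = {\<omega> \<in> space M. Y i \<omega> = l}" for l by (auto simp: A_def)
    ultimately show ?thesis by (simp add: p_def[abs_def] M.prob_space)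
  qed
  have "\<exists>J t e' c' s. log_perturbation \<theta> J t e' c' \<and> (\<forall>i. s i > 0) \<and> (\<forall>i\<ge>1. \<forall>l. t i l = s i * p i l)"
  proof (rule log_perturbation_exists[OF assms(1), of p e c])
    show "p i sums 1" if "i \<ge> 1" for i by (rule psums[OF that])
    show "\<bar>real i * p i 1 - \<theta>\<bar> \<le> e i" if "i \<ge> 1" for i using ec(6) that unfolding p_def by blast
    show "real i * p i l \<le> e i * c l" if "i \<ge> 1" "l \<ge> 2" for i l using ec(7) that unfolding p_def by blast
    show "p i l \<ge> 0" for i l by (simp add: p_def)
    show "e i \<ge> 0" if "i \<ge> 1" for i using ec(1) that by blast
    show "c l \<ge> 0" if "l \<ge> 2" for l using ec(2) that by blast
    show "e \<longlonglongrightarrow> 0" "summable (\<lambda>i. e i / real i)" "summable (\<lambda>l. real l * c l)" by (fact ec)+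
    fix J t e' c' s
    assume "log_perturbation \<theta> J t e' c'" "\<And>i. s i > 0" "\<And>i l. i \<ge> 1 \<Longrightarrow> t i l = s i * p i l"
    then show "\<exists>J t e' c' s. log_perturbation \<theta> J t e' c' \<and> (\<forall>i. s i > 0) \<and> (\<forall>i\<ge>1. \<forall>l. t i l = s i * p i l)"
      by metis
  qed
  then obtain J t e' c' s where lp: "log_perturbation \<theta> J t e' c'" and s: "\<And>i. s i > 0"
    and t: "\<And>i l. i \<ge> 1 \<Longrightarrow> t i l = s i * p i l" by blast
  interpret log_perturbation \<theta> J t e' c' by (rule lp)
  \<comment> \<open>The product of the s i depends on n only, so it cancels against
    \<open>perturbed_Z\<close>.\<close>
  have weight: "eta \<alpha> * ewens_weight \<theta> n \<alpha> = (\<Prod>i=1..n. s i) * (\<Prod>i=1..n. p i (\<alpha> i))"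
    if "\<alpha> \<in> partitions_of n" for n \<alpha>
  proof -
    have "eta \<alpha> * ewens_weight \<theta> n \<alpha> = (\<Prod>i=1..n. mix {1..n} i (\<alpha> i))"
      using prod_mix_atMost[of n n \<alpha>] parts_sum_partitions_of[OF that] by (simp add: eta_def)
    also have "\<dots> = (\<Prod>i=1..n. s i * p i (\<alpha> i))"
      by (intro prod.cong) (auto simp: mix_def t)
    finally show ?thesis by (simp add: prod.distrib)
  qed
  have sp: "(\<Prod>i=1..n. s i) > 0" for n by (intro prod_pos) (simp add: s)
  have Z: "perturbed_Z \<theta> eta n = (\<Prod>i=1..n. s i) * \<P>(\<omega> in M. (\<Sum>i=1..n. i * Y i \<omega>) = n)" if "n \<ge> 1" for n
    unfolding perturbed_Z_def M.prob_weighted_sum[OF ind that] p_def[symmetric] sum_distrib_left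
    by (intro sum.cong refl weight)
  have Zpos: "perturbed_Z \<theta> eta n > 0" if "n \<ge> 1" for n
    using cr that sp[of n] by (simp add: Z conditioning_relation_def)
  have pmf: "pmf (P n) \<alpha> = perturbed_prob \<theta> eta n \<alpha>" if n: "n \<ge> 1" and \<alpha>: "\<alpha> \<in> partitions_of n" for n \<alpha>
  proof -
    have eq: "{\<omega> \<in> space M. (\<forall>i\<in>{1..n}. Y i \<omega> = \<alpha> i) \<and> (\<Sum>i=1..n. i * Y i \<omega>) = n} = {\<omega> \<in> space M. \<forall>i\<in>{1..n}. Y i \<omega> = \<alpha> i}"
    proof -
      have "(\<Sum>i=1..n. i * Y i \<omega>) = n" if "\<forall>i\<in>{1..n}. Y i \<omega> = \<alpha> i" for \<omega>
      proof -
        have "(\<Sum>i=1..n. i * Y i \<omega>) = (\<Sum>i=1..n. i * \<alpha> i)" using that by (intro sum.cong) auto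
        then show ?thesis using \<alpha> by (simp add: partitions_of_def)
      qed
      then show ?thesis by blast
    qed
    have "pmf (P n) \<alpha> = \<P>(\<omega> in M. (\<forall>i\<in>{1..n}. Y i \<omega> = \<alpha> i) \<bar> (\<Sum>i=1..n. i * Y i \<omega>) = n)"
      using cr n \<alpha> unfolding conditioning_relation_def by blast
    also have "\<dots> = (\<Prod>i=1..n. p i (\<alpha> i)) / \<P>(\<omega> in M. (\<Sum>i=1..n. i * Y i \<omega>) = n)"
      unfolding cond_prob_def eq M.joint_law(1)[OF ind n] p_def ..
    also have "\<dots> = (eta \<alpha> * ewens_weight \<theta> n \<alpha>) / perturbed_Z \<theta> eta n"
      unfolding Z[OF n] weight[OF \<alpha>]
      by (rule mult_divide_mult_cancel_left[symmetric]) (metis sp less_irrefl)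
    finally show ?thesis by (simp add: perturbed_prob_def)
  qed
  obtain g h where "L1_limit F (\<lambda>n. eta_trunc eta n n) g"
    "\<And>m. m \<ge> 1 \<Longrightarrow> L1_limit F (\<lambda>n. eta_trunc eta n m) (h m)"
    "L1_limit F h g" "expectation g > 0"
    using eta_limits by blast
  then show ?thesis
    unfolding asymptotically_Ewens_def using pm eta_nonneg Zpos pmf by blast
qed

end
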